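(* Let $k\ge 3$, let $c_1,\dots,c_k\in\mathbb{C}^*\setminus\{1,-1\}$, let $C_i\subset SL_2(\mathbb{C})$ be the conjugacy class of $\mathrm{diag}(c_i,c_i^{-1})$, and assume that for every $1\le i\le k$ and all signs $\epsilon_j\in\{1,-1\}$, neither $\prod_{j=1}^{i}c_j^{\epsilon_j}$ nor $\prod_{j=i}^{k}c_j^{\epsilon_j}$ is equal to $\pm1$. Let $\mathbf{Q}$ be the space of pairs $(t,[p:q])\in\mathbb{A}^1\times\mathbb{P}^1$ such that $t\neq 2,-2$ and $p^2+tpq+q^2\neq 0$. Let $M'$ be the open subset of the character variety $M(S;C_\cdot)$ consisting of local systems whose monodromy around each circle $\rho_i$ ($2\le i\le k-2$) has trace different from $2,-2$ and whose restriction to each $S_i$ ($2\le i\le k-1$) is stable. Then there is an isomorphism of algebraic varieties $$M'\cong\mathbf{Q}^{k-3}.$$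
   Context: $S$ is a $2$-sphere with $k$ open disks removed, with boundary circles $\xi_1,\dots,\xi_k$; $\pi_1(S)$ is generated by loops $\gamma_1,\dots,\gamma_k$ around them with $\gamma_1\cdots\gamma_k=1$. $M(S;C_\cdot)$ is the quotient of $\mathrm{Rep}=\{(A_1,\dots,A_k):A_i\in C_i,\ A_1\cdots A_k=1\}$ by simultaneous conjugation of $PGL_2$ (under the genericity hypothesis the action is free and the quotient is a smooth affine variety, the spectrum of the invariant ring). $S$ is cut along circles $\rho_2,\dots,\rho_{k-2}$ into three-holed spheres $S_2,\dots,S_{k-1}$, where $S_i$ has boundary circles $\rho_{i-1},\xi_i,\rho_i$ (with $\rho_1=\xi_1$, $\rho_{k-1}=\xi_k$). Concretely, the monodromy around $\rho_i$ is $R_i=A_{i+1}\cdots A_k=(A_1\cdots A_i)^{-1}$, and the restriction of the local system to $S_i$ is given by $A_i$ and $R_i$ (the monodromy around $\rho_{i-1}$ being $A_iR_i$). The restriction to $S_i$ is unstable if it has a rank $1$ subsystem on which the monodromy around $\xi_i$ is $c_i^{-1}$, i.e. there is a line $L\subset\mathbb{C}^2$ invariant under $A_i$ and $R_i$ with $A_i|_L=c_i^{-1}$; it is stable otherwise. *)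

theory Defs
  imports "HOL-Analysis.Analysis"
begin

section \<open>Complex algebraic varieties as spaces with functions\<close>

text \<open>
  A variety over the complex numbers is given, as in classical algebraic geometry, by its set of
  closed points with the Zariski topology and, for every open set, the complex-valued regular
  functions on it. Functions are total in HOL; membership of \<open>f\<close> in \<open>regular X U\<close> only depends
  on the values of \<open>f\<close> on \<open>U\<close>.
\<close>

record 'a variety =
  zariski :: "'a topology"
  regular :: "'a set \<Rightarrow> ('a \<Rightarrow> complex) set"

definition morphism :: "'a variety \<Rightarrow> 'b variety \<Rightarrow> ('a \<Rightarrow> 'b) \<Rightarrow> bool" where
  "morphism X Y \<phi> \<longleftrightarrow>
     continuous_map (zariski X) (zariski Y) \<phi> \<and>
     (\<forall>U f. openin (zariski Y) U \<and> f \<in> regular Y U \<longrightarrow>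
        f \<circ> \<phi> \<in> regular X {x \<in> topspace (zariski X). \<phi> x \<in> U})"

definition isomorphic_varieties :: "'a variety \<Rightarrow> 'b variety \<Rightarrow> bool" where
  "isomorphic_varieties X Y \<longleftrightarrow>
     (\<exists>\<phi> \<psi>. morphism X Y \<phi> \<and> morphism Y X \<psi> \<and>
        (\<forall>x \<in> topspace (zariski X). \<psi> (\<phi> x) = x) \<and>
        (\<forall>y \<in> topspace (zariski Y). \<phi> (\<psi> y) = y))"

definition open_subvariety :: "'a variety \<Rightarrow> 'a set \<Rightarrow> 'a variety" where
  "open_subvariety X U = \<lparr>zariski = subtopology (zariski X) U, regular = regular X\<rparr>"

text \<open>
  All varieties below are built from a family of local functions \<open>(W, h)\<close>, where \<open>h\<close> is a function
  on \<open>W\<close>: the sets where such an \<open>h\<close> does not vanish generate the topology, and the regular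
  functions are those that are locally a quotient of two members of the family.
\<close>

definition variety_of_fractions :: "('a set \<times> ('a \<Rightarrow> complex)) set \<Rightarrow> 'a variety" where
  "variety_of_fractions \<G> =
     \<lparr>zariski = topology_generated_by {{x \<in> W. h x \<noteq> 0} | W h. (W, h) \<in> \<G>},
      regular = (\<lambda>U. {f. \<forall>x\<in>U. \<exists>W g h. (W, g) \<in> \<G> \<and> (W, h) \<in> \<G> \<and> x \<in> W \<and> h x \<noteq> 0 \<and>
                            (\<forall>y\<in>U \<inter> W. h y \<noteq> 0 \<longrightarrow> f y = g y / h y)})\<rparr>"

inductive_set generated_algebra :: "('a \<Rightarrow> complex) set \<Rightarrow> ('a \<Rightarrow> complex) set"
  for S :: "('a \<Rightarrow> complex) set" where
  const: "(\<lambda>_. a) \<in> generated_algebra S"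
| gen: "f \<in> S \<Longrightarrow> f \<in> generated_algebra S"
| add: "f \<in> generated_algebra S \<Longrightarrow> g \<in> generated_algebra S \<Longrightarrow> (\<lambda>x. f x + g x) \<in> generated_algebra S"
| mult: "f \<in> generated_algebra S \<Longrightarrow> g \<in> generated_algebra S \<Longrightarrow> (\<lambda>x. f x * g x) \<in> generated_algebra S"

text \<open>
  The affine variety with set of points \<open>X\<close> and coordinate ring \<open>A\<close>; this is the maximal spectrum
  of \<open>A\<close> whenever evaluation identifies \<open>X\<close> with the maximal ideals of \<open>A\<close>.
\<close>

definition affine_variety :: "'a set \<Rightarrow> ('a \<Rightarrow> complex) set \<Rightarrow> 'a variety" where
  "affine_variety X A = variety_of_fractions {(X, f) | f. f \<in> A}"

text \<open>
  Products carry the topology generated by the non-vanishing loci of the functions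
  \<open>\<Sum> f\<^sub>i(x) g\<^sub>i(y)\<close> on \<open>U \<times> V\<close>, which is finer than the product of the Zariski topologies.
\<close>

definition product_variety :: "'a variety \<Rightarrow> 'b variety \<Rightarrow> ('a \<times> 'b) variety" where
  "product_variety X Y = variety_of_fractions
     {(U \<times> V, h) | U V h. openin (zariski X) U \<and> openin (zariski Y) V \<and>
        h \<in> generated_algebra ({\<lambda>z. f (fst z) | f. f \<in> regular X U} \<union>
                               {\<lambda>z. g (snd z) | g. g \<in> regular Y V})}"

definition power_variety :: "'a variety \<Rightarrow> nat \<Rightarrow> (nat \<Rightarrow> 'a) variety" where
  "power_variety X n = variety_of_fractions
     {(PiE {..<n} U, h) | U h. (\<forall>i<n. openin (zariski X) (U i)) \<and>
        h \<in> generated_algebra {\<lambda>x. f (x i) | i f. i < n \<and> f \<in> regular X (U i)}}"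


section \<open>The affine line, the projective line and the space \<open>\<^bold>Q\<close>\<close>

definition affine_line :: "complex variety" where
  "affine_line = affine_variety UNIV (generated_algebra {\<lambda>z. z})"

definition is_line :: "(complex^2) set \<Rightarrow> bool" where
  "is_line L \<longleftrightarrow> vec.subspace L \<and> vec.dim L = 1"

text \<open>The point \<open>[v $ 1 : v $ 2]\<close> of the projective line, for \<open>v \<noteq> 0\<close>.\<close>

definition proj_point :: "complex^2 \<Rightarrow> (complex^2) set" where
  "proj_point v = vec.span {v}"

definition binary_form :: "nat \<Rightarrow> (complex^2 \<Rightarrow> complex) \<Rightarrow> bool" where
  "binary_form d F \<longleftrightarrow> (\<exists>a. \<forall>v. F v = (\<Sum>j\<le>d. a j * (v $ 1) ^ j * (v $ 2) ^ (d - j)))"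

definition projective_line :: "(complex^2) set variety" where
  "projective_line = variety_of_fractions
     {(W, h) | W h. \<exists>d F G. binary_form d F \<and> binary_form d G \<and>
        W = {proj_point v | v. v \<noteq> 0 \<and> G v \<noteq> 0} \<and>
        (\<forall>v. v \<noteq> 0 \<and> G v \<noteq> 0 \<longrightarrow> h (proj_point v) = F v / G v)}"

definition Q_points :: "(complex \<times> (complex^2) set) set" where
  "Q_points = {(t, proj_point (vector [p, q])) | t p q.
     (p, q) \<noteq> (0, 0) \<and> t \<noteq> 2 \<and> t \<noteq> -2 \<and> p\<^sup>2 + t * p * q + q\<^sup>2 \<noteq> 0}"

definition Q_variety :: "(complex \<times> (complex^2) set) variety" where
  "Q_variety = open_subvariety (product_variety affine_line projective_line) Q_points"


section \<open>The character variety of the punctured sphere\<close>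

text \<open>
  A local system is a tuple of matrices \<open>A 1, \<dots>, A k\<close>, encoded as a function that is
  \<open>undefined\<close> outside \<open>{1..k}\<close>. The matrix product is \<open>**\<close>; the operation \<open>*\<close> on
  \<open>complex^2^2\<close> is componentwise.
\<close>

definition diag2 :: "complex \<Rightarrow> complex \<Rightarrow> complex^2^2" where
  "diag2 a b = vector [vector [a, 0], vector [0, b]]"

definition conj_class :: "complex \<Rightarrow> (complex^2^2) set" where
  "conj_class a = {P ** diag2 a (inverse a) ** matrix_inv P | P. det P = 1}"

definition ordered_prod :: "(nat \<Rightarrow> complex^2^2) \<Rightarrow> nat \<Rightarrow> nat \<Rightarrow> complex^2^2" where
  "ordered_prod A m n = foldr (\<lambda>i P. A i ** P) [m..<Suc n] (mat 1)"

definition Rep :: "nat \<Rightarrow> (nat \<Rightarrow> complex) \<Rightarrow> (nat \<Rightarrow> complex^2^2) set" where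
  "Rep k c = {A \<in> PiE {1..k} (\<lambda>i. conj_class (c i)). ordered_prod A 1 k = mat 1}"

text \<open>
  The action of \<open>PGL\<^sub>2\<close> is written as the action of \<open>GL\<^sub>2\<close>, in which scalar matrices act trivially.
\<close>

definition conj_tuple :: "nat \<Rightarrow> complex^2^2 \<Rightarrow> (nat \<Rightarrow> complex^2^2) \<Rightarrow> (nat \<Rightarrow> complex^2^2)" where
  "conj_tuple k P A = (\<lambda>i\<in>{1..k}. P ** A i ** matrix_inv P)"

definition orbit :: "nat \<Rightarrow> (nat \<Rightarrow> complex^2^2) \<Rightarrow> (nat \<Rightarrow> complex^2^2) set" where
  "orbit k A = {conj_tuple k P A | P. invertible P}"

definition polynomial_functions :: "nat \<Rightarrow> ((nat \<Rightarrow> complex^2^2) \<Rightarrow> complex) set" where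
  "polynomial_functions k = generated_algebra {\<lambda>A. A i $ a $ b | i a b. i \<in> {1..k}}"

definition invariant_functions :: "nat \<Rightarrow> (nat \<Rightarrow> complex) \<Rightarrow> ((nat \<Rightarrow> complex^2^2) \<Rightarrow> complex) set" where
  "invariant_functions k c = {f \<in> polynomial_functions k.
     \<forall>A \<in> Rep k c. \<forall>P. invertible P \<longrightarrow> f (conj_tuple k P A) = f A}"

definition character_variety :: "nat \<Rightarrow> (nat \<Rightarrow> complex) \<Rightarrow> (nat \<Rightarrow> complex^2^2) set variety" where
  "character_variety k c = affine_variety (orbit k ` Rep k c)
     {F. \<exists>f \<in> invariant_functions k c. \<forall>A \<in> Rep k c. F (orbit k A) = f A}"

text \<open>The monodromy around the cutting circle \<open>\<rho>\<^sub>i\<close>.\<close>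

definition cut_monodromy :: "nat \<Rightarrow> (nat \<Rightarrow> complex^2^2) \<Rightarrow> nat \<Rightarrow> complex^2^2" where
  "cut_monodromy k A i = ordered_prod A (i + 1) k"

definition unstable_restriction ::
  "nat \<Rightarrow> (nat \<Rightarrow> complex) \<Rightarrow> (nat \<Rightarrow> complex^2^2) \<Rightarrow> nat \<Rightarrow> bool" where
  "unstable_restriction k c A i \<longleftrightarrow>
     (\<exists>L. is_line L \<and> (\<forall>v\<in>L. A i *v v \<in> L) \<and> (\<forall>v\<in>L. cut_monodromy k A i *v v \<in> L) \<and>
          (\<forall>v\<in>L. A i *v v = inverse (c i) *s v))"

definition M_prime :: "nat \<Rightarrow> (nat \<Rightarrow> complex) \<Rightarrow> (nat \<Rightarrow> complex^2^2) set set" where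
  "M_prime k c = orbit k ` {A \<in> Rep k c.
     (\<forall>i\<in>{2..k-2}. trace (cut_monodromy k A i) \<noteq> 2 \<and> trace (cut_monodromy k A i) \<noteq> -2) \<and>
     (\<forall>i\<in>{2..k-1}. \<not> unstable_restriction k c A i)}"

definition generic_eigenvalues :: "nat \<Rightarrow> (nat \<Rightarrow> complex) \<Rightarrow> bool" where
  "generic_eigenvalues k c \<longleftrightarrow>
     (\<forall>i\<in>{1..k}. \<forall>\<epsilon> \<in> {1..k} \<rightarrow> {1, -1 :: int}.
        (\<Prod>j=1..i. c j powi \<epsilon> j) \<notin> {1, -1} \<and> (\<Prod>j=i..k. c j powi \<epsilon> j) \<notin> {1, -1})"

end

theory Submission imports Defs begin

text \<open>
  Write \<open>R\<^sub>i = A\<^sub>i\<^sub>+\<^sub>1 \<cdots> A\<^sub>k\<close> and let \<open>e\<^sub>i\<close> span the eigenline of \<open>A\<^sub>i\<close> for \<open>c\<^sub>i\<^sup>-\<^sup>1\<close>. Stability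
  of the restriction to \<open>S\<^sub>i\<close> says that \<open>e\<^sub>i\<close> is a cyclic vector for \<open>R\<^sub>i\<^sub>-\<^sub>1\<close>, equivalently for
  \<open>R\<^sub>i\<close>. In the basis \<open>(e\<^sub>i, R\<^sub>i\<^sub>-\<^sub>1 e\<^sub>i)\<close> the matrix \<open>R\<^sub>i\<^sub>-\<^sub>1\<close> is a companion matrix and \<open>A\<^sub>i\<close> is upper
  triangular with entries determined by \<open>c\<^sub>i\<close>, \<open>tr R\<^sub>i\<^sub>-\<^sub>1\<close> and \<open>tr R\<^sub>i\<close>; so a stable restriction
  has no moduli beyond the two traces, and its only automorphisms are scalars. Two neighbouring
  pieces are compared by \<open>e\<^sub>i\<^sub>+\<^sub>1 = (p\<^sub>i + q\<^sub>i R\<^sub>i) e\<^sub>i\<close>, which is well defined up to a common scalar of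
  \<open>(p\<^sub>i, q\<^sub>i)\<close>, and \<open>e\<^sub>i\<^sub>+\<^sub>1\<close> is again cyclic exactly when \<open>det (p\<^sub>i + q\<^sub>i R\<^sub>i) = p\<^sub>i\<^sup>2 + (tr R\<^sub>i) p\<^sub>i q\<^sub>i + q\<^sub>i\<^sup>2\<close>
  is nonzero. Hence \<open>(tr R\<^sub>i, [p\<^sub>i : q\<^sub>i])\<close> for \<open>2 \<le> i \<le> k - 2\<close> are the required coordinates.

  The line \<open>[p\<^sub>i : q\<^sub>i]\<close> is the kernel of \<open>(p, q) \<mapsto> (A\<^sub>i\<^sub>+\<^sub>1 - c\<^sub>i\<^sub>+\<^sub>1\<^sup>-\<^sup>1) (p + q R\<^sub>i) (A\<^sub>i - c\<^sub>i)\<close>. All these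
  matrices are multiples of one matrix of rank one, so multiplying by a word in the \<open>A\<^sub>j\<close> and taking
  traces gives homogeneous coordinates of the line by invariant functions. Genericity of the \<open>c\<^sub>j\<close>
  makes the representation irreducible, which guarantees that some word of length at most one works.
\<close>

section \<open>Spaces with functions\<close>

text \<open>The two directions meet different obstacles. Eigenvectors are not polynomial in the
  matrices, and representatives of orbits are chosen by \<open>SOME\<close>; so the forward map is
  written with traces of polynomial matrices, which are constant on orbits. Backwards, a point of Q
  gives a line \<open>[p : q]\<close> but no vector. The vector enters only as a change of frame;
  rescaling it multiplies all later frames by a scalar, and conjugation does not see scalars. Hence
  the glued tuple depends on the lines alone and may be computed with a normalised vector on each
  chart. The glued tuple is found through its cut monodromies: R_(i-1) is a companion matrix in the
  frame of S_i, and A_i = R_(i-1) R_i^-1 with R_0 = R_k = 1, so that the relation holds by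
  telescoping. The outer traces are not free, because R_1 is inverse to A_1 and R_(k-1) = A_k; they
  are c_1 + 1/c_1 and c_k + 1/c_k, which leaves k - 3 circles with coordinates.\<close>

locale function_sheaf =
  fixes X :: "'a variety"
  assumes regular_const: "openin (zariski X) U \<Longrightarrow> (\<lambda>_. a) \<in> regular X U"
    and regular_add: "f \<in> regular X U \<Longrightarrow> g \<in> regular X U \<Longrightarrow> (\<lambda>x. f x + g x) \<in> regular X U"
    and regular_mult: "f \<in> regular X U \<Longrightarrow> g \<in> regular X U \<Longrightarrow> (\<lambda>x. f x * g x) \<in> regular X U"
    and regular_restrict: "f \<in> regular X U \<Longrightarrow> V \<subseteq> U \<Longrightarrow> f \<in> regular X V"
    and open_nonvanishing:
      "openin (zariski X) U \<Longrightarrow> f \<in> regular X U \<Longrightarrow> openin (zariski X) {x \<in> U. f x \<noteq> 0}"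
    and regular_inverse: "openin (zariski X) U \<Longrightarrow> f \<in> regular X U \<Longrightarrow>
      (\<lambda>x. inverse (f x)) \<in> regular X {x \<in> U. f x \<noteq> 0}"
    and regular_local: "openin (zariski X) U \<Longrightarrow>
      (\<And>x. x \<in> U \<Longrightarrow> \<exists>V g. openin (zariski X) V \<and> x \<in> V \<and> g \<in> regular X V \<and>
          (\<forall>y \<in> U \<inter> V. f y = g y)) \<Longrightarrow> f \<in> regular X U"
begin

text \<open>Taking \<open>V = U\<close> in the locality axiom turns it into independence of the
  values outside \<open>U\<close>.\<close>

lemma regular_cong:
  assumes "openin (zariski X) U" "f \<in> regular X U" "\<And>x. x \<in> U \<Longrightarrow> g x = f x"
  shows "g \<in> regular X U"
  using assms by (intro regular_local) auto

lemma regular_uminus: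
  assumes "openin (zariski X) U" "f \<in> regular X U" shows "(\<lambda>x. - f x) \<in> regular X U"
  using regular_mult[OF regular_const[OF assms(1), of "-1"] assms(2)] by simp

lemma regular_diff:
  assumes "openin (zariski X) U" "f \<in> regular X U" "g \<in> regular X U"
  shows "(\<lambda>x. f x - g x) \<in> regular X U"
  using regular_add[OF assms(2) regular_uminus[OF assms(1,3)]] by simp

lemma regular_power:
  assumes "openin (zariski X) U" "f \<in> regular X U" shows "(\<lambda>x. f x ^ n) \<in> regular X U"
  by (induction n) (auto intro: regular_const regular_mult assms)

lemma regular_sum:
  assumes "openin (zariski X) U" "\<And>i. i \<in> I \<Longrightarrow> f i \<in> regular X U"
  shows "(\<lambda>x. \<Sum>i\<in>I. f i x) \<in> regular X U"
  using assms(2)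
  by (induction I rule: infinite_finite_induct) (auto intro: regular_const regular_add assms(1))

lemma regular_divide:
  assumes "openin (zariski X) U" "f \<in> regular X U" "g \<in> regular X U" "\<And>x. x \<in> U \<Longrightarrow> g x \<noteq> 0"
  shows "(\<lambda>x. f x / g x) \<in> regular X U"
proof -
  have "{x \<in> U. g x \<noteq> 0} = U" using assms(4) by auto
  then show ?thesis
    using regular_mult[OF assms(2), of "\<lambda>x. inverse (g x)"] regular_inverse[OF assms(1,3)]
    by (simp add: divide_inverse)
qed

lemma regular_generated_algebra:
  assumes "openin (zariski X) U" "\<And>f. f \<in> S \<Longrightarrow> (\<lambda>x. f (\<phi> x)) \<in> regular X U"
    and "h \<in> generated_algebra S"
  shows "(\<lambda>x. h (\<phi> x)) \<in> regular X U"
  using assms(3)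
  by (induction rule: generated_algebra.induct)
    (auto intro: regular_const regular_add regular_mult assms(1,2))

end

lemma generated_algebra_mono:
  assumes "S \<subseteq> T" shows "generated_algebra S \<subseteq> generated_algebra T"
proof
  fix f assume "f \<in> generated_algebra S"
  then show "f \<in> generated_algebra T"
    using assms by (induction rule: generated_algebra.induct) (auto intro: generated_algebra.intros)
qed

lemma function_sheaf_open_subvariety:
  assumes "function_sheaf X" "openin (zariski X) S"
  shows "function_sheaf (open_subvariety X S)"
proof -
  interpret function_sheaf X by fact
  have opn: "openin (zariski (open_subvariety X S)) U \<longleftrightarrow> openin (zariski X) U \<and> U \<subseteq> S" for U
    using openin_open_subtopology[OF assms(2)] by (simp add: open_subvariety_def)
  have reg: "regular (open_subvariety X S) = regular X" by (simp add: open_subvariety_def)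
  show ?thesis
  proof (unfold_locales, unfold opn reg)
    show "openin (zariski X) {x \<in> U. f x \<noteq> 0} \<and> {x \<in> U. f x \<noteq> 0} \<subseteq> S"
      if "openin (zariski X) U \<and> U \<subseteq> S" "f \<in> regular X U" for U f
      using open_nonvanishing[of U f] that by auto
    show "f \<in> regular X U" if "openin (zariski X) U \<and> U \<subseteq> S"
      "\<And>x. x \<in> U \<Longrightarrow> \<exists>V g. (openin (zariski X) V \<and> V \<subseteq> S) \<and> x \<in> V \<and> g \<in> regular X V \<and>
        (\<forall>y\<in>U \<inter> V. f y = g y)" for U f
    proof (rule regular_local)
      fix x assume "x \<in> U"
      from that(2)[OF this] show "\<exists>V g. openin (zariski X) V \<and> x \<in> V \<and> g \<in> regular X V \<and>
        (\<forall>y\<in>U \<inter> V. f y = g y)" by (elim exE conjE) (intro exI conjI)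
    qed (use that in blast)
  qed (use regular_restrict in \<open>simp_all add: regular_const regular_add regular_mult regular_inverse\<close>)
qed

lemma morphism_into_open_subvariety:
  assumes "morphism X Y \<phi>" "openin (zariski Y) S" "\<And>x. x \<in> topspace (zariski X) \<Longrightarrow> \<phi> x \<in> S"
  shows "morphism X (open_subvariety Y S) \<phi>"
  using assms unfolding morphism_def open_subvariety_def variety.simps
    continuous_map_in_subtopology openin_open_subtopology[OF assms(2)] by auto

section \<open>Varieties given by families of local fractions\<close>

lemma regular_variety_of_fractions_restrict:
  "f \<in> regular (variety_of_fractions \<G>) U \<Longrightarrow> V \<subseteq> U \<Longrightarrow> f \<in> regular (variety_of_fractions \<G>) V"
proof -
  assume f: "f \<in> regular (variety_of_fractions \<G>) U" and V: "V \<subseteq> U"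
  show ?thesis
    unfolding variety_of_fractions_def variety.simps mem_Collect_eq
  proof
    fix x assume "x \<in> V"
    with V have "x \<in> U" by auto
    with f obtain W g h where "(W, g) \<in> \<G> \<and> (W, h) \<in> \<G> \<and> x \<in> W \<and> h x \<noteq> 0 \<and>
        (\<forall>y\<in>U \<inter> W. h y \<noteq> 0 \<longrightarrow> f y = g y / h y)"
      unfolding variety_of_fractions_def by simp blast
    then show "\<exists>W g h. (W, g) \<in> \<G> \<and> (W, h) \<in> \<G> \<and> x \<in> W \<and> h x \<noteq> 0 \<and>
        (\<forall>y\<in>V \<inter> W. h y \<noteq> 0 \<longrightarrow> f y = g y / h y)"
      using V by (intro exI[of _ W] exI[of _ g] exI[of _ h]) auto
  qed
qed

lemma open_variety_of_fractions:
  assumes "(W, h) \<in> \<G>" shows "openin (zariski (variety_of_fractions \<G>)) {x \<in> W. h x \<noteq> 0}"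
  using assms by (auto simp: variety_of_fractions_def intro!: topology_generated_by_Basis)

lemma topspace_variety_of_fractions:
  "x \<in> topspace (zariski (variety_of_fractions \<G>)) \<longleftrightarrow> (\<exists>W h. (W, h) \<in> \<G> \<and> x \<in> W \<and> h x \<noteq> 0)"
proof
  assume "x \<in> topspace (zariski (variety_of_fractions \<G>))"
  then obtain V where "x \<in> V" "V \<in> {{x \<in> W. h x \<noteq> 0} | W h. (W, h) \<in> \<G>}"
    unfolding variety_of_fractions_def variety.simps topology_generated_by_topspace by (rule UnionE)
  then show "\<exists>W h. (W, h) \<in> \<G> \<and> x \<in> W \<and> h x \<noteq> 0" by blast
next
  assume "\<exists>W h. (W, h) \<in> \<G> \<and> x \<in> W \<and> h x \<noteq> 0"
  then obtain W h where "(W, h) \<in> \<G>" "x \<in> W" "h x \<noteq> 0" by blast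
  then show "x \<in> topspace (zariski (variety_of_fractions \<G>))"
    using openin_subset[OF open_variety_of_fractions, of W h \<G>] by blast
qed

lemma regular_variety_of_fractions:
  assumes "(W, g) \<in> \<G>" "(W, \<lambda>_. 1) \<in> \<G>" "U \<subseteq> W"
  shows "g \<in> regular (variety_of_fractions \<G>) U"
  unfolding variety_of_fractions_def variety.simps mem_Collect_eq
  by (intro ballI exI[of _ W] exI[of _ g] exI[of _ "\<lambda>_. 1"]) (use assms in auto)

text \<open>Fractions with different domains are combined after restricting both to the
  intersection, so closure under the ring operations is asked for on a common domain only.\<close>

locale fraction_family =
  fixes \<G> :: "('a set \<times> ('a \<Rightarrow> complex)) set"
  assumes family_const: "(W, g) \<in> \<G> \<Longrightarrow> (W, \<lambda>_. a) \<in> \<G>"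
    and family_restrict: "(W, g) \<in> \<G> \<Longrightarrow> (W', g') \<in> \<G> \<Longrightarrow> (W \<inter> W', g) \<in> \<G>"
    and family_add: "(W, g) \<in> \<G> \<Longrightarrow> (W, h) \<in> \<G> \<Longrightarrow> (W, \<lambda>x. g x + h x) \<in> \<G>"
    and family_mult: "(W, g) \<in> \<G> \<Longrightarrow> (W, h) \<in> \<G> \<Longrightarrow> (W, \<lambda>x. g x * h x) \<in> \<G>"
begin

lemma family_restrict': "(W, g) \<in> \<G> \<Longrightarrow> (W', g') \<in> \<G> \<Longrightarrow> (W \<inter> W', g') \<in> \<G>"
  using family_restrict[of W' g' W g] by (simp add: Int_commute)

text \<open>The generating sets form a basis and not merely a subbasis: on
  \<open>W \<inter> W'\<close> the product \<open>h * h'\<close> is nonzero exactly where both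
  factors are.\<close>

lemma nonvanishing_basis:
  assumes "openin (zariski (variety_of_fractions \<G>)) U" "x \<in> U"
  shows "\<exists>W h. (W, h) \<in> \<G> \<and> x \<in> W \<and> h x \<noteq> 0 \<and> {y \<in> W. h y \<noteq> 0} \<subseteq> U"
proof -
  have "generate_topology_on {{x \<in> W. h x \<noteq> 0} | W h. (W, h) \<in> \<G>} U"
    using assms(1) by (simp add: variety_of_fractions_def openin_topology_generated_by)
  then show ?thesis using assms(2)
  proof (induction U rule: generate_topology_on.induct)
    case (Int a b)
    then have x: "x \<in> a" "x \<in> b" by auto
    from Int.IH(1)[OF x(1)] obtain W h where 1: "(W, h) \<in> \<G>" "x \<in> W" "h x \<noteq> 0" "{y \<in> W. h y \<noteq> 0} \<subseteq> a"
      by (elim exE conjE)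
    from Int.IH(2)[OF x(2)] obtain W' h' where
      2: "(W', h') \<in> \<G>" "x \<in> W'" "h' x \<noteq> 0" "{y \<in> W'. h' y \<noteq> 0} \<subseteq> b"
      by (elim exE conjE)
    have "(W \<inter> W', \<lambda>y. h y * h' y) \<in> \<G>"
      using family_mult[OF family_restrict[OF 1(1) 2(1)] family_restrict'[OF 1(1) 2(1)]] .
    then show ?case
      using 1(2-) 2(2-) by (intro exI[of _ "W \<inter> W'"] exI[of _ "\<lambda>y. h y * h' y"]) auto
  next
    case (UN K)
    then obtain V where V: "V \<in> K" "x \<in> V" by auto
    from UN.IH[OF V] obtain W h where "(W, h) \<in> \<G>" "x \<in> W" "h x \<noteq> 0" "{y \<in> W. h y \<noteq> 0} \<subseteq> V"
      by (elim exE conjE)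
    with V(1) show ?case by (intro exI[of _ W] exI[of _ h]) auto
  next
    case (Basis V)
    then obtain W h where "V = {x \<in> W. h x \<noteq> 0}" "(W, h) \<in> \<G>" by auto
    with Basis show ?case by (intro exI[of _ W] exI[of _ h]) auto
  qed simp
qed

lemma regular_fractionE:
  assumes "f \<in> regular (variety_of_fractions \<G>) U" "x \<in> U"
  obtains W g h where "(W, g) \<in> \<G>" "(W, h) \<in> \<G>" "x \<in> W" "h x \<noteq> 0"
    "\<And>y. y \<in> U \<Longrightarrow> y \<in> W \<Longrightarrow> h y \<noteq> 0 \<Longrightarrow> f y = g y / h y"
  using assms unfolding variety_of_fractions_def by auto

lemma regular_fractionI:
  assumes "\<And>x. x \<in> U \<Longrightarrow> \<exists>W g h. (W, g) \<in> \<G> \<and> (W, h) \<in> \<G> \<and> x \<in> W \<and> h x \<noteq> 0 \<and>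
            (\<forall>y\<in>U \<inter> W. h y \<noteq> 0 \<longrightarrow> f y = g y / h y)"
  shows "f \<in> regular (variety_of_fractions \<G>) U"
  using assms unfolding variety_of_fractions_def by simp

text \<open>\<open>N\<close> is the numerator of \<open>op\<close> over the common denominator, so
  that one argument serves sums and products.\<close>

lemma regular_fraction_binary:
  assumes "f \<in> regular (variety_of_fractions \<G>) U" "f' \<in> regular (variety_of_fractions \<G>) U"
    and "\<And>W g h g' h'. (W, g) \<in> \<G> \<Longrightarrow> (W, h) \<in> \<G> \<Longrightarrow> (W, g') \<in> \<G> \<Longrightarrow> (W, h') \<in> \<G> \<Longrightarrow>
      (W, \<lambda>y. N (g y) (h y) (g' y) (h' y)) \<in> \<G>"
    and "\<And>a b a' b' :: complex. b \<noteq> 0 \<Longrightarrow> b' \<noteq> 0 \<Longrightarrow> op (a / b) (a' / b') = N a b a' b' / (b * b')"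
  shows "(\<lambda>x. op (f x) (f' x)) \<in> regular (variety_of_fractions \<G>) U"
proof (rule regular_fractionI)
  fix x assume x: "x \<in> U"
  obtain W g h where 1: "(W, g) \<in> \<G>" "(W, h) \<in> \<G>" "x \<in> W" "h x \<noteq> 0"
    "\<And>y. y \<in> U \<Longrightarrow> y \<in> W \<Longrightarrow> h y \<noteq> 0 \<Longrightarrow> f y = g y / h y"
    using regular_fractionE[OF assms(1) x] by metis
  obtain W' g' h' where 2: "(W', g') \<in> \<G>" "(W', h') \<in> \<G>" "x \<in> W'" "h' x \<noteq> 0"
    "\<And>y. y \<in> U \<Longrightarrow> y \<in> W' \<Longrightarrow> h' y \<noteq> 0 \<Longrightarrow> f' y = g' y / h' y"
    using regular_fractionE[OF assms(2) x] by metis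
  let ?W = "W \<inter> W'"
  have in_family: "(?W, g) \<in> \<G>" "(?W, h) \<in> \<G>" "(?W, g') \<in> \<G>" "(?W, h') \<in> \<G>"
    using 1 2 family_restrict family_restrict' by blast+
  show "\<exists>W F H. (W, F) \<in> \<G> \<and> (W, H) \<in> \<G> \<and> x \<in> W \<and> H x \<noteq> 0 \<and>
            (\<forall>y\<in>U \<inter> W. H y \<noteq> 0 \<longrightarrow> op (f y) (f' y) = F y / H y)"
    using assms(3)[OF in_family] family_mult[OF in_family(2,4)] 1(3-5) 2(3-5) assms(4)
    by (intro exI[of _ ?W] exI[of _ "\<lambda>y. N (g y) (h y) (g' y) (h' y)"] exI[of _ "\<lambda>y. h y * h' y"])
      auto
qed

lemma function_sheaf_variety_of_fractions: "function_sheaf (variety_of_fractions \<G>)"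
proof
  let ?X = "variety_of_fractions \<G>"
  show "(\<lambda>_. a) \<in> regular ?X U" if U: "openin (zariski ?X) U" for U a
  proof (rule regular_fractionI)
    fix x assume "x \<in> U"
    with U obtain W h where "(W, h) \<in> \<G>" "x \<in> W" using nonvanishing_basis by metis
    then show "\<exists>W g h. (W, g) \<in> \<G> \<and> (W, h) \<in> \<G> \<and> x \<in> W \<and> h x \<noteq> 0 \<and>
            (\<forall>y\<in>U \<inter> W. h y \<noteq> 0 \<longrightarrow> a = g y / h y)"
      using family_const
      by (intro exI[of _ W] exI[of _ "\<lambda>_. a"] exI[of _ "\<lambda>_. 1"]) (auto intro: family_const)
  qed
  show "(\<lambda>x. f x + g x) \<in> regular ?X U" if "f \<in> regular ?X U" "g \<in> regular ?X U" for f g U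
    by (rule regular_fraction_binary[OF that, of "\<lambda>a b a' b'. a * b' + a' * b"])
      (auto simp: field_simps intro: family_mult family_add)
  show "(\<lambda>x. f x * g x) \<in> regular ?X U" if "f \<in> regular ?X U" "g \<in> regular ?X U" for f g U
    by (rule regular_fraction_binary[OF that, of "\<lambda>a b a' b'. a * a'"])
      (auto intro: family_mult)
  show "f \<in> regular ?X V" if "f \<in> regular ?X U" "V \<subseteq> U" for f U V
    using that by (rule regular_variety_of_fractions_restrict)
  show "openin (zariski ?X) {x \<in> U. f x \<noteq> 0}" if U: "openin (zariski ?X) U" and f: "f \<in> regular ?X U"
    for U f
  proof (subst openin_subopen, intro ballI)
    fix x assume "x \<in> {x \<in> U. f x \<noteq> 0}"
    then have x: "x \<in> U" "f x \<noteq> 0" by auto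
    obtain W g h where 1: "(W, g) \<in> \<G>" "(W, h) \<in> \<G>" "x \<in> W" "h x \<noteq> 0"
      "\<And>y. y \<in> U \<Longrightarrow> y \<in> W \<Longrightarrow> h y \<noteq> 0 \<Longrightarrow> f y = g y / h y"
      using regular_fractionE[OF f x(1)] by metis
    have "openin (zariski ?X) (U \<inter> {y \<in> W. g y * h y \<noteq> 0})"
      by (intro openin_Int U open_variety_of_fractions family_mult 1)
    then show "\<exists>T. openin (zariski ?X) T \<and> x \<in> T \<and> T \<subseteq> {x \<in> U. f x \<noteq> 0}"
      using 1 x by (intro exI[of _ "U \<inter> {y \<in> W. g y * h y \<noteq> 0}"]) auto
  qed
  show "(\<lambda>x. inverse (f x)) \<in> regular ?X {x \<in> U. f x \<noteq> 0}"
    if U: "openin (zariski ?X) U" and f: "f \<in> regular ?X U" for U f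
  proof (rule regular_fractionI)
    fix x assume "x \<in> {x \<in> U. f x \<noteq> 0}"
    then have x: "x \<in> U" "f x \<noteq> 0" by auto
    obtain W g h where 1: "(W, g) \<in> \<G>" "(W, h) \<in> \<G>" "x \<in> W" "h x \<noteq> 0"
      "\<And>y. y \<in> U \<Longrightarrow> y \<in> W \<Longrightarrow> h y \<noteq> 0 \<Longrightarrow> f y = g y / h y"
      using regular_fractionE[OF f x(1)] by metis
    \<comment> \<open>The inverse is written as \<open>(h * h) / (g * h)\<close> and not as
      \<open>h / g\<close>: where this denominator is nonzero, so is \<open>h\<close>, and the
      fraction for \<open>f\<close> applies.\<close>
    then show "\<exists>W a b. (W, a) \<in> \<G> \<and> (W, b) \<in> \<G> \<and> x \<in> W \<and> b x \<noteq> 0 \<and>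
        (\<forall>y\<in>{x \<in> U. f x \<noteq> 0} \<inter> W. b y \<noteq> 0 \<longrightarrow> inverse (f y) = a y / b y)"
      using x by (intro exI[of _ W] exI[of _ "\<lambda>y. h y * h y"] exI[of _ "\<lambda>y. g y * h y"])
        (auto intro: family_mult)
  qed
  show "f \<in> regular ?X U" if U: "openin (zariski ?X) U" and
    loc: "\<And>x. x \<in> U \<Longrightarrow> \<exists>V g. openin (zariski ?X) V \<and> x \<in> V \<and> g \<in> regular ?X V \<and>
      (\<forall>y \<in> U \<inter> V. f y = g y)" for U f
  proof (rule regular_fractionI)
    fix x assume x: "x \<in> U"
    then obtain V e where V: "openin (zariski ?X) V" "x \<in> V" "e \<in> regular ?X V"
      "\<forall>y \<in> U \<inter> V. f y = e y" using loc by metis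
    obtain W g h where 1: "(W, g) \<in> \<G>" "(W, h) \<in> \<G>" "x \<in> W" "h x \<noteq> 0"
      "\<And>y. y \<in> V \<Longrightarrow> y \<in> W \<Longrightarrow> h y \<noteq> 0 \<Longrightarrow> e y = g y / h y"
      using regular_fractionE[OF V(3,2)] by metis
    obtain W' b where 2: "(W', b) \<in> \<G>" "x \<in> W'" "b x \<noteq> 0" "{y \<in> W'. b y \<noteq> 0} \<subseteq> V"
      using nonvanishing_basis[OF V(1,2)] by metis
    \<comment> \<open>The common factor \<open>b\<close> changes no value, but a nonzero denominator
      now forces the point into \<open>V\<close>, where \<open>f\<close> agrees with
      \<open>e\<close>.\<close>
    have "(W \<inter> W', \<lambda>y. g y * b y) \<in> \<G>" "(W \<inter> W', \<lambda>y. h y * b y) \<in> \<G>"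
      using family_mult family_restrict[OF 1(1) 2(1)] family_restrict[OF 1(2) 2(1)]
        family_restrict'[OF 1(1) 2(1)] by blast+
    moreover have "f y = (g y * b y) / (h y * b y)" if "y \<in> U \<inter> (W \<inter> W')" "h y * b y \<noteq> 0" for y
    proof -
      have "y \<in> V" using that 2(4) by auto
      then show ?thesis using that 1(5)[of y] V(4) by auto
    qed
    ultimately show "\<exists>W g h. (W, g) \<in> \<G> \<and> (W, h) \<in> \<G> \<and> x \<in> W \<and> h x \<noteq> 0 \<and>
            (\<forall>y\<in>U \<inter> W. h y \<noteq> 0 \<longrightarrow> f y = g y / h y)"
      using 1(3,4) 2(2,3)
      by (intro exI[of _ "W \<inter> W'"] exI[of _ "\<lambda>y. g y * b y"] exI[of _ "\<lambda>y. h y * b y"]) simp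
  qed
qed

end

section \<open>Morphisms into varieties of fractions, products and powers\<close>

context function_sheaf begin

text \<open>Near each point \<open>f\<close> is a quotient of two members of the family, so its
  pullback is a quotient of regular functions there; locality does the rest.\<close>

lemma regular_pullback_fraction:
  assumes \<phi>: "\<And>W h. (W, h) \<in> \<G> \<Longrightarrow> openin (zariski X) {x \<in> topspace (zariski X). \<phi> x \<in> W} \<and>
      (\<lambda>x. h (\<phi> x)) \<in> regular X {x \<in> topspace (zariski X). \<phi> x \<in> W}"
    and open_pre: "openin (zariski X) {x \<in> topspace (zariski X). \<phi> x \<in> U}" (is "openin _ ?U")
    and f: "f \<in> regular (variety_of_fractions \<G>) U"
  shows "(\<lambda>x. f (\<phi> x)) \<in> regular X ?U"
proof (rule regular_local[OF open_pre])
  fix x assume "x \<in> ?U"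
  then obtain W g h where 1: "(W, g) \<in> \<G>" "(W, h) \<in> \<G>" "\<phi> x \<in> W" "h (\<phi> x) \<noteq> 0"
    "\<forall>y\<in>U \<inter> W. h y \<noteq> 0 \<longrightarrow> f y = g y / h y" and x: "x \<in> topspace (zariski X)"
    using f unfolding variety_of_fractions_def by auto
  let ?W = "{x \<in> topspace (zariski X). \<phi> x \<in> W}"
  let ?V = "{x \<in> ?W. h (\<phi> x) \<noteq> 0}"
  have V: "openin (zariski X) ?V"
    using open_nonvanishing \<phi>[OF 1(2)] by blast
  have "(\<lambda>y. g (\<phi> y) / h (\<phi> y)) \<in> regular X ?V"
  proof (rule regular_divide[OF V])
    show "(\<lambda>y. g (\<phi> y)) \<in> regular X ?V" "(\<lambda>y. h (\<phi> y)) \<in> regular X ?V"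
      using \<phi>[OF 1(1)] \<phi>[OF 1(2)] by (auto intro: regular_restrict)
  qed auto
  then show "\<exists>V g. openin (zariski X) V \<and> x \<in> V \<and> g \<in> regular X V \<and>
      (\<forall>y \<in> ?U \<inter> V. f (\<phi> y) = g y)"
    using V x 1 by (intro exI[of _ ?V] exI[of _ "\<lambda>y. g (\<phi> y) / h (\<phi> y)"]) auto
qed

text \<open>The family alone has to be tested, since it generates both the topology and the regular
  functions. \<open>S\<close> may be any set containing the image: intersecting with it changes no
  preimage.\<close>

lemma morphism_into_fractions:
  assumes \<phi>: "\<And>W h. (W, h) \<in> \<G> \<Longrightarrow> openin (zariski X) {x \<in> topspace (zariski X). \<phi> x \<in> W} \<and>
      (\<lambda>x. h (\<phi> x)) \<in> regular X {x \<in> topspace (zariski X). \<phi> x \<in> W}"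
    and top: "\<And>x. x \<in> topspace (zariski X) \<Longrightarrow> \<phi> x \<in> topspace (zariski (variety_of_fractions \<G>))"
    and S: "\<And>x. x \<in> topspace (zariski X) \<Longrightarrow> \<phi> x \<in> S"
  shows "morphism X (open_subvariety (variety_of_fractions \<G>) S) \<phi>"
proof -
  have cont: "continuous_map (zariski X) (zariski (variety_of_fractions \<G>)) \<phi>"
    unfolding variety_of_fractions_def variety.simps
  proof (rule continuous_on_generated_topo)
    fix V assume "V \<in> {{x \<in> W. h x \<noteq> 0} | W h. (W, h) \<in> \<G>}"
    then obtain W h where V: "V = {x \<in> W. h x \<noteq> 0}" "(W, h) \<in> \<G>" by auto
    have "\<phi> -` V \<inter> topspace (zariski X) =
        {x \<in> {x \<in> topspace (zariski X). \<phi> x \<in> W}. h (\<phi> x) \<noteq> 0}" using V by auto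
    then show "openin (zariski X) (\<phi> -` V \<inter> topspace (zariski X))"
      using open_nonvanishing[of "{x \<in> topspace (zariski X). \<phi> x \<in> W}"] \<phi>[OF V(2)] by auto
  next
    have "topspace (zariski (variety_of_fractions \<G>)) = \<Union> {{x \<in> W. h x \<noteq> 0} | W h. (W, h) \<in> \<G>}"
      by (simp add: variety_of_fractions_def)
    with top show "\<phi> ` topspace (zariski X) \<subseteq> \<Union> {{x \<in> W. h x \<noteq> 0} | W h. (W, h) \<in> \<G>}"
      by blast
  qed
  have "f \<circ> \<phi> \<in> regular X {x \<in> topspace (zariski X). \<phi> x \<in> U \<inter> S}"
    if "openin (zariski (variety_of_fractions \<G>)) U"
      "f \<in> regular (variety_of_fractions \<G>) (U \<inter> S)" for U f
  proof -
    have eq: "{x \<in> topspace (zariski X). \<phi> x \<in> U \<inter> S} = {x \<in> topspace (zariski X). \<phi> x \<in> U}"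
      using S by auto
    have "openin (zariski X) {x \<in> topspace (zariski X). \<phi> x \<in> U}"
      using openin_continuous_map_preimage[OF cont that(1)] .
    then show ?thesis
      using regular_pullback_fraction[OF \<phi> _ that(2)] unfolding eq comp_def by simp
  qed
  then show ?thesis
    using cont S
    by (auto simp: morphism_def open_subvariety_def continuous_map_in_subtopology openin_subtopology)
qed

lemma morphism_into_fractions':
  assumes "\<And>W h. (W, h) \<in> \<G> \<Longrightarrow> openin (zariski X) {x \<in> topspace (zariski X). \<phi> x \<in> W} \<and>
      (\<lambda>x. h (\<phi> x)) \<in> regular X {x \<in> topspace (zariski X). \<phi> x \<in> W}"
    and "\<And>x. x \<in> topspace (zariski X) \<Longrightarrow> \<phi> x \<in> topspace (zariski (variety_of_fractions \<G>))"
  shows "morphism X (variety_of_fractions \<G>) \<phi>"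
proof -
  have "open_subvariety (variety_of_fractions \<G>) UNIV = variety_of_fractions \<G>"
    by (simp add: open_subvariety_def)
  then show ?thesis using morphism_into_fractions[OF assms, of UNIV] by simp
qed

lemma morphismD:
  assumes "morphism X Y \<phi>" "openin (zariski Y) U"
  shows "openin (zariski X) {x \<in> topspace (zariski X). \<phi> x \<in> U}"
    and "f \<in> regular Y U \<Longrightarrow> (\<lambda>x. f (\<phi> x)) \<in> regular X {x \<in> topspace (zariski X). \<phi> x \<in> U}"
    and "x \<in> topspace (zariski X) \<Longrightarrow> \<phi> x \<in> topspace (zariski Y)"
  using assms openin_continuous_map_preimage[of "zariski X" "zariski Y"]
  by (auto simp: morphism_def comp_def continuous_map_def)

lemma morphism_into_affine:
  assumes "\<And>f. f \<in> A \<Longrightarrow> (\<lambda>x. f (\<phi> x)) \<in> regular X (topspace (zariski X))"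
    and "\<And>x. x \<in> topspace (zariski X) \<Longrightarrow> \<phi> x \<in> P" "(\<lambda>_. 1) \<in> A"
  shows "morphism X (affine_variety P A) \<phi>"
proof -
  have "{x \<in> topspace (zariski X). \<phi> x \<in> P} = topspace (zariski X)" using assms(2) by auto
  then show ?thesis
    unfolding affine_variety_def
    using assms by (intro morphism_into_fractions') (auto simp: topspace_variety_of_fractions)
qed

text \<open>The mediating map of the universal property. Functions on a box come from pulled-back
  functions of the factors by ring operations, so regularity follows by induction over the generated
  algebra.\<close>

lemma morphism_into_product:
  assumes "morphism X Y \<phi>" "morphism X Z \<psi>" "\<And>x. x \<in> topspace (zariski X) \<Longrightarrow> (\<phi> x, \<psi> x) \<in> S"
  shows "morphism X (open_subvariety (product_variety Y Z) S) (\<lambda>x. (\<phi> x, \<psi> x))"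
  unfolding product_variety_def
proof (rule morphism_into_fractions)
  let ?T = "topspace (zariski X)"
  fix W h assume "(W, h) \<in> {(U \<times> V, h) | U V h. openin (zariski Y) U \<and> openin (zariski Z) V \<and>
        h \<in> generated_algebra ({\<lambda>z. f (fst z) | f. f \<in> regular Y U} \<union>
                               {\<lambda>z. g (snd z) | g. g \<in> regular Z V})}"
  then obtain U V where UV: "W = U \<times> V" "openin (zariski Y) U" "openin (zariski Z) V"
    and h: "h \<in> generated_algebra ({\<lambda>z. f (fst z) | f. f \<in> regular Y U} \<union>
                               {\<lambda>z. g (snd z) | g. g \<in> regular Z V})" by auto
  have W: "{x \<in> ?T. (\<phi> x, \<psi> x) \<in> W} = {x \<in> ?T. \<phi> x \<in> U} \<inter> {x \<in> ?T. \<psi> x \<in> V}"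
    using UV(1) by auto
  note pre = morphismD[OF assms(1) UV(2)] morphismD[OF assms(2) UV(3)]
  have op: "openin (zariski X) {x \<in> ?T. (\<phi> x, \<psi> x) \<in> W}"
    unfolding W by (intro openin_Int pre)
  moreover have "(\<lambda>x. h (\<phi> x, \<psi> x)) \<in> regular X {x \<in> ?T. (\<phi> x, \<psi> x) \<in> W}"
  proof (rule regular_generated_algebra[OF op _ h])
    fix f assume "f \<in> {\<lambda>z. f (fst z) | f. f \<in> regular Y U} \<union> {\<lambda>z. g (snd z) | g. g \<in> regular Z V}"
    then show "(\<lambda>x. f (\<phi> x, \<psi> x)) \<in> regular X {x \<in> ?T. (\<phi> x, \<psi> x) \<in> W}"
      unfolding W using pre(2,5) by (auto intro: regular_restrict[OF _ Int_lower1] regular_restrict[OF _ Int_lower2])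
  qed
  ultimately show "openin (zariski X) {x \<in> ?T. (\<phi> x, \<psi> x) \<in> W} \<and>
    (\<lambda>x. h (\<phi> x, \<psi> x)) \<in> regular X {x \<in> ?T. (\<phi> x, \<psi> x) \<in> W}" by blast
next
  fix x assume x: "x \<in> topspace (zariski X)"
  then have "\<phi> x \<in> topspace (zariski Y)" "\<psi> x \<in> topspace (zariski Z)"
    using morphismD(3) assms(1,2) openin_topspace by blast+
  then have *: "(\<phi> x, \<psi> x) \<in> topspace (zariski Y) \<times> topspace (zariski Z)" by blast
  show "(\<phi> x, \<psi> x) \<in> topspace (zariski (variety_of_fractions
     {(U \<times> V, h) | U V h. openin (zariski Y) U \<and> openin (zariski Z) V \<and>
        h \<in> generated_algebra ({\<lambda>z. f (fst z) | f. f \<in> regular Y U} \<union>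
                               {\<lambda>z. g (snd z) | g. g \<in> regular Z V})}))"
    unfolding topspace_variety_of_fractions
    by (intro exI[of _ "topspace (zariski Y) \<times> topspace (zariski Z)"] exI[of _ "\<lambda>_. 1"])
      (use * in \<open>auto intro: generated_algebra.const\<close>)
qed (use assms in auto)

lemma morphism_into_power:
  assumes "\<And>i. i < n \<Longrightarrow> morphism X Y (\<lambda>x. \<phi> x i)"
    and "\<And>x. x \<in> topspace (zariski X) \<Longrightarrow> \<phi> x \<in> extensional {..<n}"
  shows "morphism X (power_variety Y n) \<phi>"
  unfolding power_variety_def
proof (rule morphism_into_fractions')
  let ?T = "topspace (zariski X)"
  fix W h assume "(W, h) \<in> {(PiE {..<n} U, h) | U h. (\<forall>i<n. openin (zariski Y) (U i)) \<and>
        h \<in> generated_algebra {\<lambda>x. f (x i) | i f. i < n \<and> f \<in> regular Y (U i)}}"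
  then obtain U where U: "W = PiE {..<n} U" "\<And>i. i < n \<Longrightarrow> openin (zariski Y) (U i)"
    and h: "h \<in> generated_algebra {\<lambda>x. f (x i) | i f. i < n \<and> f \<in> regular Y (U i)}" by auto
  \<comment> \<open>For \<open>n = 0\<close> the intersection over the indices is
    \<open>UNIV\<close>, and the factor \<open>?T\<close> keeps the identity true; this case occurs
    for \<open>k = 3\<close>.\<close>
  have W: "{x \<in> ?T. \<phi> x \<in> W} = (\<Inter>i\<in>{..<n}. {x \<in> ?T. \<phi> x i \<in> U i}) \<inter> ?T"
    using U(1) assms(2) by (auto simp: PiE_iff)
  have pre: "openin (zariski X) {x \<in> ?T. \<phi> x i \<in> U i}"
    "f \<in> regular Y (U i) \<Longrightarrow> (\<lambda>x. f (\<phi> x i)) \<in> regular X {x \<in> ?T. \<phi> x i \<in> U i}" if "i < n" for i f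
    using morphismD[OF assms(1)[OF that] U(2)[OF that]] by auto
  have op: "openin (zariski X) {x \<in> ?T. \<phi> x \<in> W}"
    unfolding W using pre by (intro openin_INT) auto
  moreover have "(\<lambda>x. h (\<phi> x)) \<in> regular X {x \<in> ?T. \<phi> x \<in> W}"
  proof (rule regular_generated_algebra[OF op _ h])
    fix f assume "f \<in> {\<lambda>x. f (x i) | i f. i < n \<and> f \<in> regular Y (U i)}"
    then obtain i g where "f = (\<lambda>x. g (x i))" "i < n" "g \<in> regular Y (U i)" by auto
    with pre(2) show "(\<lambda>x. f (\<phi> x)) \<in> regular X {x \<in> ?T. \<phi> x \<in> W}"
      unfolding W by (auto intro: regular_restrict)
  qed
  ultimately show "openin (zariski X) {x \<in> ?T. \<phi> x \<in> W} \<and>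
    (\<lambda>x. h (\<phi> x)) \<in> regular X {x \<in> ?T. \<phi> x \<in> W}" by blast
next
  fix x assume x: "x \<in> topspace (zariski X)"
  then have "\<phi> x i \<in> topspace (zariski Y)" if "i < n" for i
    using morphismD(3)[OF assms(1)[OF that]] openin_topspace by blast
  then have *: "\<phi> x \<in> PiE {..<n} (\<lambda>_. topspace (zariski Y))"
    using assms(2)[OF x] by (auto simp: PiE_iff)
  show "\<phi> x \<in> topspace (zariski (variety_of_fractions
     {(PiE {..<n} U, h) | U h. (\<forall>i<n. openin (zariski Y) (U i)) \<and>
        h \<in> generated_algebra {\<lambda>x. f (x i) | i f. i < n \<and> f \<in> regular Y (U i)}}))"
    unfolding topspace_variety_of_fractions
    by (intro exI[of _ "PiE {..<n} (\<lambda>_. topspace (zariski Y))"] exI[of _ "\<lambda>_. 1"])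
      (use * in \<open>auto intro: generated_algebra.const\<close>)
qed

end

text \<open>Two boxes meet in the box with sides \<open>U i \<inter> V i\<close>; restriction of
  regular functions carries the generators of both algebras there.\<close>

lemma fraction_family_power:
  assumes "\<And>f U V. f \<in> regular Y U \<Longrightarrow> V \<subseteq> U \<Longrightarrow> f \<in> regular Y V"
  shows "fraction_family {(PiE {..<n} U, h) | U h. (\<forall>i<n. openin (zariski Y) (U i)) \<and>
        h \<in> generated_algebra {\<lambda>x. f (x i) | i f. i < n \<and> f \<in> regular Y (U i)}}"
    (is "fraction_family ?\<G>")
proof -
  have *: "(W \<inter> W', f) \<in> ?\<G> \<and> (W \<inter> W', \<lambda>x. f x + g x) \<in> ?\<G> \<and> (W \<inter> W', \<lambda>x. f x * g x) \<in> ?\<G>"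
    if W: "(W, f) \<in> ?\<G>" "(W', g) \<in> ?\<G>" for W W' f g
  proof -
    let ?A = "\<lambda>U. generated_algebra {\<lambda>x. f (x i) | i f. i < n \<and> f \<in> regular Y (U i)}"
    obtain U V where U: "W = PiE {..<n} U" "\<forall>i<n. openin (zariski Y) (U i)" "f \<in> ?A U"
      and V: "W' = PiE {..<n} V" "\<forall>i<n. openin (zariski Y) (V i)" "g \<in> ?A V"
      using W by auto
    have "?A U \<subseteq> ?A (\<lambda>i. U i \<inter> V i)" "?A V \<subseteq> ?A (\<lambda>i. U i \<inter> V i)"
      by (rule generated_algebra_mono; blast intro: assms)+
    then have "f \<in> ?A (\<lambda>i. U i \<inter> V i)" "g \<in> ?A (\<lambda>i. U i \<inter> V i)" using U V by auto
    then show ?thesis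
      unfolding U(1) V(1) PiE_Int using U(2) V(2)
      by (auto intro!: exI[of _ "\<lambda>i. U i \<inter> V i"] intro: generated_algebra.intros)
  qed
  show ?thesis
  proof
    show "(W, \<lambda>x. g x + h x) \<in> ?\<G>" "(W, \<lambda>x. g x * h x) \<in> ?\<G>"
      if "(W, g) \<in> ?\<G>" "(W, h) \<in> ?\<G>" for W g h
      using *[OF that] by simp_all
  qed (use * in \<open>auto intro: generated_algebra.const\<close>)
qed

lemma function_sheaf_power:
  assumes "\<And>f U V. f \<in> regular Y U \<Longrightarrow> V \<subseteq> U \<Longrightarrow> f \<in> regular Y V"
  shows "function_sheaf (power_variety Y n)"
  unfolding power_variety_def
  by (rule fraction_family.function_sheaf_variety_of_fractions[OF fraction_family_power[OF assms]])

section \<open>Maps to the affine and the projective line\<close>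

lemma (in function_sheaf) morphism_into_affine_line:
  assumes "f \<in> regular X (topspace (zariski X))"
  shows "morphism X affine_line f"
  unfolding affine_line_def
proof (rule morphism_into_affine)
  fix g assume "g \<in> generated_algebra {\<lambda>z. z}"
  then show "(\<lambda>x. g (f x)) \<in> regular X (topspace (zariski X))"
    by (rule regular_generated_algebra[rotated 2]) (use assms in auto)
qed (auto intro: generated_algebra.const)

lemma proj_point_eq_iff:
  assumes "v \<noteq> 0" "w \<noteq> 0"
  shows "proj_point v = proj_point w \<longleftrightarrow> (\<exists>a. a \<noteq> 0 \<and> w = a *s v)"
proof
  assume "proj_point v = proj_point w"
  then have "w \<in> vec.span {v}" unfolding proj_point_def using vec.span_base[of w "{w}"] by simp
  then obtain a where "w = a *s v" by (auto simp: vec.span_singleton)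
  with assms show "\<exists>a. a \<noteq> 0 \<and> w = a *s v" by (intro exI[of _ a]) auto
next
  assume "\<exists>a. a \<noteq> 0 \<and> w = a *s v"
  then obtain a where "a \<noteq> 0" "w = a *s v" by blast
  then have "k *s v = (k / a) *s w" "k *s w = (k * a) *s v" for k by simp_all
  then show "proj_point v = proj_point w"
    unfolding proj_point_def vec.span_singleton by (intro equalityI subsetI; blast)
qed

text \<open>Homogeneity makes a quotient of two forms of equal degree a function of the line rather
  than of the vector.\<close>

lemma binary_form_scale:
  assumes "binary_form d F" shows "F (k *s v) = k ^ d * F v"
proof -
  from assms obtain a where a: "\<And>v. F v = (\<Sum>j\<le>d. a j * (v $ 1) ^ j * (v $ 2) ^ (d - j))"
    unfolding binary_form_def by blast
  then have "F (k *s v) = (\<Sum>j\<le>d. (k ^ j * k ^ (d - j)) * (a j * (v $ 1) ^ j * (v $ 2) ^ (d - j)))"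
    by (simp add: power_mult_distrib mult_ac)
  also have "\<dots> = k ^ d * (\<Sum>j\<le>d. a j * (v $ 1) ^ j * (v $ 2) ^ (d - j))"
    unfolding sum_distrib_left by (intro sum.cong) (simp_all flip: power_add)
  finally show ?thesis using a by simp
qed

lemma (in function_sheaf) regular_binary_form:
  assumes "openin (zariski X) U" "f \<in> regular X U" "g \<in> regular X U" "binary_form d F"
  shows "(\<lambda>x. F (vector [f x, g x])) \<in> regular X U"
proof -
  from assms(4) obtain a where "\<And>v. F v = (\<Sum>j\<le>d. a j * (v $ 1) ^ j * (v $ 2) ^ (d - j))"
    unfolding binary_form_def by blast
  then have "(\<lambda>x. F (vector [f x, g x])) = (\<lambda>x. \<Sum>j\<le>d. a j * f x ^ j * g x ^ (d - j))"
    by simp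
  then show ?thesis
    by (simp only:) (intro regular_sum regular_mult regular_power regular_const assms)
qed

lemma topspace_projective_line: "v \<noteq> 0 \<Longrightarrow> proj_point v \<in> topspace (zariski projective_line)"
  unfolding projective_line_def topspace_variety_of_fractions
proof (rule exI[of _ "{proj_point v | v. v \<noteq> 0}"], rule exI[of _ "\<lambda>_. 1"], intro conjI CollectI)
  show "\<exists>W h. ({proj_point v |v. v \<noteq> 0}, \<lambda>_. 1) = (W, h) \<and>
     (\<exists>d F G. binary_form d F \<and> binary_form d G \<and> W = {proj_point v |v. v \<noteq> 0 \<and> G v \<noteq> 0} \<and>
        (\<forall>v. v \<noteq> 0 \<and> G v \<noteq> 0 \<longrightarrow> h (proj_point v) = F v / G v))"
    by (rule exI[of _ "{proj_point v | v. v \<noteq> 0}"], rule exI[of _ "\<lambda>_. 1"], rule conjI[OF refl],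
        rule exI[of _ 0], rule exI[of _ "\<lambda>_. 1"], rule exI[of _ "\<lambda>_. 1"])
      (auto simp: binary_form_def)
qed auto

text \<open>Local homogeneous coordinates \<open>[f : g]\<close> suffice, and they need not agree on
  overlaps: neither the nonvanishing of a form at \<open>(f, g)\<close> nor the quotient of two
  forms of one degree depends on the representative.\<close>

lemma (in function_sheaf) morphism_into_projective_line:
  assumes loc: "\<And>x. x \<in> topspace (zariski X) \<Longrightarrow> \<exists>V f g. openin (zariski X) V \<and> x \<in> V \<and>
      f \<in> regular X V \<and> g \<in> regular X V \<and>
      (\<forall>y\<in>V. vector [f y, g y] \<noteq> (0 :: complex^2) \<and> \<phi> y = proj_point (vector [f y, g y]))"
  shows "morphism X projective_line \<phi>"
  unfolding projective_line_def
proof (rule morphism_into_fractions')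
  let ?T = "topspace (zariski X)"
  fix W h assume "(W, h) \<in> {(W, h) | W h. \<exists>d F G. binary_form d F \<and> binary_form d G \<and>
        W = {proj_point v | v. v \<noteq> 0 \<and> G v \<noteq> 0} \<and>
        (\<forall>v. v \<noteq> 0 \<and> G v \<noteq> 0 \<longrightarrow> h (proj_point v) = F v / G v)}"
  then obtain d F G where F: "binary_form d F" and G: "binary_form d G"
    and W: "W = {proj_point v | v. v \<noteq> 0 \<and> G v \<noteq> 0}"
    and h: "\<And>v. v \<noteq> 0 \<Longrightarrow> G v \<noteq> 0 \<Longrightarrow> h (proj_point v) = F v / G v" by auto
  have W_iff: "proj_point v \<in> W \<longleftrightarrow> G v \<noteq> 0" if v: "v \<noteq> 0" for v
  proof
    assume "proj_point v \<in> W"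
    then obtain w where w: "proj_point w = proj_point v" "w \<noteq> 0" "G w \<noteq> 0"
      unfolding W by auto
    with v obtain a where "a \<noteq> 0" "v = a *s w" using proj_point_eq_iff by blast
    then show "G v \<noteq> 0" using w(3) binary_form_scale[OF G] by simp
  qed (use v in \<open>auto simp: W\<close>)
  have local: "\<exists>V e. openin (zariski X) V \<and> x \<in> V \<and> V \<subseteq> {x \<in> ?T. \<phi> x \<in> W} \<and> e \<in> regular X V \<and>
      (\<forall>y\<in>V. h (\<phi> y) = e y)" if x: "x \<in> ?T" "\<phi> x \<in> W" for x
  proof -
    from loc[OF x(1)] obtain V f g where V: "openin (zariski X) V" "x \<in> V"
      "f \<in> regular X V" "g \<in> regular X V"
      and eq: "\<And>y. y \<in> V \<Longrightarrow> vector [f y, g y] \<noteq> (0 :: complex^2) \<and> \<phi> y = proj_point (vector [f y, g y])"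
      by (elim exE conjE) blast
    let ?V = "{y \<in> V. G (vector [f y, g y]) \<noteq> 0}"
    let ?e = "\<lambda>y. F (vector [f y, g y]) / G (vector [f y, g y])"
    note Freg = regular_binary_form[OF V(1,3,4) F] and Greg = regular_binary_form[OF V(1,3,4) G]
    have opn: "openin (zariski X) ?V" by (rule open_nonvanishing[OF V(1) Greg])
    have "?e \<in> regular X ?V"
      by (intro regular_divide opn regular_restrict[OF Freg] regular_restrict[OF Greg]) auto
    moreover have "x \<in> ?V" using V(2) x eq[OF V(2)] W_iff by auto
    moreover have "?V \<subseteq> {x \<in> ?T. \<phi> x \<in> W}" using eq W_iff openin_subset[OF V(1)] by auto
    moreover have "\<forall>y\<in>?V. h (\<phi> y) = ?e y" using eq h by auto
    ultimately show ?thesis using opn by (intro exI[of _ ?V] exI[of _ ?e]) simp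
  qed
  have opn: "openin (zariski X) {x \<in> ?T. \<phi> x \<in> W}"
  proof (subst openin_subopen, intro ballI)
    fix x assume "x \<in> {x \<in> ?T. \<phi> x \<in> W}"
    then have "x \<in> ?T" "\<phi> x \<in> W" by auto
    from local[OF this] show "\<exists>T. openin (zariski X) T \<and> x \<in> T \<and> T \<subseteq> {x \<in> ?T. \<phi> x \<in> W}"
      by (elim exE conjE) (intro exI conjI)
  qed
  moreover have "(\<lambda>x. h (\<phi> x)) \<in> regular X {x \<in> ?T. \<phi> x \<in> W}"
  proof (rule regular_local[OF opn])
    fix x assume "x \<in> {x \<in> ?T. \<phi> x \<in> W}"
    then have "x \<in> ?T" "\<phi> x \<in> W" by auto
    from local[OF this] obtain V e where "openin (zariski X) V" "x \<in> V" "e \<in> regular X V"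
      "\<forall>y\<in>V. h (\<phi> y) = e y" by (elim exE conjE)
    then show "\<exists>V g. openin (zariski X) V \<and> x \<in> V \<and> g \<in> regular X V \<and>
        (\<forall>y\<in>{x \<in> ?T. \<phi> x \<in> W} \<inter> V. h (\<phi> y) = g y)"
      by (intro exI[of _ V] exI[of _ e]) simp
  qed
  ultimately show "openin (zariski X) {x \<in> ?T. \<phi> x \<in> W} \<and>
    (\<lambda>x. h (\<phi> x)) \<in> regular X {x \<in> ?T. \<phi> x \<in> W}" by blast
next
  fix x assume "x \<in> topspace (zariski X)"
  from loc[OF this] obtain V f g where "x \<in> V"
    and "\<And>y. y \<in> V \<Longrightarrow> vector [f y, g y] \<noteq> (0 :: complex^2) \<and> \<phi> y = proj_point (vector [f y, g y])"
    by (elim exE conjE) blast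
  then show "\<phi> x \<in> topspace (zariski (variety_of_fractions {(W, h) | W h. \<exists>d F G.
      binary_form d F \<and> binary_form d G \<and> W = {proj_point v | v. v \<noteq> 0 \<and> G v \<noteq> 0} \<and>
      (\<forall>v. v \<noteq> 0 \<and> G v \<noteq> 0 \<longrightarrow> h (proj_point v) = F v / G v)}))"
    using topspace_projective_line unfolding projective_line_def by simp
qed

text \<open>The choice is arbitrary and varies in no regular way with the line; only scale-invariant
  expressions in it have geometric meaning.\<close>

definition line_rep :: "(complex^2) set \<Rightarrow> complex^2" where
  "line_rep l = (SOME v. v \<noteq> 0 \<and> proj_point v = l)"

lemma line_rep:
  assumes "v \<noteq> 0" shows "line_rep (proj_point v) \<noteq> 0" "proj_point (line_rep (proj_point v)) = proj_point v"
  unfolding line_rep_def by (rule someI2[of _ v]; use assms in simp)+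

lemma line_rep_scale:
  assumes "v \<noteq> 0" obtains a where "a \<noteq> 0" "line_rep (proj_point v) = a *s v"
  using proj_point_eq_iff[OF assms line_rep(1)[OF assms]] line_rep(2)[OF assms] by auto

lemma projective_line_chart:
  fixes F G :: "complex^2 \<Rightarrow> complex"
  assumes F: "binary_form d F" and G: "binary_form d G"
  defines "W \<equiv> {proj_point v | v. v \<noteq> 0 \<and> G v \<noteq> 0}"
  shows "openin (zariski projective_line) W"
    and "(\<lambda>l. F (line_rep l) / G (line_rep l)) \<in> regular projective_line W"
proof -
  have 0: "(W, h) \<in> {(W, h) | W h. \<exists>d F G. binary_form d F \<and> binary_form d G \<and>
        W = {proj_point v | v. v \<noteq> 0 \<and> G v \<noteq> 0} \<and>
        (\<forall>v. v \<noteq> 0 \<and> G v \<noteq> 0 \<longrightarrow> h (proj_point v) = F v / G v)}"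
    if "binary_form d F" "\<And>v. v \<noteq> 0 \<Longrightarrow> G v \<noteq> 0 \<Longrightarrow> h (proj_point v) = F v / G v" for F h
    using that G unfolding W_def by blast
  have 1: "(W, \<lambda>_. 1) \<in> {(W, h) | W h. \<exists>d F G. binary_form d F \<and> binary_form d G \<and>
        W = {proj_point v | v. v \<noteq> 0 \<and> G v \<noteq> 0} \<and>
        (\<forall>v. v \<noteq> 0 \<and> G v \<noteq> 0 \<longrightarrow> h (proj_point v) = F v / G v)}"
    by (rule 0[OF G]) simp
  show "openin (zariski projective_line) W"
    using open_variety_of_fractions[OF 1] unfolding projective_line_def by simp
  show "(\<lambda>l. F (line_rep l) / G (line_rep l)) \<in> regular projective_line W"
    unfolding projective_line_def
  proof (rule regular_variety_of_fractions[OF 0[OF F] 1])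
    fix v :: "complex^2" assume v: "v \<noteq> 0" "G v \<noteq> 0"
    obtain a where "a \<noteq> 0" "line_rep (proj_point v) = a *s v" using line_rep_scale[OF v(1)] .
    then show "F (line_rep (proj_point v)) / G (line_rep (proj_point v)) = F v / G v"
      by (simp add: binary_form_scale[OF F] binary_form_scale[OF G])
  qed simp
qed

section \<open>Open cylinders in Q and in its powers\<close>

lemma regular_Q_restrict: "f \<in> regular Q_variety U \<Longrightarrow> V \<subseteq> U \<Longrightarrow> f \<in> regular Q_variety V"
  unfolding Q_variety_def open_subvariety_def product_variety_def variety.simps
  by (rule regular_variety_of_fractions_restrict)

lemma openin_affine_line_UNIV: "openin (zariski affine_line) UNIV"
proof -
  have "openin (zariski affine_line) {x \<in> UNIV. (1::complex) \<noteq> 0}"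
    unfolding affine_line_def affine_variety_def
    by (rule open_variety_of_fractions[of _ "\<lambda>_. 1"]) (auto intro: generated_algebra.const)
  then show ?thesis by simp
qed

lemma regular_affine_line_id: "(\<lambda>z. z) \<in> regular affine_line U"
  unfolding affine_line_def affine_variety_def
  by (rule regular_variety_of_fractions[of UNIV]) (auto intro: generated_algebra.intros)

lemma Q_variety_cylinder:
  assumes "openin (zariski projective_line) V"
  defines "U \<equiv> Q_points \<inter> (UNIV \<times> V)"
  shows "openin (zariski Q_variety) U" and "fst \<in> regular Q_variety U"
    and "g \<in> regular projective_line V \<Longrightarrow> (\<lambda>z. g (snd z)) \<in> regular Q_variety U"
proof -
  let ?\<G> = "{(U \<times> V, h) | U V h. openin (zariski affine_line) U \<and> openin (zariski projective_line) V \<and>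
        h \<in> generated_algebra ({\<lambda>z. f (fst z) | f. f \<in> regular affine_line U} \<union>
                               {\<lambda>z. g (snd z) | g. g \<in> regular projective_line V})}"
  have G: "(UNIV \<times> V, h) \<in> ?\<G>" if "h \<in> generated_algebra
      ({\<lambda>z. f (fst z) | f. f \<in> regular affine_line UNIV} \<union> {\<lambda>z. g (snd z) | g. g \<in> regular projective_line V})" for h
    unfolding mem_Collect_eq using that assms(1) openin_affine_line_UNIV
    by (intro exI[of _ UNIV] exI[of _ V] exI[of _ h]) simp
  have 1: "(UNIV \<times> V, \<lambda>_. 1) \<in> ?\<G>" by (intro G generated_algebra.const)
  have "openin (zariski (product_variety affine_line projective_line)) (UNIV \<times> V)"
    using open_variety_of_fractions[OF 1] unfolding product_variety_def by simp
  then show "openin (zariski Q_variety) U"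
    unfolding Q_variety_def open_subvariety_def U_def by (simp add: openin_subtopology_Int2)
  have reg: "h \<in> regular Q_variety U" if "(UNIV \<times> V, h) \<in> ?\<G>" for h
    unfolding Q_variety_def open_subvariety_def product_variety_def variety.simps
    by (rule regular_variety_of_fractions[OF that 1]) (auto simp: U_def)
  show "fst \<in> regular Q_variety U"
    by (intro reg G generated_algebra.gen UnI1 CollectI exI[of _ "\<lambda>z. z"])
      (auto intro: regular_affine_line_id)
  show "(\<lambda>z. g (snd z)) \<in> regular Q_variety U" if "g \<in> regular projective_line V"
    by (intro reg G generated_algebra.gen UnI2 CollectI exI[of _ g]) (simp add: that)
qed

lemma topspace_Q_variety: "topspace (zariski Q_variety) = Q_points"
proof -
  have "Q_points \<subseteq> topspace (zariski (product_variety affine_line projective_line))"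
  proof
    fix z assume "z \<in> Q_points"
    then obtain t v where z: "z = (t, proj_point v)" "v \<noteq> 0"
      unfolding Q_points_def by (auto simp: vec_eq_iff forall_2)
    show "z \<in> topspace (zariski (product_variety affine_line projective_line))"
      unfolding product_variety_def topspace_variety_of_fractions
      by (intro exI[of _ "UNIV \<times> topspace (zariski projective_line)"] exI[of _ "\<lambda>_. 1"])
        (use z topspace_projective_line openin_affine_line_UNIV in \<open>auto intro: generated_algebra.const\<close>)
  qed
  then show ?thesis unfolding Q_variety_def open_subvariety_def by auto
qed

lemma power_variety_cylinder:
  assumes "\<And>i. i < n \<Longrightarrow> openin (zariski Y) (U i)"
  shows "openin (zariski (power_variety Y n)) (PiE {..<n} U)"
    and "i < n \<Longrightarrow> f \<in> regular Y (U i) \<Longrightarrow> (\<lambda>x. f (x i)) \<in> regular (power_variety Y n) (PiE {..<n} U)"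
proof -
  let ?\<G> = "{(PiE {..<n} U, h) | U h. (\<forall>i<n. openin (zariski Y) (U i)) \<and>
        h \<in> generated_algebra {\<lambda>x. f (x i) | i f. i < n \<and> f \<in> regular Y (U i)}}"
  have G: "(PiE {..<n} U, h) \<in> ?\<G>"
    if "h \<in> generated_algebra {\<lambda>x. f (x i) | i f. i < n \<and> f \<in> regular Y (U i)}" for h
    unfolding mem_Collect_eq using that assms by (intro exI[of _ U] exI[of _ h]) simp
  have 1: "(PiE {..<n} U, \<lambda>_. 1) \<in> ?\<G>" by (intro G generated_algebra.const)
  show "openin (zariski (power_variety Y n)) (PiE {..<n} U)"
    using open_variety_of_fractions[OF 1] unfolding power_variety_def by simp
  show "(\<lambda>x. f (x i)) \<in> regular (power_variety Y n) (PiE {..<n} U)" if "i < n" "f \<in> regular Y (U i)"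
    unfolding power_variety_def
    by (rule regular_variety_of_fractions[OF G 1 order_refl], rule generated_algebra.gen)
      (use that in blast)
qed

lemma topspace_power_variety:
  "topspace (zariski (power_variety Y n)) = PiE {..<n} (\<lambda>_. topspace (zariski Y))"
proof (rule equalityI)
  show "topspace (zariski (power_variety Y n)) \<subseteq> PiE {..<n} (\<lambda>_. topspace (zariski Y))"
  proof
    fix x assume "x \<in> topspace (zariski (power_variety Y n))"
    then obtain U where U: "x \<in> PiE {..<n} U" "\<forall>i<n. openin (zariski Y) (U i)"
      unfolding power_variety_def topspace_variety_of_fractions by auto
    have "x i \<in> topspace (zariski Y)" if "i < n" for i
      using U that openin_subset[of "zariski Y" "U i"] by (auto simp: PiE_iff)
    then show "x \<in> PiE {..<n} (\<lambda>_. topspace (zariski Y))" using U(1) by (simp add: PiE_iff)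
  qed
  show "PiE {..<n} (\<lambda>_. topspace (zariski Y)) \<subseteq> topspace (zariski (power_variety Y n))"
    by (rule openin_subset[OF power_variety_cylinder(1)]) simp
qed

section \<open>Two-by-two matrices\<close>

definition mat22 :: "complex \<Rightarrow> complex \<Rightarrow> complex \<Rightarrow> complex \<Rightarrow> complex^2^2" where
  "mat22 a b c d = vector [vector [a, b], vector [c, d]]"

text \<open>Serves as the test for linear independence: \<open>u\<close> and \<open>v\<close> are
  independent iff \<open>det (cols u v)\<close> is nonzero.\<close>

definition cols :: "complex^2 \<Rightarrow> complex^2 \<Rightarrow> complex^2^2" where
  "cols u v = mat22 (u $ 1) (v $ 1) (u $ 2) (v $ 2)"

lemma mat22_nth [simp]:
  "mat22 a b c d $ 1 $ 1 = a" "mat22 a b c d $ 1 $ 2 = b"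
  "mat22 a b c d $ 2 $ 1 = c" "mat22 a b c d $ 2 $ 2 = d"
  by (simp_all add: mat22_def)

lemma matrix2_eq_iff:
  fixes A B :: "complex^2^2"
  shows "A = B \<longleftrightarrow> A $ 1 $ 1 = B $ 1 $ 1 \<and> A $ 1 $ 2 = B $ 1 $ 2 \<and> A $ 2 $ 1 = B $ 2 $ 1 \<and> A $ 2 $ 2 = B $ 2 $ 2"
  by (auto simp: vec_eq_iff forall_2)

lemma vec2_eq_iff:
  fixes u v :: "complex^2"
  shows "u = v \<longleftrightarrow> u $ 1 = v $ 1 \<and> u $ 2 = v $ 2"
  by (auto simp: vec_eq_iff forall_2)

lemma matrix2_mult_nth: "((A :: complex^2^2) ** B) $ i $ j = A $ i $ 1 * B $ 1 $ j + A $ i $ 2 * B $ 2 $ j"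
  by (simp add: matrix_matrix_mult_def sum_2)

lemma matrix2_vector_nth: "((A :: complex^2^2) *v v) $ i = A $ i $ 1 * v $ 1 + A $ i $ 2 * v $ 2"
  by (simp add: matrix_vector_mult_def sum_2)

lemma mat2_nth:
  "(mat a :: complex^2^2) $ 1 $ 1 = a" "(mat a :: complex^2^2) $ 1 $ 2 = 0"
  "(mat a :: complex^2^2) $ 2 $ 1 = 0" "(mat a :: complex^2^2) $ 2 $ 2 = a"
  by (simp_all add: mat_def)

lemma trace_2: "trace (A :: complex^2^2) = A $ 1 $ 1 + A $ 2 $ 2"
  by (simp add: trace_def sum_2)

lemma cols_nth [simp]:
  "cols u v $ 1 $ 1 = u $ 1" "cols u v $ 1 $ 2 = v $ 1"
  "cols u v $ 2 $ 1 = u $ 2" "cols u v $ 2 $ 2 = v $ 2"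
  by (simp_all add: cols_def)

lemmas matrix2_simps = matrix2_eq_iff vec2_eq_iff matrix2_mult_nth matrix2_vector_nth mat2_nth trace_2 det_2

lemma mult_cols: "A ** cols u v = cols (A *v u) (A *v v)"
  by (simp add: matrix2_simps)

text \<open>Both columns of the adjugate, up to sign, lie in the kernel; if both vanish then
  \<open>B = 0\<close> and any vector will do.\<close>

lemma singular_kernel:
  fixes B :: "complex^2^2"
  assumes "det B = 0" obtains v where "v \<noteq> 0" "B *v v = 0"
proof -
  have "B *v vector [B $ 1 $ 2, - (B $ 1 $ 1)] = 0" "B *v vector [B $ 2 $ 2, - (B $ 2 $ 1)] = 0"
    using assms by (simp_all add: matrix2_simps algebra_simps)
  moreover have "B *v vector [1, 0] = 0" if "B = 0" using that by simp
  moreover have "vector [1, 0] \<noteq> (0 :: complex^2)" by (simp add: vec2_eq_iff)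
  moreover have "B = 0" if "vector [B $ 1 $ 2, - (B $ 1 $ 1)] = (0 :: complex^2)"
    "vector [B $ 2 $ 2, - (B $ 2 $ 1)] = (0 :: complex^2)"
    using that by (simp add: matrix2_eq_iff vec2_eq_iff)
  ultimately show thesis using that by blast
qed

lemma det_cols_eq_0D:
  assumes "det (cols u v) = 0" "u \<noteq> 0" obtains a where "v = a *s u"
proof (cases "u $ 1 = 0")
  case True
  then have "v = (v $ 2 / u $ 2) *s u" using assms by (simp add: matrix2_simps)
  then show thesis using that by blast
next
  case False
  then have "v = (v $ 1 / u $ 1) *s u" using assms by (simp add: matrix2_simps field_simps)
  then show thesis using that by blast
qed

lemma det_cols_scale [simp]: "det (cols u (a *s u)) = 0"
  by (simp add: det_2)

lemma eigenvector_exists: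
  fixes A :: "complex^2^2"
  assumes "det A = 1" "trace A = a + 1 / a" "a \<noteq> 0"
  obtains v where "v \<noteq> 0" "A *v v = a *s v"
proof -
  have "det (A - mat a) = det A - a * trace A + a\<^sup>2"
    by (simp add: matrix2_simps power2_eq_square algebra_simps)
  also have "\<dots> = 0" using assms by (simp add: power2_eq_square algebra_simps)
  finally obtain v where "v \<noteq> 0" "(A - mat a) *v v = 0" by (rule singular_kernel)
  then show thesis using that[of v] by (simp add: matrix2_simps algebra_simps)
qed

lemma matrix_inv_2:
  fixes P :: "complex^2^2"
  assumes "det P \<noteq> 0"
  shows "P ** matrix_inv P = mat 1" "matrix_inv P ** P = mat 1"
proof -
  have "\<exists>Q. P ** Q = mat 1 \<and> Q ** P = mat 1"
    using assms by (simp flip: invertible_det_nz add: invertible_def)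
  then have "P ** matrix_inv P = mat 1 \<and> matrix_inv P ** P = mat 1"
    unfolding matrix_inv_def by (rule someI_ex)
  then show "P ** matrix_inv P = mat 1" "matrix_inv P ** P = mat 1" by auto
qed

text \<open>Two independent eigenvectors would make \<open>A\<close> the scalar \<open>a\<close>, of
  trace \<open>2 * a\<close>; but \<open>2 * a = a + 1 / a\<close> forces
  \<open>a\<^sup>2 = 1\<close>.\<close>

lemma eigenspace_1dim:
  fixes A :: "complex^2^2"
  assumes "trace A = a + 1 / a" "a \<noteq> 0" "a\<^sup>2 \<noteq> 1"
    and "u \<noteq> 0" "A *v u = a *s u" "A *v x = a *s x"
  obtains s where "x = s *s u"
proof -
  have "det (cols u x) = 0"
  proof (rule ccontr)
    assume "det (cols u x) \<noteq> 0"
    note inv = matrix_inv_2(1)[OF this]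
    have "A ** cols u x = mat a ** cols u x"
      using assms(5,6) by (simp add: mult_cols matrix2_simps)
    then have "A ** cols u x ** matrix_inv (cols u x) = mat a ** cols u x ** matrix_inv (cols u x)" by simp
    then have "A = mat a" by (simp add: inv flip: matrix_mul_assoc)
    then show False using assms(1-3) by (simp add: matrix2_simps field_simps power2_eq_square)
  qed
  then show thesis using det_cols_eq_0D assms(4) that by blast
qed

section \<open>Inverses, conjugation and the classes \<open>C_i\<close>\<close>

lemma matrix_inv_eqI:
  fixes P :: "complex^2^2"
  assumes "P ** Q = mat 1" shows "matrix_inv P = Q" "det P \<noteq> 0"
proof -
  have "det P * det Q = 1" using assms by (metis det_I det_mul)
  then show d: "det P \<noteq> 0" by auto
  have "matrix_inv P = matrix_inv P ** (P ** Q)" by (simp add: assms)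
  then show "matrix_inv P = Q" by (simp add: matrix_mul_assoc matrix_inv_2[OF d])
qed

lemma matrix_inv_entries:
  fixes P :: "complex^2^2"
  assumes "det P \<noteq> 0"
  shows "matrix_inv P = mat22 (P $ 2 $ 2 / det P) (- P $ 1 $ 2 / det P) (- P $ 2 $ 1 / det P) (P $ 1 $ 1 / det P)"
proof (rule matrix_inv_eqI)
  have "(P $ 1 $ 1 * P $ 2 $ 2 - P $ 1 $ 2 * P $ 2 $ 1) / det P = 1" using assms by (simp add: det_2)
  then have "P $ 1 $ 1 * P $ 2 $ 2 / det P = 1 + P $ 1 $ 2 * P $ 2 $ 1 / det P"
    unfolding diff_divide_distrib by (simp only: diff_eq_eq)
  then show "P ** mat22 (P $ 2 $ 2 / det P) (- P $ 1 $ 2 / det P) (- P $ 2 $ 1 / det P) (P $ 1 $ 1 / det P) = mat 1"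
    by (simp add: matrix2_eq_iff matrix2_mult_nth mat2_nth mult.commute algebra_simps)
qed

lemma matrix_inv_mult:
  fixes P Q :: "complex^2^2"
  assumes "det P \<noteq> 0" "det Q \<noteq> 0"
  shows "matrix_inv (P ** Q) = matrix_inv Q ** matrix_inv P"
proof (rule matrix_inv_eqI)
  have "P ** Q ** (matrix_inv Q ** matrix_inv P) = P ** (Q ** matrix_inv Q) ** matrix_inv P"
    by (simp only: matrix_mul_assoc)
  then show "P ** Q ** (matrix_inv Q ** matrix_inv P) = mat 1" by (simp add: matrix_inv_2 assms)
qed

lemma det_matrix_inv:
  fixes P :: "complex^2^2"
  assumes "det P \<noteq> 0" shows "det (matrix_inv P) = 1 / det P"
  using matrix_inv_2(1)[OF assms] assms by (metis det_I det_mul nonzero_mult_div_cancel_left)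

definition conjugate :: "complex^2^2 \<Rightarrow> complex^2^2 \<Rightarrow> complex^2^2" where
  "conjugate P A = P ** A ** matrix_inv P"

lemma conjugate_mult:
  assumes "det P \<noteq> 0" shows "conjugate P (A ** B) = conjugate P A ** conjugate P B"
proof -
  have "conjugate P A ** conjugate P B = P ** A ** (matrix_inv P ** P) ** B ** matrix_inv P"
    by (simp only: conjugate_def matrix_mul_assoc)
  then show ?thesis by (simp add: matrix_inv_2[OF assms] conjugate_def matrix_mul_assoc)
qed

lemma mat_commute: "mat a ** (A :: complex^2^2) = A ** mat a"
  by (simp add: matrix2_simps)

lemma conjugate_mat:
  assumes "det P \<noteq> 0" shows "conjugate P (mat a) = mat a"
proof -
  have "conjugate P (mat a) = mat a ** (P ** matrix_inv P)"
    by (simp add: conjugate_def mat_commute[symmetric] matrix_mul_assoc)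
  then show ?thesis by (simp add: matrix_inv_2[OF assms])
qed

lemma conjugate_add: "conjugate P (A + B) = conjugate P A + conjugate P B"
  by (simp add: conjugate_def matrix2_simps algebra_simps)

lemma conjugate_diff: "conjugate P (A - B) = conjugate P A - conjugate P B"
  by (simp add: conjugate_def matrix2_simps algebra_simps)

lemma conjugate_conjugate:
  assumes "det P \<noteq> 0" "det Q \<noteq> 0" shows "conjugate P (conjugate Q A) = conjugate (P ** Q) A"
  by (simp add: conjugate_def matrix_inv_mult assms matrix_mul_assoc)

lemma conjugate_inverse:
  assumes "det P \<noteq> 0"
  shows "conjugate P (conjugate (matrix_inv P) A) = A" "conjugate (matrix_inv P) (conjugate P A) = A"
proof -
  have "det (matrix_inv P) \<noteq> 0" using det_matrix_inv[OF assms] assms by simp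
  moreover have "conjugate (mat 1) A = A" using matrix_inv_eqI(1)[of "mat 1" "mat 1"] by (simp add: conjugate_def)
  ultimately show "conjugate P (conjugate (matrix_inv P) A) = A" "conjugate (matrix_inv P) (conjugate P A) = A"
    by (simp_all add: conjugate_conjugate assms matrix_inv_2)
qed

lemma trace_conjugate: assumes "det P \<noteq> 0" shows "trace (conjugate P A) = trace A"
proof -
  have "trace (conjugate P A) = trace (matrix_inv P ** (P ** A))"
    unfolding conjugate_def by (rule trace_mul_sym)
  then show ?thesis by (simp add: matrix_mul_assoc matrix_inv_2[OF assms])
qed

lemma det_conjugate: assumes "det P \<noteq> 0" shows "det (conjugate P A) = det A"
  using assms by (simp add: conjugate_def det_mul det_matrix_inv)

lemma conjugate_eq_0_iff: assumes "det P \<noteq> 0" shows "conjugate P A = 0 \<longleftrightarrow> A = 0"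
proof -
  have "conjugate Q 0 = 0" for Q by (simp add: conjugate_def matrix2_simps)
  then show ?thesis using conjugate_inverse(2)[OF assms, of A] by metis
qed

lemma conjugate_iff:
  assumes "det P \<noteq> 0" shows "A = conjugate P B \<longleftrightarrow> A ** P = P ** B"
proof
  assume "A = conjugate P B"
  then show "A ** P = P ** B"
    by (simp add: conjugate_def matrix_inv_2[OF assms] flip: matrix_mul_assoc)
next
  assume "A ** P = P ** B"
  then have "conjugate P B = A ** (P ** matrix_inv P)" by (simp add: conjugate_def matrix_mul_assoc)
  then show "A = conjugate P B" by (simp add: matrix_inv_2[OF assms])
qed

lemma det_diag2: "det (diag2 a b) = a * b" and trace_diag2: "trace (diag2 a b) = a + b"
  by (simp_all add: diag2_def matrix2_simps)

text \<open>The eigenvalues \<open>a\<close> and \<open>1 / a\<close> are distinct, so eigenvectors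
  form a basis and determinant and trace determine the class. This describes \<open>Rep\<close> by
  polynomial equations.\<close>

lemma conj_class_iff:
  assumes "a \<noteq> 0" "a\<^sup>2 \<noteq> 1"
  shows "A \<in> conj_class a \<longleftrightarrow> det A = 1 \<and> trace A = a + 1 / a"
proof
  assume "A \<in> conj_class a"
  then obtain P where P: "det P = 1" "A = conjugate P (diag2 a (inverse a))"
    by (auto simp: conj_class_def conjugate_def)
  then show "det A = 1 \<and> trace A = a + 1 / a"
    using assms by (simp add: det_conjugate trace_conjugate det_diag2 trace_diag2 inverse_eq_divide)
next
  assume A: "det A = 1 \<and> trace A = a + 1 / a"
  obtain u where u: "u \<noteq> 0" "A *v u = a *s u"
    using eigenvector_exists[of A a] A assms by blast
  obtain w where w: "w \<noteq> 0" "A *v w = (1 / a) *s w"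
    using eigenvector_exists[of A "1 / a"] A assms by (auto simp: add.commute)
  have d: "det (cols u w) \<noteq> 0"
  proof
    assume "det (cols u w) = 0"
    then obtain b where b: "w = b *s u" using det_cols_eq_0D u(1) by blast
    have "A *v w = a *s w" by (simp add: b vector_scalar_commute u(2) mult.commute)
    then have "(1 / a - a) *s w = 0" using w(2) by (simp add: vec2_eq_iff algebra_simps)
    then show False using w(1) assms by (auto simp: field_simps power2_eq_square)
  qed
  \<comment> \<open>One eigenvector is rescaled because \<open>conj_class\<close> asks for a
    conjugating matrix of determinant 1.\<close>
  let ?P = "cols ((1 / det (cols u w)) *s u) w"
  have "det (cols (k *s u) w) = k * det (cols u w)" for k by (simp add: det_2 algebra_simps)
  then have P: "det ?P = 1" using d by (metis nonzero_eq_divide_eq)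
  have "A ** ?P = ?P ** diag2 a (inverse a)"
    unfolding mult_cols vector_scalar_commute u(2) w(2)
    by (simp add: diag2_def matrix2_eq_iff matrix2_mult_nth inverse_eq_divide)
  then have "A = conjugate ?P (diag2 a (inverse a))" using P by (subst conjugate_iff) auto
  then show "A \<in> conj_class a" using P unfolding conj_class_def conjugate_def by blast
qed

section \<open>Stable three-holed spheres\<close>

definition stable_pair :: "complex \<Rightarrow> complex^2^2 \<Rightarrow> complex^2^2 \<Rightarrow> bool" where
  "stable_pair c A R \<longleftrightarrow> (\<forall>e. e \<noteq> 0 \<and> A *v e = (1 / c) *s e \<longrightarrow> det (cols e (R *v e)) \<noteq> 0)"

text \<open>By Cayley-Hamilton the image of \<open>A - mat c\<close> is the
  \<open>1 / c\<close>-eigenline of \<open>A\<close>, while the kernel of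
  \<open>A' - mat (1 / c')\<close> is the \<open>1 / c'\<close>-eigenline of \<open>A'\<close>. So
  for matrices of the prescribed classes the product vanishes exactly when \<open>Y\<close> maps the
  first line into the second.\<close>

definition transfer :: "complex \<Rightarrow> complex^2^2 \<Rightarrow> complex \<Rightarrow> complex^2^2 \<Rightarrow> complex^2^2 \<Rightarrow> complex^2^2" where
  "transfer c' A' c A Y = (A' - mat (1 / c')) ** Y ** (A - mat c)"

text \<open>
  The matrix with kernel spanned by \<open>u\<close> and image spanned by \<open>u'\<close>.
\<close>

definition rank_one :: "complex^2 \<Rightarrow> complex^2 \<Rightarrow> complex^2^2" where
  "rank_one u' u = mat22 (u' $ 1 * u $ 2) (- u' $ 1 * u $ 1) (u' $ 2 * u $ 2) (- u' $ 2 * u $ 1)"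

lemma trace_rank_one: "trace (rank_one u' u ** X) = det (cols (X *v u') u)"
  by (simp add: rank_one_def matrix2_simps algebra_simps)

lemma rank_one_eq_0_iff: "u \<noteq> 0 \<Longrightarrow> rank_one u' u = 0 \<longleftrightarrow> u' = 0"
  by (auto simp: rank_one_def matrix2_simps)

lemma rank_one_eq_0: "u \<noteq> 0 \<Longrightarrow> u' \<noteq> 0 \<Longrightarrow> rank_one u' u \<noteq> 0"
  by (simp add: rank_one_eq_0_iff)

lemma mult_rank_one: "B ** rank_one u' u = rank_one (B *v u') u"
  by (simp add: rank_one_def matrix2_simps algebra_simps)

lemma Cayley_Hamilton_1:
  fixes A :: "complex^2^2"
  assumes "det A = 1" "trace A = c + 1 / c" "c \<noteq> 0"
  shows "(A - mat c) ** (A - mat (1 / c)) = 0" "(A - mat (1 / c)) ** (A - mat c) = 0"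
proof -
  have *: "(A - mat a) ** (A - mat b) = mat (trace A - (a + b)) ** A + mat (a * b - det A)" for a b
    by (simp add: matrix2_simps algebra_simps)
  have "mat 0 = (0 :: complex^2^2)" by (simp add: matrix2_simps)
  then show "(A - mat c) ** (A - mat (1 / c)) = 0" "(A - mat (1 / c)) ** (A - mat c) = 0"
    unfolding * using assms by (simp_all add: add.commute)
qed

text \<open>The right factor kills \<open>u\<close>, and Cayley-Hamilton puts the image into the
  line of \<open>u'\<close>. Here \<open>u\<close> and \<open>u'\<close> belong to the eigenvalues
  \<open>c\<close> and \<open>c'\<close>, not to their inverses. The rank-one matrix does not depend
  on \<open>Y\<close>; only the scalar \<open>s\<close> does.\<close>

lemma transfer_rank_one:
  assumes A: "det A = 1" "trace A = c + 1 / c" "c \<noteq> 0" "u \<noteq> 0" "A *v u = c *s u"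
    and A': "det A' = 1" "trace A' = c' + 1 / c'" "c' \<noteq> 0" "c'\<^sup>2 \<noteq> 1" "u' \<noteq> 0" "A' *v u' = c' *s u'"
  obtains s where "transfer c' A' c A Y = mat s ** rank_one u' u"
proof -
  let ?N = "transfer c' A' c A Y"
  have "(A - mat c) *v u = 0" using A(5) by (simp add: matrix2_simps algebra_simps)
  then have N: "?N *v u = 0" by (simp add: transfer_def flip: matrix_vector_mul_assoc)
  have "(A' - mat c') ** ?N = ((A' - mat c') ** (A' - mat (1 / c'))) ** Y ** (A - mat c)"
    by (simp add: transfer_def matrix_mul_assoc)
  then have N': "(A' - mat c') ** ?N = 0" by (simp add: Cayley_Hamilton_1[OF A'(1-3)])
  \<comment> \<open>A matrix killing \<open>u\<close> is \<open>rank_one x u\<close> for some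
    \<open>x\<close>, which is read off from a column after division by a nonzero coordinate of
    \<open>u\<close>.\<close>
  obtain x where x: "?N = rank_one x u"
  proof (cases "u $ 1 = 0")
    case True
    with A(4) have u2: "u $ 2 \<noteq> 0" by (simp add: vec2_eq_iff)
    have "?N = rank_one (vector [?N $ 1 $ 1 / u $ 2, ?N $ 2 $ 1 / u $ 2]) u"
      using N u2 True by (simp add: rank_one_def matrix2_eq_iff vec2_eq_iff matrix2_vector_nth)
    then show thesis using that by blast
  next
    case False
    have "?N = rank_one (vector [- ?N $ 1 $ 2 / u $ 1, - ?N $ 2 $ 2 / u $ 1]) u"
      using N False by (simp add: rank_one_def matrix2_eq_iff vec2_eq_iff matrix2_vector_nth field_simps
          add_eq_0_iff)
    then show thesis using that by blast
  qed
  have "A' *v x = c' *s x"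
    using N' A(4) unfolding x by (simp add: mult_rank_one rank_one_eq_0_iff) (simp add: matrix2_simps algebra_simps)
  then obtain s where "x = s *s u'" using eigenspace_1dim[OF A'(2-6)] by blast
  then have "?N = mat s ** rank_one u' u" unfolding x by (simp add: rank_one_def matrix2_simps)
  then show thesis using that by blast
qed

lemma image_eigenspace:
  fixes A :: "complex^2^2"
  assumes "det A = 1" "trace A = c + 1 / c" "c \<noteq> 0" "c\<^sup>2 \<noteq> 1" "e \<noteq> 0" "A *v e = (1 / c) *s e"
  obtains s where "(A - mat c) *v z = s *s e"
proof -
  have "(A - mat (1 / c)) *v ((A - mat c) *v z) = 0"
    by (simp add: matrix_vector_mul_assoc Cayley_Hamilton_1[OF assms(1-3)])
  then have "A *v ((A - mat c) *v z) = (1 / c) *s ((A - mat c) *v z)"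
    by (simp add: matrix2_simps algebra_simps)
  moreover have "trace A = 1 / c + 1 / (1 / c)" "1 / c \<noteq> 0" "(1 / c)\<^sup>2 \<noteq> 1"
    using assms by (simp_all add: field_simps power2_eq_square)
  ultimately show thesis using eigenspace_1dim[of A "1 / c" e] assms that by blast
qed

text \<open>Writes \<open>e\<close> as an image under \<open>A - mat c\<close>, so that
  \<open>transfer\<close> can be evaluated on a multiple of \<open>e\<close> itself.\<close>

lemma preimage_eigenvector:
  fixes A :: "complex^2^2"
  assumes "c \<noteq> 0" "c\<^sup>2 \<noteq> 1" "A *v e = (1 / c) *s e"
  shows "(A - mat c) *v ((1 / (1 / c - c)) *s e) = e"
proof -
  have "1 / c - c \<noteq> 0" using assms by (simp add: field_simps power2_eq_square)
  moreover have "(A - mat c) *v e = (1 / c - c) *s e" using assms(3) by (simp add: matrix2_simps algebra_simps)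
  ultimately show ?thesis by (simp add: vector_scalar_commute del: vector_sub_rdistrib)
qed

text \<open>Trades the quantifier over eigenvectors for the nonvanishing of a matrix that is
  polynomial in \<open>A\<close> and \<open>R\<close>.\<close>

lemma stable_pair_iff_transfer:
  assumes A: "det A = 1" "trace A = c + 1 / c" "c \<noteq> 0" "c\<^sup>2 \<noteq> 1"
  shows "stable_pair c A R \<longleftrightarrow> transfer c A c A R \<noteq> 0"
proof -
  have A': "trace A = 1 / c + 1 / (1 / c)" "1 / c \<noteq> 0" "(1 / c)\<^sup>2 \<noteq> 1"
    using A by (simp_all add: field_simps power2_eq_square)
  obtain e where e: "e \<noteq> 0" "A *v e = (1 / c) *s e" using eigenvector_exists[OF A(1) A'(1,2)] .
  show ?thesis
  proof
    assume st: "stable_pair c A R"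
    show "transfer c A c A R \<noteq> 0"
    proof
      assume "transfer c A c A R = 0"
      then have "transfer c A c A R *v ((1 / (1 / c - c)) *s e) = 0" by simp
      then have "(A - mat (1 / c)) *v (R *v e) = 0"
        by (simp add: transfer_def preimage_eigenvector[OF A(3,4) e(2)] flip: matrix_vector_mul_assoc)
      then have "A *v (R *v e) = (1 / c) *s (R *v e)" by (simp add: matrix2_simps algebra_simps)
      then obtain s where "R *v e = s *s e" using eigenspace_1dim[OF A' e] by blast
      then show False using st e unfolding stable_pair_def by auto
    qed
  next
    assume N: "transfer c A c A R \<noteq> 0"
    show "stable_pair c A R"
      unfolding stable_pair_def
    proof (intro allI impI notI)
      fix e assume "e \<noteq> 0 \<and> A *v e = (1 / c) *s e" and "det (cols e (R *v e)) = 0"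
      then have e: "e \<noteq> 0" "A *v e = (1 / c) *s e" and "\<exists>b. R *v e = b *s e" using det_cols_eq_0D by metis+
      then obtain b where b: "R *v e = b *s e" by blast
      have "transfer c A c A R *v z = 0" for z
      proof -
        obtain s where s: "(A - mat c) *v z = s *s e" using image_eigenspace[OF A e] .
        have "(A - mat (1 / c)) *v e = 0" using e(2) by (simp add: matrix2_simps algebra_simps)
        then show ?thesis by (simp add: transfer_def s b vector_scalar_commute flip: matrix_vector_mul_assoc)
      qed
      then show False using N matrix_eq[of "transfer c A c A R" 0] by simp
    qed
  qed
qed

text \<open>The matrix is \<open>s\<close> times a fixed one of rank one, and the trace against
  \<open>X\<close> recovers \<open>s\<close> up to a nonzero factor as soon as \<open>X\<close>
  moves the line of \<open>u\<close>.\<close>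

lemma stable_pair_trace:
  assumes A: "det A = 1" "trace A = c + 1 / c" "c \<noteq> 0" "c\<^sup>2 \<noteq> 1"
    and u: "u \<noteq> 0" "A *v u = c *s u" and X: "det (cols (X *v u) u) \<noteq> 0"
  shows "stable_pair c A R \<longleftrightarrow> trace (transfer c A c A R ** X) \<noteq> 0"
proof -
  obtain s where s: "transfer c A c A R = mat s ** rank_one u u"
    using transfer_rank_one[OF A(1-3) u A u] .
  have "trace (mat s ** rank_one u u ** X) = s * trace (rank_one u u ** X)"
    by (simp add: matrix2_simps algebra_simps)
  moreover have "mat s ** rank_one u u = 0 \<longleftrightarrow> s = 0"
    using rank_one_eq_0[OF u(1) u(1)] by (auto simp: matrix2_simps)
  ultimately show ?thesis
    unfolding stable_pair_iff_transfer[OF A] s using X by (simp add: trace_rank_one)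
qed

lemma trace_transfer_stable:
  assumes A: "det A = 1" "trace A = c + 1 / c" "c \<noteq> 0" "c\<^sup>2 \<noteq> 1"
    and "trace (transfer c A c A R ** X) \<noteq> 0"
  shows "stable_pair c A R"
  using assms(5) unfolding stable_pair_iff_transfer[OF A] by (auto simp: matrix2_simps)

text \<open>Since \<open>e = A *v (c *s e)\<close>, a factor \<open>A\<close> can be pulled out of
  the determinant. Stability may thus be tested with the monodromy on either side of the
  piece.\<close>

lemma stable_pair_mult_iff:
  assumes "det A = 1" "c \<noteq> 0"
  shows "stable_pair c A (A ** R) \<longleftrightarrow> stable_pair c A R"
proof -
  have "det (cols e ((A ** R) *v e)) = c * det (cols e (R *v e))" if "A *v e = (1 / c) *s e" for e
  proof -
    have "cols e ((A ** R) *v e) = A ** cols (c *s e) (R *v e)"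
      using that assms(2) by (simp add: mult_cols vector_scalar_commute matrix_vector_mul_assoc)
    then show ?thesis by (simp add: det_mul assms) (simp add: det_2 algebra_simps)
  qed
  then show ?thesis unfolding stable_pair_def using assms(2) by auto
qed

section \<open>The line that glues two neighbouring pieces\<close>

definition gluing_line :: "complex \<Rightarrow> complex^2^2 \<Rightarrow> complex \<Rightarrow> complex^2^2 \<Rightarrow> complex^2^2 \<Rightarrow> (complex^2) set" where
  "gluing_line c' A' c A R = {v. transfer c' A' c A (mat (v $ 1) + mat (v $ 2) ** R) = 0}"

lemma transfer_linear:
  "transfer c' A' c A (mat p + mat q ** R) =
     mat p ** transfer c' A' c A (mat 1) + mat q ** transfer c' A' c A R"
proof -
  have "B ** (mat p + mat q ** R) ** D = mat p ** (B ** mat 1 ** D) + mat q ** (B ** R ** D)"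
    for B D :: "complex^2^2"
    by (simp add: matrix2_simps algebra_simps)
  then show ?thesis unfolding transfer_def .
qed

text \<open>The matrix \<open>p + q R\<close> commutes with \<open>R\<close>, so it factors out on
  the left, and its determinant is the homogenised characteristic polynomial of \<open>R\<close> up
  to a sign of the argument.\<close>

lemma det_cyclic:
  fixes R :: "complex^2^2"
  assumes "det R = 1"
  shows "det (cols ((mat p + mat q ** R) *v e) (R *v ((mat p + mat q ** R) *v e))) =
    (p\<^sup>2 + trace R * p * q + q\<^sup>2) * det (cols e (R *v e))"
proof -
  have "cols ((mat p + mat q ** R) *v e) (R *v ((mat p + mat q ** R) *v e)) =
      (mat p + mat q ** R) ** cols e (R *v e)"
    by (simp add: mult_cols) (simp add: matrix2_simps algebra_simps)
  moreover have "det (mat p + mat q ** R) = p\<^sup>2 + trace R * p * q + q\<^sup>2 * det R"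
    by (simp add: matrix2_simps algebra_simps power2_eq_square)
  ultimately show ?thesis using assms by (simp add: det_mul)
qed

text \<open>Both transfers are multiples \<open>s\<close> and \<open>r\<close> of one rank-one
  matrix, so the line is given by \<open>p * s + q * r = 0\<close>. A trace against \<open>X\<close>
  multiplies \<open>s\<close> and \<open>r\<close> by a common factor, which leaves the solution
  \<open>[b X : - a X]\<close> if that factor is nonzero.\<close>

lemma gluing_line:
  assumes A: "det A = 1" "trace A = c + 1 / c" "c \<noteq> 0" "c\<^sup>2 \<noteq> 1" "stable_pair c A R"
    and A': "det A' = 1" "trace A' = c' + 1 / c'" "c' \<noteq> 0" "c'\<^sup>2 \<noteq> 1" "stable_pair c' A' R"
    and R: "det R = 1"
    and u: "u \<noteq> 0" "A *v u = c *s u" "u' \<noteq> 0" "A' *v u' = c' *s u'"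
  defines "a X \<equiv> trace (transfer c' A' c A (mat 1) ** X)" and "b X \<equiv> trace (transfer c' A' c A R ** X)"
  shows "det (cols (X *v u') u) \<noteq> 0 \<Longrightarrow> a X \<noteq> 0 \<or> b X \<noteq> 0"
    and "a X \<noteq> 0 \<or> b X \<noteq> 0 \<Longrightarrow> gluing_line c' A' c A R = proj_point (vector [b X, - a X])"
    and "a X \<noteq> 0 \<or> b X \<noteq> 0 \<Longrightarrow> (b X)\<^sup>2 + trace R * b X * (- a X) + (- a X)\<^sup>2 \<noteq> 0"
proof -
  obtain s where s: "transfer c' A' c A (mat 1) = mat s ** rank_one u' u"
    using transfer_rank_one[OF A(1-3) u(1,2) A'(1-4) u(3,4)] .
  obtain r where r: "transfer c' A' c A R = mat r ** rank_one u' u"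
    using transfer_rank_one[OF A(1-3) u(1,2) A'(1-4) u(3,4)] .
  have flip: "trace A = 1 / c + 1 / (1 / c)" "1 / c \<noteq> 0" "trace A' = 1 / c' + 1 / (1 / c')"
      "1 / c' \<noteq> 0" "(1 / c')\<^sup>2 \<noteq> 1"
    using A A' by (simp_all add: field_simps power2_eq_square)
  obtain e where e: "e \<noteq> 0" "A *v e = (1 / c) *s e" using eigenvector_exists[OF A(1) flip(1,2)] .
  have cyc: "det (cols e (R *v e)) \<noteq> 0" using A(5) e unfolding stable_pair_def by blast
  have kill: "A' *v (Y *v e) = (1 / c') *s (Y *v e)" if "transfer c' A' c A Y = 0" for Y
  proof -
    from that have "transfer c' A' c A Y *v ((1 / (1 / c - c)) *s e) = 0" by simp
    then have "(A' - mat (1 / c')) *v (Y *v e) = 0"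
      by (simp add: transfer_def preimage_eigenvector[OF A(3,4) e(2)] flip: matrix_vector_mul_assoc)
    then show ?thesis by (simp add: matrix2_simps algebra_simps)
  qed
  \<comment> \<open>Otherwise \<open>e\<close> and \<open>R *v e\<close> both lie in the
    one-dimensional \<open>1 / c'\<close>-eigenspace of \<open>A'\<close>, against cyclicity of
    \<open>e\<close>.\<close>
  have sr: "s \<noteq> 0 \<or> r \<noteq> 0"
  proof (rule ccontr)
    assume "\<not> ?thesis"
    then have "transfer c' A' c A (mat 1) = 0" "transfer c' A' c A R = 0"
      unfolding s r by (simp_all add: matrix2_simps)
    from kill[OF this(1)] kill[OF this(2)] obtain k where "R *v e = k *s e"
      using eigenspace_1dim[OF flip(3-5) e(1)] by auto
    with cyc show False by auto
  qed
  have ab: "a X = s * trace (rank_one u' u ** X)" "b X = r * trace (rank_one u' u ** X)"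
    unfolding a_def b_def s r by (simp_all add: matrix2_simps algebra_simps)
  then show "a X \<noteq> 0 \<or> b X \<noteq> 0" if "det (cols (X *v u') u) \<noteq> 0"
    using that sr by (auto simp: trace_rank_one)
  assume "a X \<noteq> 0 \<or> b X \<noteq> 0"
  then have tau: "trace (rank_one u' u ** X) \<noteq> 0" (is "?\<tau> \<noteq> 0") using ab by auto
  have line: "v \<in> gluing_line c' A' c A R \<longleftrightarrow> v $ 1 * s + v $ 2 * r = 0" for v
  proof -
    have "mat (v $ 1) ** (mat s ** rank_one u' u) + mat (v $ 2) ** (mat r ** rank_one u' u) =
        mat (v $ 1 * s + v $ 2 * r) ** rank_one u' u"
      by (simp add: matrix2_simps algebra_simps)
    moreover have "mat k ** rank_one u' u = 0 \<longleftrightarrow> k = 0" for k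
      using rank_one_eq_0[OF u(1,3)] by (auto simp: matrix2_simps)
    ultimately show ?thesis unfolding gluing_line_def mem_Collect_eq transfer_linear s r by simp
  qed
  show "gluing_line c' A' c A R = proj_point (vector [b X, - a X])"
  proof (intro equalityI subsetI)
    fix v assume "v \<in> gluing_line c' A' c A R"
    then have v: "v $ 1 * s + v $ 2 * r = 0" unfolding line .
    have "\<exists>k. v = k *s vector [b X, - a X]"
    proof (cases "s = 0")
      case True
      with v sr tau show ?thesis by (intro exI[of _ "v $ 1 / b X"]) (simp add: ab vec2_eq_iff)
    next
      case False
      with v tau show ?thesis
        by (intro exI[of _ "- v $ 2 / a X"]) (simp add: ab vec2_eq_iff field_simps add_eq_0_iff)
    qed
    then show "v \<in> proj_point (vector [b X, - a X])"
      unfolding proj_point_def vec.span_singleton by auto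
  next
    fix v assume "v \<in> proj_point (vector [b X, - a X])"
    then obtain k where "v = k *s vector [b X, - a X]"
      unfolding proj_point_def vec.span_singleton by auto
    then show "v \<in> gluing_line c' A' c A R" unfolding line by (simp add: ab)
  qed
  have "vector [b X, - a X] \<in> gluing_line c' A' c A R" unfolding line by (simp add: ab)
  then have "transfer c' A' c A (mat (b X) + mat (- a X) ** R) = 0"
    by (simp add: gluing_line_def)
  from kill[OF this]
  have e': "A' *v ((mat (b X) + mat (- a X) ** R) *v e) = (1 / c') *s ((mat (b X) + mat (- a X) ** R) *v e)" .
  \<comment> \<open>Independence of \<open>e\<close> and \<open>R *v e\<close> makes this vector
    nonzero. It is then an eigenvector to which stability of \<open>(A', R)\<close> applies.\<close>
  have "(mat (b X) + mat (- a X) ** R) *v e \<noteq> 0"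
  proof
    assume *: "(mat (b X) + mat (- a X) ** R) *v e = 0"
    have "(mat (b X) + mat (- a X) ** R) *v e = b X *s e - a X *s (R *v e)"
      by (simp add: matrix2_simps algebra_simps)
    with * have eq: "b X *s e = a X *s (R *v e)" by simp
    show False
    proof (cases "a X = 0")
      case True
      then show False using eq e(1) \<open>a X \<noteq> 0 \<or> b X \<noteq> 0\<close> by simp
    next
      case False
      then have "R *v e = (b X / a X) *s e" using eq by (simp add: vec2_eq_iff field_simps)
      with cyc show False by auto
    qed
  qed
  with A'(5) e' show "(b X)\<^sup>2 + trace R * b X * (- a X) + (- a X)\<^sup>2 \<noteq> 0"
    using det_cyclic[OF R, of "b X" "- a X" e] unfolding stable_pair_def by fastforce
qed

section \<open>Normal forms and changes of frame\<close>

definition companion :: "complex \<Rightarrow> complex^2^2" where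
  "companion t = mat22 0 (-1) 1 t"

text \<open>The matrix A_i in the basis \<open>(e, R_(i-1) e)\<close>, with t and t' the traces of
  R_(i-1) and R_i. The corner entry is forced by the trace of R_i.\<close>

definition normal_form :: "complex \<Rightarrow> complex \<Rightarrow> complex \<Rightarrow> complex^2^2" where
  "normal_form c t t' = mat22 (1 / c) (t / c - t') 0 c"

text \<open>R_i in the same basis, that is, the inverse of \<open>normal_form\<close> times
  \<open>companion t\<close>.\<close>

definition normal_quot :: "complex \<Rightarrow> complex \<Rightarrow> complex \<Rightarrow> complex^2^2" where
  "normal_quot c t t' = mat22 (t' - t / c) ((t' - t / c) * t - c) (1 / c) (t / c)"

definition axis1 :: "complex^2" where
  "axis1 = vector [1, 0]"

text \<open>The next frame \<open>(e_(i+1), R_i e_(i+1))\<close>, written in coordinates of the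
  frame of S_i.\<close>

definition transition :: "complex \<Rightarrow> complex \<Rightarrow> complex \<Rightarrow> complex^2 \<Rightarrow> complex^2^2" where
  "transition c t t' v =
     (let e = (mat (v $ 1) + mat (v $ 2) ** normal_quot c t t') *v axis1
      in cols e (normal_quot c t t' *v e))"

lemma axis1_nth [simp]: "axis1 $ 1 = 1" "axis1 $ 2 = 0"
  by (simp_all add: axis1_def)

lemma normal_form_quot: "c \<noteq> 0 \<Longrightarrow> normal_form c t t' ** normal_quot c t t' = companion t"
  by (simp add: normal_form_def normal_quot_def companion_def matrix2_simps field_simps)

lemma det_trace_normal:
  assumes "c \<noteq> 0"
  shows "det (companion t) = 1" "trace (companion t) = t"
    "det (normal_form c t t') = 1" "trace (normal_form c t t') = c + 1 / c"
    "det (normal_quot c t t') = 1" "trace (normal_quot c t t') = t'"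
  using assms
  by (simp_all add: companion_def normal_form_def normal_quot_def matrix2_simps algebra_simps)

lemma Cayley_Hamilton_vec:
  fixes R :: "complex^2^2"
  shows "R *v (R *v e) = trace R *s (R *v e) - det R *s e"
  by (simp add: matrix2_simps algebra_simps)

lemma cyclic_companion:
  fixes R :: "complex^2^2"
  assumes "det R = 1"
  shows "R ** cols e (R *v e) = cols e (R *v e) ** companion (trace R)"
  unfolding mult_cols Cayley_Hamilton_vec assms
  by (simp add: companion_def matrix2_eq_iff matrix2_mult_nth)

lemma quot_transition:
  assumes "c \<noteq> 0"
  shows "normal_quot c t t' ** transition c t t' v = transition c t t' v ** companion t'"
  using cyclic_companion[of "normal_quot c t t'" "(mat (v $ 1) + mat (v $ 2) ** normal_quot c t t') *v axis1"]
  by (simp add: transition_def Let_def det_trace_normal assms)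

text \<open>The factor \<open>1 / c\<close> is the determinant of \<open>(e, R_i e)\<close> relative
  to the frame \<open>(e, R_(i-1) e)\<close>.\<close>

lemma det_transition:
  assumes "c \<noteq> 0"
  shows "det (transition c t t' v) = ((v $ 1)\<^sup>2 + t' * v $ 1 * v $ 2 + (v $ 2)\<^sup>2) / c"
proof -
  have "det (cols axis1 (normal_quot c t t' *v axis1)) = 1 / c"
    by (simp add: normal_quot_def matrix2_simps)
  then show ?thesis
    using det_cyclic[OF det_trace_normal(5)[OF assms], of "v $ 1" "v $ 2" t t' axis1]
    by (simp add: transition_def Let_def det_trace_normal assms)
qed

lemma transition_scale: "transition c t t' (s *s v) = mat s ** transition c t t' v"
  by (simp add: transition_def Let_def matrix2_simps algebra_simps)

text \<open>In the basis \<open>M\<close> the eigenvector gives the first column of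
  \<open>A\<close>, and the determinant gives its diagonal. The product \<open>A ** R'\<close> being
  a companion matrix then determines the lower row of \<open>R'\<close>, and the trace of
  \<open>R'\<close> settles the remaining entries.\<close>

lemma frame_normal_form:
  fixes A R R' :: "complex^2^2"
  assumes e: "A *v e = (1 / c) *s e" and "det A = 1" "c \<noteq> 0" "det R = 1" "R = A ** R'"
    and M: "M = cols e (R *v e)" "det M \<noteq> 0"
  shows "A ** M = M ** normal_form c (trace R) (trace R')"
    and "R' ** M = M ** normal_quot c (trace R) (trace R')"
proof -
  define W where "W = matrix_inv M"
  have W: "det W \<noteq> 0" using M(2) by (simp add: W_def det_matrix_inv)
  have Me: "M *v axis1 = e" by (simp add: M(1) matrix2_simps)
  have We: "W *v e = axis1"
    by (simp add: W_def matrix_inv_2[OF M(2)] matrix_vector_mul_assoc flip: Me)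
  have MW: "matrix_inv W = M"
    unfolding W_def by (rule matrix_inv_eqI) (rule matrix_inv_2[OF M(2)])
  let ?A = "conjugate W A" and ?R' = "conjugate W R'"
  have "?A *v axis1 = W *v (A *v (M *v axis1))"
    by (simp add: conjugate_def MW matrix_vector_mul_assoc matrix_mul_assoc)
  also have "\<dots> = (1 / c) *s axis1" by (simp only: Me e vector_scalar_commute We)
  finally have A1: "?A $ 1 $ 1 = 1 / c" "?A $ 2 $ 1 = 0" by (simp_all add: matrix2_simps)
  have "det ?A = 1" using det_conjugate[OF W] assms(2) by simp
  then have A2: "?A $ 2 $ 2 = c" using A1 assms(3) by (simp add: det_2 field_simps)
  have "R ** M = M ** companion (trace R)"
    unfolding M(1) by (rule cyclic_companion) fact
  then have "R = conjugate M (companion (trace R))"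
    unfolding conjugate_iff[OF M(2)] .
  then have "conjugate W R = companion (trace R)"
    using conjugate_inverse(2)[OF M(2)] unfolding W_def by metis
  then have eq: "?A ** ?R' = companion (trace R)" by (simp add: assms(5) conjugate_mult[OF W])
  have R2: "?R' $ 2 $ 1 = 1 / c" "?R' $ 2 $ 2 = trace R / c"
    using eq assms(3) by (simp_all add: companion_def matrix2_eq_iff matrix2_mult_nth A1 A2 field_simps)
  have "?R' $ 1 $ 1 = - ?A $ 1 $ 2"
    using eq assms(3)
    by (simp add: companion_def matrix2_eq_iff matrix2_mult_nth A1 A2 R2 field_simps add_eq_0_iff)
  moreover have tr: "trace R' = ?R' $ 1 $ 1 + ?R' $ 2 $ 2" using trace_conjugate[OF W, of R'] by (simp add: trace_2)
  ultimately have A3: "?A $ 1 $ 2 = trace R / c - trace R'" by (simp add: R2)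
  have R1: "?R' $ 1 $ 1 = trace R' - trace R / c" using tr by (simp add: R2)
  have "?R' $ 1 $ 2 / c + ?A $ 1 $ 2 * (trace R / c) = -1"
    using eq by (simp add: companion_def matrix2_eq_iff matrix2_mult_nth A1 R2)
  then have "?R' $ 1 $ 2 = - c - (trace R / c - trace R') * trace R"
    using assms(3) A3 by (simp add: field_simps)
  then have "?R' = normal_quot c (trace R) (trace R')"
    using R1 R2 by (simp add: normal_quot_def matrix2_eq_iff algebra_simps)
  then have "R' = conjugate M (normal_quot c (trace R) (trace R'))"
    using conjugate_inverse(1)[OF M(2)] unfolding W_def by metis
  then show "R' ** M = M ** normal_quot c (trace R) (trace R')"
    unfolding conjugate_iff[OF M(2)] .
  have "?A = normal_form c (trace R) (trace R')"
    using A1 A2 A3 by (simp add: normal_form_def matrix2_eq_iff)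
  then have "A = conjugate M (normal_form c (trace R) (trace R'))"
    using conjugate_inverse(1)[OF M(2)] unfolding W_def by metis
  then show "A ** M = M ** normal_form c (trace R) (trace R')"
    unfolding conjugate_iff[OF M(2)] .
qed

text \<open>\<open>M\<close> intertwines \<open>normal_quot\<close> with \<open>R\<close>, so it
  carries the model frame to \<open>(e', R e')\<close>, where \<open>e'\<close> is an eigenvector of
  \<open>A'\<close> by the choice of \<open>v\<close>. Stability makes the new frame invertible, and
  its normal form follows.\<close>

lemma transition_step:
  fixes A R A' R' :: "complex^2^2"
  assumes M: "det M \<noteq> 0" "A ** M = M ** normal_form c t t'" "R ** M = M ** normal_quot c t t'"
    and c: "c \<noteq> 0" "c\<^sup>2 \<noteq> 1" and v: "v \<in> gluing_line c' A' c A R" "v \<noteq> 0"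
    and A': "det A' = 1" "c' \<noteq> 0" "stable_pair c' A' R'" and R: "R = A' ** R'"
  defines "M' \<equiv> M ** transition c t t' v"
  shows "det M' \<noteq> 0" "A' ** M' = M' ** normal_form c' t' (trace R')"
    "R' ** M' = M' ** normal_quot c' t' (trace R')"
proof -
  let ?P = "normal_quot c t t'"
  let ?f = "(mat (v $ 1) + mat (v $ 2) ** ?P) *v axis1"
  define e where "e = M *v axis1"
  define e' where "e' = (mat (v $ 1) + mat (v $ 2) ** R) *v e"
  have "R = conjugate M ?P" unfolding conjugate_iff[OF M(1)] by (rule M)
  then have dR: "det R = 1" and tR: "trace R = t'"
    using c by (simp_all add: det_conjugate[OF M(1)] trace_conjugate[OF M(1)] det_trace_normal)
  have "(mat (v $ 1) + mat (v $ 2) ** R) ** M = mat (v $ 1) ** M + mat (v $ 2) ** (R ** M)"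
    by (simp add: matrix2_simps algebra_simps)
  also have "\<dots> = M ** (mat (v $ 1) + mat (v $ 2) ** ?P)"
    unfolding M(3) by (simp add: matrix2_simps algebra_simps)
  finally have Mf: "M *v ?f = e'"
    by (simp add: e'_def e_def matrix_vector_mul_assoc)
  have MPf: "M *v (?P *v x) = R *v (M *v x)" for x
    using M(3) by (simp add: matrix_vector_mul_assoc)
  have M': "M' = cols e' (R *v e')"
    unfolding M'_def transition_def Let_def mult_cols MPf Mf ..
  have "normal_form c t t' *v axis1 = (1 / c) *s axis1" by (simp add: normal_form_def matrix2_simps)
  then have e: "A *v e = (1 / c) *s e"
    using M(2) by (metis e_def matrix_vector_mul_assoc vector_scalar_commute)
  have "?f \<noteq> 0"
    using v(2) c by (auto simp: normal_quot_def matrix2_simps)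
  then have "e' \<noteq> 0"
    using Mf M(1) by (metis invertible_det_nz matrix_left_invertible_ker invertible_def)
  have "transfer c' A' c A (mat (v $ 1) + mat (v $ 2) ** R) *v ((1 / (1 / c - c)) *s e) = 0"
    using v(1) by (simp add: gluing_line_def)
  then have "(A' - mat (1 / c')) *v e' = 0"
    by (simp add: transfer_def e'_def preimage_eigenvector[OF c e] flip: matrix_vector_mul_assoc)
  then have Ae': "A' *v e' = (1 / c') *s e'" by (simp add: matrix2_simps algebra_simps)
  have "stable_pair c' A' R" unfolding R stable_pair_mult_iff[OF A'(1,2)] by (rule A')
  then show d: "det M' \<noteq> 0" unfolding M' stable_pair_def using Ae' \<open>e' \<noteq> 0\<close> by blast
  show "A' ** M' = M' ** normal_form c' t' (trace R')"
    "R' ** M' = M' ** normal_quot c' t' (trace R')"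
    using frame_normal_form[OF Ae' A'(1,2) dR R M' d] unfolding tR .
qed

lemma conjugate_transfer:
  assumes "det P \<noteq> 0"
  shows "transfer c' (conjugate P A') c (conjugate P A) (conjugate P Y) = conjugate P (transfer c' A' c A Y)"
  by (simp add: transfer_def conjugate_mult[OF assms] conjugate_diff conjugate_mat[OF assms])

lemma conjugate_gluing_line:
  assumes "det P \<noteq> 0"
  shows "gluing_line c' (conjugate P A') c (conjugate P A) (conjugate P R) = gluing_line c' A' c A R"
proof -
  have "mat p + mat q ** conjugate P R = conjugate P (mat p + mat q ** R)" for p q
    by (simp add: conjugate_add conjugate_mult[OF assms] conjugate_mat[OF assms])
  then show ?thesis
    by (simp add: gluing_line_def conjugate_transfer[OF assms] conjugate_eq_0_iff[OF assms])
qed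

lemma conjugate_stable_pair:
  assumes "det P \<noteq> 0" and A: "det A = 1" "trace A = c + 1 / c" "c \<noteq> 0" "c\<^sup>2 \<noteq> 1"
  shows "stable_pair c (conjugate P A) (conjugate P R) \<longleftrightarrow> stable_pair c A R"
proof -
  have *: "det (conjugate P A) = 1" "trace (conjugate P A) = c + 1 / c"
    using A by (simp_all add: det_conjugate[OF assms(1)] trace_conjugate[OF assms(1)])
  show ?thesis
    unfolding stable_pair_iff_transfer[OF A] stable_pair_iff_transfer[OF * A(3,4)]
    by (simp add: conjugate_transfer conjugate_eq_0_iff assms(1))
qed

text \<open>A single nonzero entry of the transfer matrix suffices, and the lower left one is
  independent of both traces.\<close>

lemma stable_pair_normal:
  assumes "c \<noteq> 0" "c\<^sup>2 \<noteq> 1"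
  shows "stable_pair c (normal_form c t t') (normal_quot c t t')"
proof -
  have "transfer c (normal_form c t t') c (normal_form c t t') (normal_quot c t t') $ 2 $ 1 =
      (c - 1 / c) * (1 / c) * (1 / c - c)"
    by (simp add: transfer_def normal_form_def normal_quot_def matrix2_mult_nth mat2_nth)
  also have "\<dots> \<noteq> 0"
  proof -
    have "c - 1 / c \<noteq> 0" "1 / c - c \<noteq> 0" using assms by (simp_all add: field_simps power2_eq_square)
    then show ?thesis using assms(1) by simp
  qed
  finally have "transfer c (normal_form c t t') c (normal_form c t t') (normal_quot c t t') \<noteq> 0" by auto
  then show ?thesis
    by (subst stable_pair_iff_transfer) (simp_all add: det_trace_normal assms)
qed

lemma gluing_line_normal:
  assumes T: "det (transition c t t' v) \<noteq> 0"
  shows "v \<in> gluing_line c' (conjugate (transition c t t' v) (normal_form c' t' t''))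
    c (normal_form c t t') (normal_quot c t t')"
proof -
  let ?T = "transition c t t' v" and ?N = "normal_form c t t'" and ?N' = "normal_form c' t' t''"
  \<comment> \<open>Both left factors have the same first column, and \<open>?N - mat c\<close> has
    zero second row. For the same reason its image is the first axis, which
    \<open>?N' - mat (1 / c')\<close> kills.\<close>
  have TN: "(mat (v $ 1) + mat (v $ 2) ** normal_quot c t t') ** (?N - mat c) = ?T ** (?N - mat c)"
    by (simp add: transition_def Let_def normal_form_def matrix2_simps algebra_simps)
  have "conjugate ?T ?N' - mat (1 / c') = conjugate ?T (?N' - mat (1 / c'))"
    by (simp add: conjugate_diff conjugate_mat[OF T])
  then have "transfer c' (conjugate ?T ?N') c ?N (mat (v $ 1) + mat (v $ 2) ** normal_quot c t t') =
      conjugate ?T (?N' - mat (1 / c')) ** (?T ** (?N - mat c))"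
    by (simp add: transfer_def TN flip: matrix_mul_assoc)
  also have "\<dots> = ?T ** (?N' - mat (1 / c')) ** (matrix_inv ?T ** ?T) ** (?N - mat c)"
    by (simp only: conjugate_def matrix_mul_assoc)
  also have "\<dots> = ?T ** ((?N' - mat (1 / c')) ** (?N - mat c))"
    by (simp add: matrix_inv_2[OF T] flip: matrix_mul_assoc)
  also have "(?N' - mat (1 / c')) ** (?N - mat c) = 0"
    by (simp add: normal_form_def matrix2_simps)
  finally show ?thesis by (simp add: gluing_line_def)
qed

section \<open>Representations glued from normal forms\<close>

lemma det_companion [simp]: "det (companion t) = 1" and trace_companion [simp]: "trace (companion t) = t"
  by (simp_all add: companion_def det_2 trace_2)

text \<open>The frame with index m belongs to the piece S_(m+2); hence the double successors from
  here on.\<close>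

lemma middle_index:
  assumes "i \<in> {2..k - 1}" obtains m where "i = Suc (Suc m)" "Suc (Suc m) < k"
proof
  show "i = Suc (Suc (i - 2))" "Suc (Suc (i - 2)) < k" using assms by auto
qed

lemma ordered_prod_rec:
  assumes "m \<le> n" shows "ordered_prod A m n = A m ** ordered_prod A (Suc m) n"
  using assms by (simp add: ordered_prod_def upt_conv_Cons del: upt_Suc)

lemma cut_monodromy_rec: "i < k \<Longrightarrow> cut_monodromy k A i = A (Suc i) ** cut_monodromy k A (Suc i)"
  unfolding cut_monodromy_def using ordered_prod_rec[of "Suc i" k A] by simp

lemma cut_monodromy_last: "cut_monodromy k A k = mat 1"
  by (simp add: cut_monodromy_def ordered_prod_def)

lemma cut_monodromy_0: "cut_monodromy k A 0 = ordered_prod A 1 k"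
  by (simp add: cut_monodromy_def)

lemma downward_induct [consumes 1, case_names top step]:
  assumes "i \<le> k" "P k" "\<And>i. i < k \<Longrightarrow> P (Suc i) \<Longrightarrow> P i"
  shows "P (i :: nat)"
  using assms by (induction rule: inc_induct) auto

lemma conj_tuple_eq: "conj_tuple k P A = (\<lambda>i\<in>{1..k}. conjugate P (A i))"
  by (simp add: conj_tuple_def conjugate_def)

lemma cut_monodromy_conj_tuple:
  assumes "i \<le> k" "det P \<noteq> 0"
  shows "cut_monodromy k (conj_tuple k P A) i = conjugate P (cut_monodromy k A i)"
  using assms(1)
proof (induction rule: downward_induct)
  case (step i)
  then show ?case
    by (simp add: cut_monodromy_rec conjugate_mult[OF assms(2)]) (simp add: conj_tuple_eq)
qed (simp add: cut_monodromy_last conjugate_mat[OF assms(2)])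

locale punctured_sphere =
  fixes k :: nat and c :: "nat \<Rightarrow> complex"
  assumes k: "k \<ge> 3"
    and c: "\<And>i. i \<in> {1..k} \<Longrightarrow> c i \<noteq> 0 \<and> c i \<noteq> 1 \<and> c i \<noteq> -1"
    and generic: "generic_eigenvalues k c"
begin

lemma c_nonzero: "i \<in> {1..k} \<Longrightarrow> c i \<noteq> 0" and c_square: "i \<in> {1..k} \<Longrightarrow> (c i)\<^sup>2 \<noteq> 1"
  using c[of i] by (auto simp: power2_eq_1_iff)

lemma Rep_iff:
  "A \<in> Rep k c \<longleftrightarrow> A \<in> extensional {1..k} \<and>
     (\<forall>i\<in>{1..k}. det (A i) = 1 \<and> trace (A i) = c i + 1 / c i) \<and> cut_monodromy k A 0 = mat 1"
proof -
  have "A i \<in> conj_class (c i) \<longleftrightarrow> det (A i) = 1 \<and> trace (A i) = c i + 1 / c i" if "i \<in> {1..k}" for i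
    using conj_class_iff c_nonzero[OF that] c_square[OF that] by blast
  then show ?thesis unfolding Rep_def cut_monodromy_0 PiE_iff by auto
qed

lemma det_cut:
  assumes "A \<in> Rep k c" "i \<le> k" shows "det (cut_monodromy k A i) = 1"
  using assms(2)
proof (induction rule: downward_induct)
  case (step i)
  then show ?case using assms(1) by (simp add: cut_monodromy_rec det_mul Rep_iff)
qed (simp add: cut_monodromy_last)

text \<open>The frame of S_(m+2) in coordinates of the frame of S_2. Starting with the identity
  fixes the freedom of simultaneous conjugation.\<close>

primrec frame :: "(nat \<Rightarrow> complex) \<Rightarrow> (nat \<Rightarrow> complex^2) \<Rightarrow> nat \<Rightarrow> complex^2^2" where
  "frame t v 0 = mat 1"
| "frame t v (Suc m) = frame t v m ** transition (c (Suc (Suc m))) (t (Suc m)) (t (Suc (Suc m))) (v (Suc (Suc m)))"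

text \<open>R_i is a companion matrix in the frame of S_(i+1), whose index is \<open>i - 1\<close>;
  for \<open>i = k - 1\<close> this is an auxiliary frame beyond the last piece. The identities at 0
  and \<open>k\<close> encode the relation.\<close>

definition model_cut :: "(nat \<Rightarrow> complex) \<Rightarrow> (nat \<Rightarrow> complex^2) \<Rightarrow> nat \<Rightarrow> complex^2^2" where
  "model_cut t v i = (if i \<in> {1..<k} then conjugate (frame t v (i - 1)) (companion (t i)) else mat 1)"

definition build :: "(nat \<Rightarrow> complex) \<Rightarrow> (nat \<Rightarrow> complex^2) \<Rightarrow> nat \<Rightarrow> complex^2^2" where
  "build t v = (\<lambda>i\<in>{1..k}. model_cut t v (i - 1) ** matrix_inv (model_cut t v i))"

text \<open>The outer values are the traces of A_1^-1 and A_k. The inequalities keep all transition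
  matrices invertible, including the auxiliary one at \<open>k - 1\<close>.\<close>

definition admissible :: "(nat \<Rightarrow> complex) \<Rightarrow> (nat \<Rightarrow> complex^2) \<Rightarrow> bool" where
  "admissible t v \<longleftrightarrow> t 1 = c 1 + 1 / c 1 \<and> t (k - 1) = c k + 1 / c k \<and>
     (\<forall>i\<in>{2..k-1}. (v i $ 1)\<^sup>2 + t i * v i $ 1 * v i $ 2 + (v i $ 2)\<^sup>2 \<noteq> 0)"

lemma det_transition_nonzero:
  assumes "admissible t v" "Suc (Suc m) < k"
  shows "det (transition (c (Suc (Suc m))) (t (Suc m)) (t (Suc (Suc m))) (v (Suc (Suc m)))) \<noteq> 0"
proof -
  have "c (Suc (Suc m)) \<noteq> 0" using assms(2) by (intro c_nonzero) auto
  moreover have "Suc (Suc m) \<in> {2..k-1}" using assms(2) by auto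
  ultimately show ?thesis using assms(1) by (simp add: det_transition admissible_def del: atLeastAtMost_iff)
qed

lemma det_frame: "admissible t v \<Longrightarrow> m \<le> k - 2 \<Longrightarrow> det (frame t v m) \<noteq> 0"
proof (induction m)
  case (Suc m)
  then show ?case using det_transition_nonzero[of t v m] k by (simp add: det_mul)
qed simp

lemma det_model_cut:
  assumes "admissible t v" shows "det (model_cut t v i) = 1"
proof (cases "i \<in> {1..<k}")
  case True
  then have "det (frame t v (i - 1)) \<noteq> 0" by (intro det_frame[OF assms]) auto
  then show ?thesis using True
    by (simp add: model_cut_def det_conjugate)
qed (auto simp: model_cut_def)

text \<open>One cut monodromy seen from the frames on both sides of its circle: a companion matrix
  in the later frame, \<open>normal_quot\<close> in the earlier one.\<close>

lemma model_cut_normal: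
  assumes "admissible t v" "Suc (Suc m) < k"
  shows "model_cut t v (Suc (Suc m)) = conjugate (frame t v m) (normal_quot (c (Suc (Suc m))) (t (Suc m)) (t (Suc (Suc m))))"
proof -
  let ?T = "transition (c (Suc (Suc m))) (t (Suc m)) (t (Suc (Suc m))) (v (Suc (Suc m)))"
  have T: "det ?T \<noteq> 0" by (rule det_transition_nonzero[OF assms])
  have F: "det (frame t v m) \<noteq> 0" using assms(2) by (intro det_frame[OF assms(1)]) auto
  have "c (Suc (Suc m)) \<noteq> 0" using assms(2) by (intro c_nonzero) auto
  then have "conjugate ?T (companion (t (Suc (Suc m)))) = normal_quot (c (Suc (Suc m))) (t (Suc m)) (t (Suc (Suc m)))"
    using quot_transition conjugate_iff[OF T] by metis
  then show ?thesis using assms(2) by (simp add: model_cut_def flip: conjugate_conjugate[OF F T])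
qed

lemma model_cut_form:
  assumes "admissible t v" "Suc (Suc m) < k"
  shows "model_cut t v (Suc m) =
    conjugate (frame t v m) (normal_form (c (Suc (Suc m))) (t (Suc m)) (t (Suc (Suc m)))) ** model_cut t v (Suc (Suc m))"
proof -
  have F: "det (frame t v m) \<noteq> 0" using assms(2) by (intro det_frame[OF assms(1)]) auto
  have "c (Suc (Suc m)) \<noteq> 0" using assms(2) by (intro c_nonzero) auto
  moreover have "model_cut t v (Suc m) = conjugate (frame t v m) (companion (t (Suc m)))"
    using assms(2) by (simp add: model_cut_def)
  ultimately show ?thesis
    unfolding model_cut_normal[OF assms] by (simp add: normal_form_quot flip: conjugate_mult[OF F])
qed

lemma build_normal:
  assumes "admissible t v" "Suc (Suc m) < k"
  shows "build t v (Suc (Suc m)) = conjugate (frame t v m) (normal_form (c (Suc (Suc m))) (t (Suc m)) (t (Suc (Suc m))))"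
proof -
  have "det (model_cut t v (Suc (Suc m))) \<noteq> 0" using det_model_cut[OF assms(1)] by simp
  from matrix_inv_2(1)[OF this] show ?thesis
    using assms(2) model_cut_form[OF assms] by (auto simp: build_def simp flip: matrix_mul_assoc)
qed

text \<open>The product of the quotients R_(j-1) R_j^-1 telescopes down from R_k = 1.\<close>

lemma cut_build:
  assumes "admissible t v" "i \<le> k"
  shows "cut_monodromy k (build t v) i = model_cut t v i"
  using assms(2)
proof (induction rule: downward_induct)
  case top then show ?case by (simp add: cut_monodromy_last model_cut_def)
next
  case (step i)
  have "det (model_cut t v (Suc i)) \<noteq> 0" using det_model_cut[OF assms(1)] by simp
  from matrix_inv_2(2)[OF this] show ?case
    using step by (simp add: cut_monodromy_rec build_def flip: matrix_mul_assoc)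
qed

lemma trace_model_cut:
  assumes "admissible t v" "i \<in> {1..<k}" shows "trace (model_cut t v i) = t i"
proof -
  have "det (frame t v (i - 1)) \<noteq> 0" using assms(2) by (intro det_frame[OF assms(1)]) auto
  then show ?thesis using assms(2) by (simp add: model_cut_def trace_conjugate)
qed

lemma build_in_Rep:
  assumes "admissible t v" shows "build t v \<in> Rep k c"
  unfolding Rep_iff
proof (intro conjI ballI)
  show "build t v \<in> extensional {1..k}" by (simp add: build_def)
  show "cut_monodromy k (build t v) 0 = mat 1" by (simp add: cut_build[OF assms] model_cut_def)
  fix i assume i: "i \<in> {1..k}"
  have dm: "det (model_cut t v j) \<noteq> 0" for j using det_model_cut[OF assms] by simp
  show "det (build t v i) = 1"
    using i det_matrix_inv[OF dm] by (simp add: build_def det_mul det_model_cut[OF assms])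
  consider "i = 1" | "i = k" | "i \<in> {2..k-1}" using i by force
  then show "trace (build t v i) = c i + 1 / c i"
  proof cases
    case 1
    \<comment> \<open>R_0 = 1 makes the first matrix inverse to R_1, and inversion in SL_2 preserves
      the trace.\<close>
    have "trace (matrix_inv (model_cut t v 1)) = trace (model_cut t v 1)"
      by (simp add: matrix_inv_entries[OF dm] det_model_cut[OF assms] trace_2 add.commute)
    then show ?thesis
      using 1 k trace_model_cut[OF assms, of 1] assms by (simp add: build_def model_cut_def[of t v 0] admissible_def)
  next
    case 2
    have "matrix_inv (mat 1) = (mat 1 :: complex^2^2)" by (rule matrix_inv_eqI) simp
    then show ?thesis
      using 2 k trace_model_cut[OF assms, of "k - 1"] assms by (simp add: build_def model_cut_def[of t v k] admissible_def)
  next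
    case 3
    obtain m where m: "i = Suc (Suc m)" "Suc (Suc m) < k" using middle_index[OF 3] .
    have F: "det (frame t v m) \<noteq> 0" using m by (intro det_frame[OF assms]) auto
    show ?thesis
      unfolding m(1) build_normal[OF assms m(2)] trace_conjugate[OF F]
      using i m by (intro det_trace_normal c_nonzero) simp
  qed
qed

lemma build_stable:
  assumes "admissible t v" "i \<in> {2..k-1}"
  shows "stable_pair (c i) (build t v i) (cut_monodromy k (build t v) i)"
proof -
  obtain m where m: "i = Suc (Suc m)" "Suc (Suc m) < k" using middle_index[OF assms(2)] .
  have F: "det (frame t v m) \<noteq> 0" using m by (intro det_frame[OF assms(1)]) auto
  have i: "i \<in> {1..k}" using assms(2) by auto
  have "cut_monodromy k (build t v) i = model_cut t v i" using i by (intro cut_build[OF assms(1)]) simp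
  then show ?thesis
    unfolding m(1)
    using stable_pair_normal[OF c_nonzero[OF i] c_square[OF i]] c_nonzero[OF i] c_square[OF i]
    by (simp add: m(1) build_normal[OF assms(1) m(2)] model_cut_normal[OF assms(1) m(2)]
        conjugate_stable_pair[OF F] det_trace_normal del: One_nat_def)
qed

lemma build_gluing_line:
  assumes "admissible t v" "i \<in> {2..k-2}"
  shows "v i \<in> gluing_line (c (i + 1)) (build t v (i + 1)) (c i) (build t v i) (cut_monodromy k (build t v) i)"
proof -
  have "i \<in> {2..k-1}" using assms(2) by auto
  from middle_index[OF this] obtain m where m: "i = Suc (Suc m)" "Suc (Suc m) < k" .
  then have m3: "Suc (Suc (Suc m)) < k" using assms(2) by auto
  have F: "det (frame t v m) \<noteq> 0" using m by (intro det_frame[OF assms(1)]) auto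
  have T: "det (transition (c (Suc (Suc m))) (t (Suc m)) (t (Suc (Suc m))) (v (Suc (Suc m)))) \<noteq> 0"
    by (rule det_transition_nonzero[OF assms(1) m(2)])
  have cut: "cut_monodromy k (build t v) i = model_cut t v i"
    using m by (intro cut_build[OF assms(1)]) simp
  have "build t v (i + 1) = conjugate (frame t v m)
      (conjugate (transition (c (Suc (Suc m))) (t (Suc m)) (t (Suc (Suc m))) (v (Suc (Suc m))))
        (normal_form (c (Suc (Suc (Suc m)))) (t (Suc (Suc m))) (t (Suc (Suc (Suc m))))))"
    using build_normal[OF assms(1) m3] by (simp add: m(1) conjugate_conjugate[OF F T])
  then show ?thesis
    unfolding cut unfolding m(1) build_normal[OF assms(1) m(2)] model_cut_normal[OF assms(1) m(2)]
    using gluing_line_normal[OF T]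
    by (simp add: conjugate_gluing_line[OF F])
qed

text \<open>
  The frame consists of an eigenvector of the second matrix and its image under the first
  cut monodromy; the transition matrices then propagate it along the sphere.
\<close>

lemma conjugate_to_build:
  assumes A: "A \<in> Rep k c" and tv: "admissible t v"
    and t: "\<And>i. i \<in> {1..<k} \<Longrightarrow> trace (cut_monodromy k A i) = t i"
    and stable: "\<And>i. i \<in> {2..k-1} \<Longrightarrow> stable_pair (c i) (A i) (cut_monodromy k A i)"
    and v: "\<And>i. i \<in> {2..k-2} \<Longrightarrow>
      v i \<noteq> 0 \<and> v i \<in> gluing_line (c (i + 1)) (A (i + 1)) (c i) (A i) (cut_monodromy k A i)"
  shows "\<exists>P. det P \<noteq> 0 \<and> A = conj_tuple k P (build t v)"
proof -
  let ?R = "cut_monodromy k A"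
  have Ai: "det (A i) = 1" "trace (A i) = c i + 1 / c i" "c i \<noteq> 0" "(c i)\<^sup>2 \<noteq> 1" if "i \<in> {1..k}" for i
    using A that c_nonzero c_square by (simp_all add: Rep_iff)
  have 2: "2 \<in> {1..k}" "2 \<in> {2..k-1}" using k by auto
  have R1: "?R 1 = A 2 ** ?R 2" using cut_monodromy_rec[of 1 k A] k by (simp add: numeral_2_eq_2)
  have R0: "?R 0 = A 1 ** ?R 1" using cut_monodromy_rec[of 0 k A] k by simp
  have "trace (A 2) = 1 / c 2 + 1 / (1 / c 2)" "1 / c 2 \<noteq> 0" using Ai[OF 2(1)] by simp_all
  then obtain e where e: "e \<noteq> 0" "A 2 *v e = (1 / c 2) *s e"
    using eigenvector_exists[OF Ai(1)[OF 2(1)]] by blast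
  define P where "P = cols e (?R 1 *v e)"
  have "stable_pair (c 2) (A 2) (?R 1)"
    unfolding R1 stable_pair_mult_iff[OF Ai(1,3)[OF 2(1)]] by (rule stable[OF 2(2)])
  then have P: "det P \<noteq> 0" using e unfolding P_def stable_pair_def by blast
  have tr: "trace (?R 1) = t 1" "trace (?R 2) = t 2" using t[of 1] t[of 2] k by auto
  have dR: "det (?R i) = 1" if "i \<le> k" for i using det_cut[OF A that] .
  \<comment> \<open>\<open>P\<close> carries the model frame of S_2 to that of \<open>A\<close>; the
    induction says that \<open>P ** frame t v m\<close> is then the frame of S_(m+2) for
    \<open>A\<close>.\<close>
  have frames: "A (Suc (Suc m)) ** (P ** frame t v m) =
      (P ** frame t v m) ** normal_form (c (Suc (Suc m))) (t (Suc m)) (t (Suc (Suc m))) \<and>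
    ?R (Suc (Suc m)) ** (P ** frame t v m) =
      (P ** frame t v m) ** normal_quot (c (Suc (Suc m))) (t (Suc m)) (t (Suc (Suc m)))" if "Suc (Suc m) < k" for m
    using that
  proof (induction m)
    case 0
    have "det (?R 1) = 1" using k by (intro dR) simp
    from frame_normal_form[OF e(2) Ai(1,3)[OF 2(1)] this R1 P_def P] show ?case
      using tr by (simp add: numeral_2_eq_2)
  next
    case (Suc m)
    let ?M = "P ** frame t v m"
    have M: "det ?M \<noteq> 0" using det_frame[OF tv, of m] Suc.prems P by (simp add: det_mul)
    have i: "Suc (Suc m) \<in> {1..k}" "Suc (Suc (Suc m)) \<in> {1..k}" "Suc (Suc (Suc m)) \<in> {2..k-1}" "Suc (Suc m) \<in> {2..k-2}" using Suc.prems by auto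
    have R: "?R (Suc (Suc m)) = A (Suc (Suc (Suc m))) ** ?R (Suc (Suc (Suc m)))"
      using cut_monodromy_rec[of "Suc (Suc m)" k A] i by simp
    have tr: "trace (?R (Suc (Suc (Suc m)))) = t (Suc (Suc (Suc m)))" using Suc.prems by (intro t) auto
    note IH = conjunct1[OF Suc.IH] conjunct2[OF Suc.IH]
    have g: "v (Suc (Suc m)) \<in> gluing_line (c (Suc (Suc (Suc m)))) (A (Suc (Suc (Suc m)))) (c (Suc (Suc m))) (A (Suc (Suc m))) (?R (Suc (Suc m)))"
      "v (Suc (Suc m)) \<noteq> 0" using v[OF i(4)] by simp_all
    from transition_step(2,3)[OF M IH Ai(3,4)[OF i(1)] g Ai(1,3)[OF i(2)] stable[OF i(3)] R] Suc.prems
    show ?case by (simp add: tr matrix_mul_assoc)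
  qed
  \<comment> \<open>\<open>frames\<close> covers the indices from 2 to \<open>k - 1\<close>. R_1 is
    recovered as A_2 R_2, and R_0 and R_k are identities.\<close>
  have R_model_cut: "?R i = conjugate P (model_cut t v i)" if "i \<le> k" for i
  proof -
    have ge2: "?R (Suc (Suc m)) = conjugate P (model_cut t v (Suc (Suc m))) \<and>
        A (Suc (Suc m)) = conjugate P (conjugate (frame t v m) (normal_form (c (Suc (Suc m))) (t (Suc m)) (t (Suc (Suc m)))))"
      if m: "Suc (Suc m) < k" for m
    proof -
      have F: "det (frame t v m) \<noteq> 0" using m by (intro det_frame[OF tv]) auto
      then have M: "det (P ** frame t v m) \<noteq> 0" using P by (simp add: det_mul)
      show ?thesis
        using frames[OF m] unfolding model_cut_normal[OF tv m]
        by (simp add: conjugate_conjugate[OF P F] conjugate_iff[OF M])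
    qed
    have "i = 0 \<or> i = 1 \<or> i = k \<or> i \<in> {2..k-1}" using that by auto
    then consider "i = 0" | "i = 1" | "i = k" | "i \<in> {2..k-1}" by blast
    then show ?thesis
    proof cases
      case 1
      then show ?thesis using A by (simp add: Rep_iff model_cut_def conjugate_mat[OF P])
    next
      case 2
      have m: "Suc (Suc 0) < k" using k by simp
      have "?R 1 = conjugate P (conjugate (frame t v 0) (normal_form (c (Suc (Suc 0))) (t (Suc 0)) (t (Suc (Suc 0)))) **
          model_cut t v (Suc (Suc 0)))"
        using ge2[OF m] by (simp only: R1 conjugate_mult[OF P] numeral_2_eq_2)
      also have "\<dots> = conjugate P (model_cut t v (Suc 0))" by (simp only: model_cut_form[OF tv m])
      finally show ?thesis using 2 by simp
    next
      case 3
      then show ?thesis by (simp add: cut_monodromy_last model_cut_def conjugate_mat[OF P])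
    next
      case 4
      then obtain m where m: "i = Suc (Suc m)" "Suc (Suc m) < k" using middle_index by blast
      with ge2[OF m(2)] show ?thesis by simp
    qed
  qed
  \<comment> \<open>The cut monodromies determine the tuple: R_(i-1) = A_i R_i with R_i
    invertible.\<close>
  have "A i = conj_tuple k P (build t v) i" for i
  proof (cases "i \<in> {1..k}")
    case True
    then obtain j where j: "i = Suc j" "j < k" by (cases i) auto
    have "det (model_cut t v i) \<noteq> 0" using det_model_cut[OF tv] by simp
    note inv = matrix_inv_2(1)[OF this]
    have "conjugate P (build t v i) ** ?R i = ?R j"
      using True j inv
      by (simp add: R_model_cut conjugate_mult[OF P, symmetric] build_def matrix_inv_2(2) det_model_cut[OF tv]
          flip: matrix_mul_assoc)
    moreover have "?R j = A i ** ?R i" using j cut_monodromy_rec by simp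
    ultimately have "conjugate P (build t v i) ** ?R i ** matrix_inv (?R i) = A i ** ?R i ** matrix_inv (?R i)"
      by simp
    moreover have "det (?R i) \<noteq> 0" using dR[of i] True by simp
    ultimately have "conjugate P (build t v i) = A i"
      by (simp add: matrix_inv_2(1) flip: matrix_mul_assoc)
    then show ?thesis using True by (simp add: conj_tuple_eq)
  next
    case False
    then show ?thesis using A by (auto simp: conj_tuple_eq Rep_iff extensional_def)
  qed
  then show ?thesis using P by blast
qed

text \<open>Scalars accumulate along the frames but disappear under conjugation. Hence
  \<open>build\<close> depends on the points \<open>[p : q]\<close> only.\<close>

lemma build_scale:
  assumes "admissible t v"
    and "\<And>i. i \<in> {2..k-1} \<Longrightarrow> \<exists>s. s \<noteq> 0 \<and> v' i = s *s v i"
  shows "build t v' = build t v"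
proof -
  have frame: "\<exists>a. a \<noteq> 0 \<and> frame t v' m = mat a ** frame t v m" if "m \<le> k - 2" for m
    using that
  proof (induction m)
    case 0
    show ?case by (intro exI[of _ 1]) simp
  next
    case (Suc m)
    then obtain a where a: "a \<noteq> 0" "frame t v' m = mat a ** frame t v m" by auto
    have "Suc (Suc m) \<in> {2..k-1}" using Suc.prems k by auto
    then obtain s where s: "s \<noteq> 0" "v' (Suc (Suc m)) = s *s v (Suc (Suc m))"
      using assms(2) by blast
    have "mat a ** F ** (mat b ** T) = mat (a * b) ** (F ** T)" for b and F T :: "complex^2^2"
      by (simp add: matrix2_simps algebra_simps)
    then show ?case
      using a s by (intro exI[of _ "a * s"]) (simp add: transition_scale)
  qed
  have "model_cut t v' i = model_cut t v i" for i
  proof (cases "i \<in> {1..<k}")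
    case True
    then have le: "i - 1 \<le> k - 2" by auto
    from frame[OF this] obtain a where a: "a \<noteq> 0" "frame t v' (i - 1) = mat a ** frame t v (i - 1)" by blast
    have F: "det (frame t v (i - 1)) \<noteq> 0" by (rule det_frame[OF assms(1) le])
    have da: "det (mat a :: complex^2^2) \<noteq> 0" using a(1) by (simp add: det_2 mat2_nth)
    have "B = conjugate (mat a) B" for B by (simp add: conjugate_iff[OF da] mat_commute)
    then have "conjugate (mat a ** frame t v (i - 1)) B = conjugate (frame t v (i - 1)) B" for B
      by (metis conjugate_conjugate[OF da F])
    then show ?thesis using True by (simp only: model_cut_def a(2))
  qed (auto simp: model_cut_def)
  then show ?thesis by (simp add: build_def)
qed

end

section \<open>Orbits, invariants and stability\<close>

lemma is_line_iff: "is_line L \<longleftrightarrow> (\<exists>v. v \<noteq> 0 \<and> L = proj_point v)"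
proof
  assume L: "is_line L"
  obtain B where B: "B \<subseteq> L" "vec.independent B" "L \<subseteq> vec.span B" "card B = vec.dim L"
    using vec.basis_exists[of L] by blast
  then obtain v where v: "B = {v}" using L by (auto simp: is_line_def card_1_singleton_iff)
  have "v \<noteq> 0" using B(2) v by (auto simp: vec.dependent_single)
  moreover have "vec.span {v} \<subseteq> L" using B(1) L v by (intro vec.span_minimal) (auto simp: is_line_def)
  ultimately show "\<exists>v. v \<noteq> 0 \<and> L = proj_point v" using B(3) v by (auto simp: proj_point_def)
next
  assume "\<exists>v. v \<noteq> 0 \<and> L = proj_point v"
  then show "is_line L" by (auto simp: is_line_def proj_point_def vec.subspace_span)
qed

lemma mem_proj_point: "w \<in> proj_point v \<longleftrightarrow> (\<exists>a. w = a *s v)"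
  by (auto simp: proj_point_def vec.span_singleton)

lemma unstable_restriction_iff:
  assumes "c i \<noteq> 0"
  shows "unstable_restriction k c A i \<longleftrightarrow> \<not> stable_pair (c i) (A i) (cut_monodromy k A i)"
proof
  assume "unstable_restriction k c A i"
  then obtain e where e: "e \<noteq> 0" "\<And>v. v \<in> proj_point e \<Longrightarrow> cut_monodromy k A i *v v \<in> proj_point e"
    "\<And>v. v \<in> proj_point e \<Longrightarrow> A i *v v = inverse (c i) *s v"
    unfolding unstable_restriction_def is_line_iff by auto
  have "e \<in> proj_point e" unfolding mem_proj_point by (rule exI[of _ 1]) simp
  from e(2)[OF this] e(3)[OF this] e(1) show "\<not> stable_pair (c i) (A i) (cut_monodromy k A i)"
    unfolding stable_pair_def mem_proj_point by (auto simp: inverse_eq_divide)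
next
  assume "\<not> stable_pair (c i) (A i) (cut_monodromy k A i)"
  then obtain e where e: "e \<noteq> 0" "A i *v e = (1 / c i) *s e" "det (cols e (cut_monodromy k A i *v e)) = 0"
    unfolding stable_pair_def by blast
  obtain b where b: "cut_monodromy k A i *v e = b *s e" using det_cols_eq_0D[OF e(3,1)] .
  show "unstable_restriction k c A i"
    unfolding unstable_restriction_def
  proof (intro exI[of _ "proj_point e"] conjI ballI)
    show "is_line (proj_point e)" using e(1) is_line_iff by blast
    fix v assume "v \<in> proj_point e"
    then obtain a where v: "v = a *s e" unfolding mem_proj_point by blast
    show "A i *v v = inverse (c i) *s v"
      by (simp add: v vector_scalar_commute e(2) mult.commute inverse_eq_divide)
    then show "A i *v v \<in> proj_point e" unfolding mem_proj_point v by auto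
    show "cut_monodromy k A i *v v \<in> proj_point e"
      unfolding mem_proj_point v by (auto simp: vector_scalar_commute b)
  qed
qed

lemma conj_tuple_conj_tuple:
  assumes "det P \<noteq> 0" "det Q \<noteq> 0"
  shows "conj_tuple k P (conj_tuple k Q A) = conj_tuple k (P ** Q) A"
  by (auto simp: conj_tuple_eq conjugate_conjugate[OF assms] fun_eq_iff)

lemma orbit_eq: "orbit k A = {conj_tuple k P A | P. det P \<noteq> 0}"
  by (simp add: orbit_def invertible_det_nz)

lemma orbit_conj_tuple:
  assumes "det P \<noteq> 0" shows "orbit k (conj_tuple k P A) = orbit k A"
proof -
  have inv: "det (matrix_inv P) \<noteq> 0" using det_matrix_inv[OF assms] assms by simp
  have "conj_tuple k Q A = conj_tuple k (Q ** matrix_inv P) (conj_tuple k P A)" if "det Q \<noteq> 0" for Q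
    using that assms inv
    by (simp add: conj_tuple_conj_tuple det_mul matrix_inv_2 flip: matrix_mul_assoc)
  moreover have "det (Q ** matrix_inv P) \<noteq> 0" if "det Q \<noteq> 0" for Q using that inv by (simp add: det_mul)
  moreover have "conj_tuple k Q (conj_tuple k P A) = conj_tuple k (Q ** P) A \<and> det (Q ** P) \<noteq> 0"
    if "det Q \<noteq> 0" for Q using that assms by (simp add: conj_tuple_conj_tuple det_mul)
  ultimately show ?thesis unfolding orbit_eq by blast
qed

context punctured_sphere
begin

lemma orbit_self: assumes "A \<in> Rep k c" shows "A \<in> orbit k A"
proof -
  have "conjugate (mat 1) B = B" for B using matrix_inv_eqI(1)[of "mat 1" "mat 1"] by (simp add: conjugate_def)
  then have "conj_tuple k (mat 1) A = A"
    using assms by (auto simp: conj_tuple_eq Rep_iff extensional_def)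
  moreover have "det (mat 1 :: complex^2^2) \<noteq> 0" by simp
  ultimately show ?thesis unfolding orbit_eq mem_Collect_eq by metis
qed

text \<open>On a common eigenvector each A_j acts by c_j or its inverse, and the relation makes the
  full signed product equal to 1, which genericity excludes.\<close>

lemma irreducible:
  assumes A: "A \<in> Rep k c" and u: "u \<noteq> 0"
  shows "\<exists>j\<in>{1..k}. det (cols (A j *v u) u) \<noteq> 0"
proof (rule ccontr)
  assume contra: "\<not> ?thesis"
  have "\<exists>\<epsilon> \<in> {1, -1 :: int}. A j *v u = (c j powi \<epsilon>) *s u" if j: "j \<in> {1..k}" for j
  proof -
    have "det (cols (A j *v u) u) = - det (cols u (A j *v u))" by (simp add: det_2)
    then have "det (cols u (A j *v u)) = 0" using contra j by auto
    then obtain l where l: "A j *v u = l *s u" using det_cols_eq_0D u by blast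
    have Aj: "det (A j) = 1" "trace (A j) = c j + 1 / c j" "c j \<noteq> 0"
      using A j c_nonzero by (simp_all add: Rep_iff)
    have "(A j - mat a) *v (b *s u) = b *s (A j *v u) - (a * b) *s u" for a b
      by (simp add: matrix2_simps algebra_simps)
    then have diff: "(A j - mat a) *v (b *s u) = ((l - a) * b) *s u" for a b
      unfolding l by (simp add: vec2_eq_iff algebra_simps)
    \<comment> \<open>Cayley-Hamilton, evaluated on \<open>u\<close>, restricts the eigenvalue
      \<open>l\<close> to the two roots.\<close>
    have "((A j - mat (c j)) ** (A j - mat (1 / c j))) *v (1 *s u) = ((l - c j) * (l - 1 / c j)) *s u"
      unfolding matrix_vector_mul_assoc[symmetric] diff by simp
    then have "((l - c j) * (l - 1 / c j)) *s u = 0" by (simp add: Cayley_Hamilton_1[OF Aj])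
    then have "l = c j \<or> l = 1 / c j" using u by auto
    then show ?thesis using l by (auto simp: power_int_minus inverse_eq_divide)
  qed
  then obtain \<epsilon> where eps: "\<And>j. j \<in> {1..k} \<Longrightarrow> \<epsilon> j \<in> {1, -1 :: int} \<and> A j *v u = (c j powi \<epsilon> j) *s u"
    by metis
  have "cut_monodromy k A i *v u = (\<Prod>j=Suc i..k. c j powi \<epsilon> j) *s u" if "i \<le> k" for i
    using that
  proof (induction rule: downward_induct)
    case (step i)
    have "{Suc i..k} = insert (Suc i) {Suc (Suc i)..k}" using step(1) by auto
    moreover have "A (Suc i) *v u = (c (Suc i) powi \<epsilon> (Suc i)) *s u" using eps[of "Suc i"] step(1) by simp
    ultimately show ?case using step
      by (simp add: cut_monodromy_rec vector_scalar_commute mult.commute flip: matrix_vector_mul_assoc)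
  qed (simp add: cut_monodromy_last)
  from this[of 0] have "u = (\<Prod>j=1..k. c j powi \<epsilon> j) *s u" using A by (simp add: Rep_iff)
  then have "((\<Prod>j=1..k. c j powi \<epsilon> j) - 1) *s u = 0" by (simp add: vector_sub_rdistrib)
  then have "(\<Prod>j=1..k. c j powi \<epsilon> j) = 1" using u unfolding vector_mul_eq_0 by simp
  moreover have "k \<in> {1..k}" "\<epsilon> \<in> {1..k} \<rightarrow> {1, -1}" using k eps by auto
  ultimately show False using generic unfolding generic_eigenvalues_def by blast
qed

definition stable_system :: "(nat \<Rightarrow> complex^2^2) \<Rightarrow> bool" where
  "stable_system A \<longleftrightarrow> A \<in> Rep k c \<and>
     (\<forall>i\<in>{2..k-2}. trace (cut_monodromy k A i) \<noteq> 2 \<and> trace (cut_monodromy k A i) \<noteq> -2) \<and>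
     (\<forall>i\<in>{2..k-1}. stable_pair (c i) (A i) (cut_monodromy k A i))"

lemma M_prime_eq: "M_prime k c = orbit k ` {A. stable_system A}"
proof -
  have "\<not> unstable_restriction k c A i \<longleftrightarrow> stable_pair (c i) (A i) (cut_monodromy k A i)" if "i \<in> {2..k-1}" for A i
    using unstable_restriction_iff[OF c_nonzero] that by auto
  then have "{A \<in> Rep k c.
     (\<forall>i\<in>{2..k-2}. trace (cut_monodromy k A i) \<noteq> 2 \<and> trace (cut_monodromy k A i) \<noteq> -2) \<and>
     (\<forall>i\<in>{2..k-1}. \<not> unstable_restriction k c A i)} = {A. stable_system A}"
    unfolding stable_system_def by blast
  then show ?thesis unfolding M_prime_def by simp
qed

lemma Rep_entries:
  assumes "A \<in> Rep k c" "i \<in> {1..k}"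
  shows "det (A i) = 1" "trace (A i) = c i + 1 / c i" "c i \<noteq> 0" "(c i)\<^sup>2 \<noteq> 1"
  using assms c_nonzero c_square by (simp_all add: Rep_iff)

text \<open>Irreducibility supplies an A_j moving the c_i-eigenline, so finitely many traces detect
  stability on all of \<open>Rep\<close>. This is what makes stability an open condition.\<close>

lemma stable_pair_detect:
  assumes A: "A \<in> Rep k c" and i: "i \<in> {1..k}"
  shows "stable_pair (c i) (A i) R \<longleftrightarrow>
    (\<exists>j\<in>{1..k}. trace (transfer (c i) (A i) (c i) (A i) R ** A j) \<noteq> 0)"
proof -
  note Ai = Rep_entries[OF A i]
  obtain u where u: "u \<noteq> 0" "A i *v u = c i *s u" using eigenvector_exists[OF Ai(1-3)] .
  obtain j where "j \<in> {1..k}" "det (cols (A j *v u) u) \<noteq> 0" using irreducible[OF A u(1)] by blast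
  then show ?thesis
    using stable_pair_trace[OF Ai u] trace_transfer_stable[OF Ai] by blast
qed

text \<open>An arbitrary choice, harmless because everything read off from it is invariant under
  conjugation.\<close>

definition orbit_rep :: "(nat \<Rightarrow> complex^2^2) set \<Rightarrow> (nat \<Rightarrow> complex^2^2)" where
  "orbit_rep X = (SOME A. A \<in> Rep k c \<and> orbit k A = X)"

lemma orbit_rep:
  assumes "A \<in> Rep k c"
  shows "orbit_rep (orbit k A) \<in> Rep k c" "orbit k (orbit_rep (orbit k A)) = orbit k A"
    "\<exists>P. det P \<noteq> 0 \<and> orbit_rep (orbit k A) = conj_tuple k P A"
proof -
  have "orbit_rep (orbit k A) \<in> Rep k c \<and> orbit k (orbit_rep (orbit k A)) = orbit k A"
    unfolding orbit_rep_def by (rule someI[of _ A]) (simp add: assms)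
  then show *: "orbit_rep (orbit k A) \<in> Rep k c" "orbit k (orbit_rep (orbit k A)) = orbit k A" by auto
  have "orbit_rep (orbit k A) \<in> orbit k A" using orbit_self[OF *(1)] *(2) by simp
  then show "\<exists>P. det P \<noteq> 0 \<and> orbit_rep (orbit k A) = conj_tuple k P A" unfolding orbit_eq by blast
qed

lemma invariant_orbit_rep:
  assumes "f \<in> invariant_functions k c" "A \<in> Rep k c"
  shows "f (orbit_rep (orbit k A)) = f A"
  using orbit_rep(3)[OF assms(2)] assms by (auto simp: invariant_functions_def invertible_det_nz)

section \<open>Invariant functions and the character variety\<close>

lemma polynomial_functions_intros:
  "(\<lambda>_. a) \<in> polynomial_functions k"
  "i \<in> {1..k} \<Longrightarrow> (\<lambda>A. A i $ r $ s) \<in> polynomial_functions k"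
  "f \<in> polynomial_functions k \<Longrightarrow> g \<in> polynomial_functions k \<Longrightarrow> (\<lambda>A. f A + g A) \<in> polynomial_functions k"
  "f \<in> polynomial_functions k \<Longrightarrow> g \<in> polynomial_functions k \<Longrightarrow> (\<lambda>A. f A * g A) \<in> polynomial_functions k"
  unfolding polynomial_functions_def by (auto intro: generated_algebra.intros)

lemma invariant_functions_intros:
  "(\<lambda>_. a) \<in> invariant_functions k c"
  "f \<in> invariant_functions k c \<Longrightarrow> g \<in> invariant_functions k c \<Longrightarrow> (\<lambda>A. f A + g A) \<in> invariant_functions k c"
  "f \<in> invariant_functions k c \<Longrightarrow> g \<in> invariant_functions k c \<Longrightarrow> (\<lambda>A. f A * g A) \<in> invariant_functions k c"
  unfolding invariant_functions_def by (simp_all add: polynomial_functions_intros)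

text \<open>Polynomial matrix-valued maps compatible with conjugation: closed under products, and
  with invariant traces. They supply the invariants used below.\<close>

definition equivariant :: "((nat \<Rightarrow> complex^2^2) \<Rightarrow> complex^2^2) \<Rightarrow> bool" where
  "equivariant M \<longleftrightarrow> (\<forall>r s. (\<lambda>A. M A $ r $ s) \<in> polynomial_functions k) \<and>
     (\<forall>A\<in>Rep k c. \<forall>P. det P \<noteq> 0 \<longrightarrow> M (conj_tuple k P A) = conjugate P (M A))"

lemma equivariant_const: "equivariant (\<lambda>_. mat a)"
  unfolding equivariant_def by (simp add: polynomial_functions_intros conjugate_mat)

lemma equivariant_proj: "i \<in> {1..k} \<Longrightarrow> equivariant (\<lambda>A. A i)"
  unfolding equivariant_def by (simp add: polynomial_functions_intros conj_tuple_eq)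

lemma equivariant_mult: "equivariant M \<Longrightarrow> equivariant N \<Longrightarrow> equivariant (\<lambda>A. M A ** N A)"
  unfolding equivariant_def by (simp add: matrix2_mult_nth polynomial_functions_intros conjugate_mult)

lemma equivariant_diff_mat:
  assumes "equivariant M" shows "equivariant (\<lambda>A. M A - mat a)"
proof -
  have "(\<lambda>A. M A $ r $ s + (- mat a $ r $ s)) \<in> polynomial_functions k" for r s
    by (rule polynomial_functions_intros(3)[OF _ polynomial_functions_intros(1)])
      (use assms in \<open>simp add: equivariant_def\<close>)
  then show ?thesis
    using assms unfolding equivariant_def by (simp add: conjugate_diff conjugate_mat)
qed

lemma equivariant_cut: "i \<le> k \<Longrightarrow> equivariant (\<lambda>A. cut_monodromy k A i)"
proof (induction rule: downward_induct)
  case (step i)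
  then show ?case using equivariant_mult[OF equivariant_proj[of "Suc i"] step(2)]
    by (simp add: cut_monodromy_rec)
qed (simp add: cut_monodromy_last equivariant_const)

lemma equivariant_transfer:
  assumes "i \<in> {1..k}" "j \<in> {1..k}" "equivariant Y"
  shows "equivariant (\<lambda>A. transfer a (A i) b (A j) (Y A))"
  unfolding transfer_def
  by (intro equivariant_mult equivariant_diff_mat equivariant_proj assms)

lemma invariant_trace:
  assumes "equivariant M" shows "(\<lambda>A. trace (M A)) \<in> invariant_functions k c"
proof -
  have "(\<lambda>A. trace (M A)) \<in> polynomial_functions k"
    using assms unfolding equivariant_def trace_2 by (intro polynomial_functions_intros) auto
  then show ?thesis
    using assms by (auto simp: invariant_functions_def equivariant_def trace_conjugate invertible_det_nz)
qed

definition coordinate_ring :: "((nat \<Rightarrow> complex^2^2) set \<Rightarrow> complex) set" where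
  "coordinate_ring = {F. \<exists>f \<in> invariant_functions k c. \<forall>A \<in> Rep k c. F (orbit k A) = f A}"

lemma coordinate_ring_orbit_rep:
  "f \<in> invariant_functions k c \<Longrightarrow> (\<lambda>X. f (orbit_rep X)) \<in> coordinate_ring"
  unfolding coordinate_ring_def using invariant_orbit_rep by auto

lemma fraction_family_character: "fraction_family {(orbit k ` Rep k c, f) | f. f \<in> coordinate_ring}"
proof
  let ?\<G> = "{(orbit k ` Rep k c, f) | f. f \<in> coordinate_ring}"
  show "(W, \<lambda>x. g x + h x) \<in> ?\<G>" "(W, \<lambda>x. g x * h x) \<in> ?\<G>"
    if gh: "(W, g) \<in> ?\<G>" "(W, h) \<in> ?\<G>" for W g h
  proof -
    from gh obtain g' h' where "g' \<in> invariant_functions k c" "\<forall>A \<in> Rep k c. g (orbit k A) = g' A"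
      "h' \<in> invariant_functions k c" "\<forall>A \<in> Rep k c. h (orbit k A) = h' A"
      unfolding coordinate_ring_def by auto
    then have "(\<lambda>x. g x + h x) \<in> coordinate_ring" "(\<lambda>x. g x * h x) \<in> coordinate_ring"
      unfolding coordinate_ring_def mem_Collect_eq
      by (intro bexI[of _ "\<lambda>A. g' A + h' A"] bexI[of _ "\<lambda>A. g' A * h' A"];
          simp add: invariant_functions_intros)+
    then show "(W, \<lambda>x. g x + h x) \<in> ?\<G>" "(W, \<lambda>x. g x * h x) \<in> ?\<G>" using gh by auto
  qed
  show "(W, \<lambda>_. a) \<in> ?\<G>" if "(W, g) \<in> ?\<G>" for W g a
    using that invariant_functions_intros(1) unfolding coordinate_ring_def by auto
qed auto

lemma character_variety_eq: "character_variety k c = affine_variety (orbit k ` Rep k c) coordinate_ring"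
  by (simp add: character_variety_def coordinate_ring_def)

lemma one_in_coordinate_ring: "(\<lambda>_. 1) \<in> coordinate_ring"
  using invariant_functions_intros(1)[of 1] unfolding coordinate_ring_def by auto

lemma function_sheaf_character: "function_sheaf (character_variety k c)"
  unfolding character_variety_eq affine_variety_def
  by (rule fraction_family.function_sheaf_variety_of_fractions[OF fraction_family_character])

lemma topspace_character: "topspace (zariski (character_variety k c)) = orbit k ` Rep k c"
  unfolding character_variety_eq affine_variety_def
proof (intro equalityI subsetI)
  fix X assume "X \<in> orbit k ` Rep k c"
  then show "X \<in> topspace (zariski (variety_of_fractions {(orbit k ` Rep k c, f) | f. f \<in> coordinate_ring}))"
    unfolding topspace_variety_of_fractions using one_in_coordinate_ring
    by (intro exI[of _ "orbit k ` Rep k c"] exI[of _ "\<lambda>_. 1"]) simp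
qed (auto simp: topspace_variety_of_fractions)

lemma regular_character:
  assumes "f \<in> invariant_functions k c" "U \<subseteq> orbit k ` Rep k c"
  shows "(\<lambda>X. f (orbit_rep X)) \<in> regular (character_variety k c) U"
  unfolding character_variety_eq affine_variety_def
  by (rule regular_variety_of_fractions[OF _ _ assms(2)])
    (use coordinate_ring_orbit_rep[OF assms(1)] one_in_coordinate_ring in auto)

lemma stable_system_orbit_rep:
  assumes "X \<in> M_prime k c" shows "stable_system (orbit_rep X)" "orbit k (orbit_rep X) = X"
proof -
  obtain A where A: "stable_system A" "X = orbit k A" using assms unfolding M_prime_eq by blast
  then have R: "A \<in> Rep k c" by (simp add: stable_system_def)
  obtain P where P: "det P \<noteq> 0" "orbit_rep X = conj_tuple k P A" using orbit_rep(3)[OF R] A(2) by blast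
  show "orbit k (orbit_rep X) = X" using orbit_rep(2)[OF R] A(2) by simp
  have "stable_pair (c i) (conj_tuple k P A i) (cut_monodromy k (conj_tuple k P A) i)" if "i \<in> {2..k-1}" for i
  proof -
    have i: "i \<in> {1..k}" using that by auto
    then have "conj_tuple k P A i = conjugate P (A i)" by (simp add: conj_tuple_eq)
    then show ?thesis
      using A(1) that i conjugate_stable_pair[OF P(1) Rep_entries[OF R i]]
      by (simp add: stable_system_def cut_monodromy_conj_tuple[OF _ P(1)])
  qed
  moreover have "trace (cut_monodromy k (conj_tuple k P A) i) = trace (cut_monodromy k A i)" if "i \<in> {2..k-2}" for i
    using that by (subst cut_monodromy_conj_tuple[OF _ P(1)]) (auto simp: trace_conjugate[OF P(1)])
  ultimately show "stable_system (orbit_rep X)"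
    using A(1) orbit_rep(1)[OF R] unfolding stable_system_def A(2)[symmetric] P(2) by auto
qed

text \<open>Both conditions are nonvanishing of invariants: \<open>D\<close> is the squared trace
  minus 4, and stability of a piece means that one of finitely many \<open>S\<close> is
  nonzero.\<close>

lemma openin_M_prime: "openin (zariski (character_variety k c)) (M_prime k c)"
proof -
  let ?X = "character_variety k c" and ?T = "orbit k ` Rep k c"
  interpret function_sheaf ?X by (rule function_sheaf_character)
  have T: "openin (zariski ?X) ?T" using openin_topspace[of "zariski ?X"] by (simp add: topspace_character)
  have nonvanishing: "openin (zariski ?X) {x \<in> ?T. f (orbit_rep x) \<noteq> 0}"
    if "f \<in> invariant_functions k c" for f
    using open_nonvanishing[OF T regular_character[OF that order_refl]] .
  define D where "D i A = trace (cut_monodromy k A i) * trace (cut_monodromy k A i) + (-4)" for i A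
  define S where "S i j A = trace (transfer (c i) (A i) (c i) (A i) (cut_monodromy k A i) ** A j)" for i j A
  have D: "D i \<in> invariant_functions k c" if "i \<in> {1..k}" for i
    using that unfolding D_def
    by (intro invariant_functions_intros invariant_trace equivariant_cut) auto
  have S: "S i j \<in> invariant_functions k c" if "i \<in> {1..k}" "j \<in> {1..k}" for i j
    using that unfolding S_def
    by (intro invariant_trace equivariant_cut equivariant_mult equivariant_transfer equivariant_proj) auto
  have sq: "D i A \<noteq> 0 \<longleftrightarrow> trace (cut_monodromy k A i) \<noteq> 2 \<and> trace (cut_monodromy k A i) \<noteq> -2" for i A
  proof -
    have "D i A = (trace (cut_monodromy k A i) - 2) * (trace (cut_monodromy k A i) + 2)"
      by (simp add: D_def algebra_simps)
    then show ?thesis by (simp add: eq_neg_iff_add_eq_0)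
  qed
  have stable_system_iff: "stable_system A \<longleftrightarrow> (\<forall>i\<in>{2..k-2}. D i A \<noteq> 0) \<and> (\<forall>i\<in>{2..k-1}. \<exists>j\<in>{1..k}. S i j A \<noteq> 0)"
    if A: "A \<in> Rep k c" for A
  proof -
    have "stable_pair (c i) (A i) (cut_monodromy k A i) \<longleftrightarrow> (\<exists>j\<in>{1..k}. S i j A \<noteq> 0)" if "i \<in> {2..k-1}" for i
      unfolding S_def by (rule stable_pair_detect[OF A]) (use that in auto)
    then show ?thesis unfolding stable_system_def sq using A by blast
  qed
  \<comment> \<open>For \<open>k = 3\<close> there are no cutting circles and the first intersection
    is \<open>UNIV\<close>; meeting it with \<open>?T\<close> keeps it an open set.\<close>
  have "M_prime k c = (\<Inter>i\<in>{2..k-2}. {x \<in> ?T. D i (orbit_rep x) \<noteq> 0}) \<inter> ?T \<inter>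
      ((\<Inter>i\<in>{2..k-1}. \<Union>j\<in>{1..k}. {x \<in> ?T. S i j (orbit_rep x) \<noteq> 0}) \<inter> ?T)" (is "_ = ?M")
  proof (intro equalityI subsetI)
    fix x assume x: "x \<in> M_prime k c"
    then have "stable_system (orbit_rep x)" "orbit k (orbit_rep x) = x" by (rule stable_system_orbit_rep)+
    moreover from this have "orbit_rep x \<in> Rep k c" by (simp add: stable_system_def)
    ultimately have "x \<in> ?T" "stable_system (orbit_rep x)" "orbit_rep x \<in> Rep k c" by auto
    then show "x \<in> ?M" using stable_system_iff[of "orbit_rep x"] by auto
  next
    fix x assume x: "x \<in> ?M"
    then obtain A where "A \<in> Rep k c" "x = orbit k A" by auto
    then have "orbit_rep x \<in> Rep k c" "orbit k (orbit_rep x) = x" using orbit_rep by auto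
    moreover from this(1) have "stable_system (orbit_rep x)" using x stable_system_iff[of "orbit_rep x"] by auto
    ultimately show "x \<in> M_prime k c" unfolding M_prime_eq by force
  qed
  moreover have "openin (zariski ?X) ?M"
  proof (rule openin_Int)
    show "openin (zariski ?X) ((\<Inter>i\<in>{2..k-2}. {x \<in> ?T. D i (orbit_rep x) \<noteq> 0}) \<inter> ?T)"
      unfolding topspace_character[symmetric]
      by (intro openin_INT) (use nonvanishing D in \<open>auto simp: topspace_character\<close>)
    show "openin (zariski ?X) ((\<Inter>i\<in>{2..k-1}. \<Union>j\<in>{1..k}. {x \<in> ?T. S i j (orbit_rep x) \<noteq> 0}) \<inter> ?T)"
      unfolding topspace_character[symmetric]
      by (intro openin_INT openin_Union) (use nonvanishing S in \<open>auto simp: topspace_character\<close>)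
  qed
  ultimately show ?thesis by simp
qed

end

section \<open>The isomorphism\<close>

lemma Q_pointsI:
  assumes "t \<noteq> 2" "t \<noteq> -2" "(v $ 1)\<^sup>2 + t * v $ 1 * v $ 2 + (v $ 2)\<^sup>2 \<noteq> 0"
  shows "(t, proj_point v) \<in> Q_points"
proof -
  obtain p q where v: "v = vector [p, q]"
    using that[of "v $ 1" "v $ 2"] by (simp add: vec2_eq_iff)
  have "(p, q) \<noteq> (0, 0)" using assms(3) by (auto simp: v)
  then show ?thesis
    unfolding Q_points_def mem_Collect_eq using assms
    by (intro exI[of _ t] exI[of _ p] exI[of _ q]) (simp add: v)
qed

lemma Q_pointsD:
  assumes "z \<in> Q_points"
  shows "fst z \<noteq> 2" "fst z \<noteq> -2" "line_rep (snd z) \<noteq> 0" "proj_point (line_rep (snd z)) = snd z"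
    "(line_rep (snd z) $ 1)\<^sup>2 + fst z * line_rep (snd z) $ 1 * line_rep (snd z) $ 2 + (line_rep (snd z) $ 2)\<^sup>2 \<noteq> 0"
proof -
  from assms obtain t p q where z: "z = (t, proj_point (vector [p, q]))" "(p, q) \<noteq> (0, 0)"
    "t \<noteq> 2" "t \<noteq> -2" "p\<^sup>2 + t * p * q + q\<^sup>2 \<noteq> 0" unfolding Q_points_def by blast
  have v: "vector [p, q] \<noteq> (0 :: complex^2)" using z(2) by (simp add: vec2_eq_iff)
  obtain a where a: "a \<noteq> 0" "line_rep (snd z) = a *s vector [p, q]" using line_rep_scale[OF v] z(1) by auto
  show "fst z \<noteq> 2" "fst z \<noteq> -2" using z by simp_all
  show "line_rep (snd z) \<noteq> 0" "proj_point (line_rep (snd z)) = snd z" using line_rep[OF v] z(1) by simp_all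
  have "(line_rep (snd z) $ 1)\<^sup>2 + fst z * line_rep (snd z) $ 1 * line_rep (snd z) $ 2 + (line_rep (snd z) $ 2)\<^sup>2
      = a\<^sup>2 * (p\<^sup>2 + t * p * q + q\<^sup>2)" unfolding a(2) by (simp add: z(1) power2_eq_square algebra_simps)
  then show "(line_rep (snd z) $ 1)\<^sup>2 + fst z * line_rep (snd z) $ 1 * line_rep (snd z) $ 2 + (line_rep (snd z) $ 2)\<^sup>2 \<noteq> 0"
    using a(1) z(5) by simp
qed

context punctured_sphere
begin

definition cut_line :: "(nat \<Rightarrow> complex^2^2) \<Rightarrow> nat \<Rightarrow> (complex^2) set" where
  "cut_line A i = gluing_line (c (Suc i)) (A (Suc i)) (c i) (A i) (cut_monodromy k A i)"

definition cut_form :: "nat \<Rightarrow> ((nat \<Rightarrow> complex^2^2) \<Rightarrow> complex^2^2) \<Rightarrow> ((nat \<Rightarrow> complex^2^2) \<Rightarrow> complex^2^2)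
    \<Rightarrow> (nat \<Rightarrow> complex^2^2) \<Rightarrow> complex" where
  "cut_form i Y X A = trace (transfer (c (Suc i)) (A (Suc i)) (c i) (A i) (Y A) ** X A)"

text \<open>The identity works when the c-eigenlines of the two neighbouring matrices differ. When
  they coincide, some \<open>A l\<close> moves the common line.\<close>

definition probes :: "((nat \<Rightarrow> complex^2^2) \<Rightarrow> complex^2^2) set" where
  "probes = insert (\<lambda>_. mat 1) ((\<lambda>l A. A l) ` {1..k})"

lemma cut_form_invariant:
  assumes "i \<in> {2..k-2}" "equivariant Y" "X \<in> probes"
  shows "cut_form i Y X \<in> invariant_functions k c"
proof -
  have "equivariant X" using assms(3) by (auto simp: probes_def equivariant_const equivariant_proj)
  then show ?thesis
    unfolding cut_form_def using assms(1)
    by (intro invariant_trace equivariant_mult equivariant_transfer assms) auto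
qed

text \<open>The probe that works may vary with \<open>A\<close>, but every one that works yields the
  same line; the local coordinates are therefore compatible.\<close>

lemma cut_line_stable_system:
  assumes A: "stable_system A" and i: "i \<in> {2..k-2}"
  defines "a X \<equiv> cut_form i (\<lambda>_. mat 1) X A" and "b X \<equiv> cut_form i (\<lambda>A. cut_monodromy k A i) X A"
  shows "\<exists>X\<in>probes. a X \<noteq> 0 \<or> b X \<noteq> 0"
    and "a X \<noteq> 0 \<or> b X \<noteq> 0 \<Longrightarrow> cut_line A i = proj_point (vector [b X, - a X])"
    and "a X \<noteq> 0 \<or> b X \<noteq> 0 \<Longrightarrow>
      (b X)\<^sup>2 + trace (cut_monodromy k A i) * b X * (- a X) + (- a X)\<^sup>2 \<noteq> 0"
proof -
  let ?R = "cut_monodromy k A i"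
  have R: "A \<in> Rep k c" using A by (simp add: stable_system_def)
  have i': "i \<in> {1..k}" "Suc i \<in> {1..k}" "i \<in> {2..k-1}" "Suc i \<in> {2..k-1}" "i < k" using i by auto
  note Ai = Rep_entries[OF R i'(1)] and Ai' = Rep_entries[OF R i'(2)]
  have "stable_pair (c i) (A i) ?R" using A i'(3) unfolding stable_system_def by blast
  note Ai = Ai this
  have "stable_pair (c (Suc i)) (A (Suc i)) (cut_monodromy k A (Suc i))" using A i'(4) unfolding stable_system_def by blast
  then have "stable_pair (c (Suc i)) (A (Suc i)) ?R"
    using stable_pair_mult_iff[OF Ai'(1,3)] cut_monodromy_rec[OF i'(5)] by simp
  note Ai' = Ai' this
  obtain u where u: "u \<noteq> 0" "A i *v u = c i *s u" using eigenvector_exists[OF Ai(1-3)] .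
  obtain u' where u': "u' \<noteq> 0" "A (Suc i) *v u' = c (Suc i) *s u'" using eigenvector_exists[OF Ai'(1-3)] .
  have "det ?R = 1" using i'(5) by (intro det_cut R) simp
  note line = gluing_line[OF Ai Ai' this u u']
  show "cut_line A i = proj_point (vector [b X, - a X])"
    "(b X)\<^sup>2 + trace ?R * b X * (- a X) + (- a X)\<^sup>2 \<noteq> 0" if "a X \<noteq> 0 \<or> b X \<noteq> 0"
    using line(2,3)[of "X A"] that unfolding a_def b_def cut_form_def cut_line_def by blast+
  have "\<exists>X\<in>probes. det (cols (X A *v u') u) \<noteq> 0"
  proof (cases "det (cols u' u) = 0")
    case False
    then show ?thesis by (intro bexI[of _ "\<lambda>_. mat 1"]) (simp_all add: probes_def)
  next
    case True
    then obtain m where m: "u = m *s u'" using det_cols_eq_0D u'(1) by blast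
    obtain j where j: "j \<in> {1..k}" "det (cols (A j *v u') u') \<noteq> 0" using irreducible[OF R u'(1)] by blast
    have "m \<noteq> 0" using m u(1) by auto
    moreover have "det (cols x (m *s y)) = m * det (cols x y)" for x y by (simp add: det_2 algebra_simps)
    ultimately show ?thesis using j by (intro bexI[of _ "\<lambda>A. A j"]) (simp_all add: probes_def m)
  qed
  then show "\<exists>X\<in>probes. a X \<noteq> 0 \<or> b X \<noteq> 0"
    using line(1) unfolding a_def b_def cut_form_def by blast
qed

text \<open>Coordinate \<open>j\<close> belongs to the circle rho_(j+2).\<close>

definition cut_data :: "(nat \<Rightarrow> complex^2^2) set \<Rightarrow> nat \<Rightarrow> complex \<times> (complex^2) set" where
  "cut_data X = (\<lambda>j\<in>{..<k-3}. (trace (cut_monodromy k (orbit_rep X) (Suc (Suc j))),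
     cut_line (orbit_rep X) (Suc (Suc j))))"

lemma cut_data_Q:
  assumes "X \<in> M_prime k c" "j < k - 3"
  shows "(trace (cut_monodromy k (orbit_rep X) (Suc (Suc j))), cut_line (orbit_rep X) (Suc (Suc j))) \<in> Q_points"
proof -
  note A = stable_system_orbit_rep(1)[OF assms(1)]
  have i: "Suc (Suc j) \<in> {2..k-2}" using assms(2) by auto
  obtain Y where Y: "cut_form (Suc (Suc j)) (\<lambda>_. mat 1) Y (orbit_rep X) \<noteq> 0 \<or>
    cut_form (Suc (Suc j)) (\<lambda>A. cut_monodromy k A (Suc (Suc j))) Y (orbit_rep X) \<noteq> 0"
    using cut_line_stable_system(1)[OF A i] by blast
  have "trace (cut_monodromy k (orbit_rep X) (Suc (Suc j))) \<noteq> 2 \<and>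
      trace (cut_monodromy k (orbit_rep X) (Suc (Suc j))) \<noteq> -2"
    using A i unfolding stable_system_def by blast
  then show ?thesis
    unfolding cut_line_stable_system(2)[OF A i Y] using cut_line_stable_system(3)[OF A i Y]
    by (intro Q_pointsI) simp_all
qed

lemma M_prime_subset: "M_prime k c \<subseteq> orbit k ` Rep k c"
  unfolding M_prime_eq stable_system_def by auto

lemma topspace_M_prime: "topspace (zariski (open_subvariety (character_variety k c) (M_prime k c))) = M_prime k c"
  using M_prime_subset by (auto simp: open_subvariety_def topspace_character)

lemma morphism_cut_data:
  "morphism (open_subvariety (character_variety k c) (M_prime k c)) (power_variety Q_variety (k - 3)) cut_data"
proof -
  let ?X = "open_subvariety (character_variety k c) (M_prime k c)" and ?M = "M_prime k c"
  interpret function_sheaf ?X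
    by (rule function_sheaf_open_subvariety[OF function_sheaf_character openin_M_prime])
  have M: "openin (zariski ?X) ?M" using openin_topspace[of "zariski ?X"] by (simp add: topspace_M_prime)
  have reg: "(\<lambda>X. f (orbit_rep X)) \<in> regular ?X ?M" if "f \<in> invariant_functions k c" for f
    using regular_character[OF that M_prime_subset] by (simp add: open_subvariety_def)
  have trace_reg: "(\<lambda>X. trace (cut_monodromy k (orbit_rep X) (Suc (Suc j)))) \<in> regular ?X ?M" if "j < k - 3" for j
    by (rule reg[OF invariant_trace[OF equivariant_cut]]) (use that in auto)
  show ?thesis
  proof (rule morphism_into_power)
    fix j assume j: "j < k - 3"
    let ?t = "\<lambda>X. trace (cut_monodromy k (orbit_rep X) (Suc (Suc j)))"
    let ?l = "\<lambda>X. cut_line (orbit_rep X) (Suc (Suc j))"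
    have i: "Suc (Suc j) \<in> {2..k-2}" using j by auto
    have "morphism ?X (open_subvariety (product_variety affine_line projective_line) Q_points) (\<lambda>X. (?t X, ?l X))"
    proof (rule morphism_into_product)
      show "morphism ?X affine_line ?t"
        by (rule morphism_into_affine_line) (simp only: topspace_M_prime trace_reg[OF j])
      show "morphism ?X projective_line ?l"
      proof (rule morphism_into_projective_line)
        fix X assume "X \<in> topspace (zariski ?X)"
        then have X: "X \<in> ?M" by (simp add: topspace_M_prime)
        define a where "a Y X = cut_form (Suc (Suc j)) (\<lambda>_. mat 1) Y (orbit_rep X)" for Y X
        define b where "b Y X = cut_form (Suc (Suc j)) (\<lambda>A. cut_monodromy k A (Suc (Suc j))) Y (orbit_rep X)" for Y X
        obtain Y where Y: "Y \<in> probes" "a Y X \<noteq> 0 \<or> b Y X \<noteq> 0"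
          using cut_line_stable_system(1)[OF stable_system_orbit_rep(1)[OF X] i] unfolding a_def b_def by blast
        have ra: "a Y \<in> regular ?X ?M" unfolding a_def
          by (intro reg cut_form_invariant i equivariant_const Y)
        have rb: "b Y \<in> regular ?X ?M" unfolding b_def
          by (intro reg cut_form_invariant i equivariant_cut Y) (use i in auto)
        \<comment> \<open>The probe that works at \<open>X\<close> works on all of
          \<open>?V\<close>, which gives homogeneous coordinates of the line by regular functions
          there.\<close>
        let ?V = "{X \<in> ?M. a Y X \<noteq> 0} \<union> {X \<in> ?M. b Y X \<noteq> 0}"
        have V: "openin (zariski ?X) ?V"
          by (intro openin_Un open_nonvanishing M ra rb)
        have "(\<lambda>X. - a Y X) \<in> regular ?X ?V" "b Y \<in> regular ?X ?V"
          by (rule regular_restrict[OF regular_uminus[OF M ra]] regular_restrict[OF rb]; auto)+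
        moreover have "vector [b Y Z, - a Y Z] \<noteq> (0 :: complex^2) \<and> ?l Z = proj_point (vector [b Y Z, - a Y Z])"
          if "Z \<in> ?V" for Z
        proof -
          have Z: "Z \<in> ?M" "a Y Z \<noteq> 0 \<or> b Y Z \<noteq> 0" using that by auto
          then show ?thesis
            using cut_line_stable_system(2)[OF stable_system_orbit_rep(1)[OF Z(1)] i, of Y]
            by (auto simp: a_def b_def vec2_eq_iff)
        qed
        moreover have "X \<in> ?V" using X Y(2) by auto
        ultimately show "\<exists>V f g. openin (zariski ?X) V \<and> X \<in> V \<and> f \<in> regular ?X V \<and> g \<in> regular ?X V \<and>
          (\<forall>y\<in>V. vector [f y, g y] \<noteq> (0 :: complex^2) \<and> ?l y = proj_point (vector [f y, g y]))"
          using V by (intro exI[of _ ?V] exI[of _ "b Y"] exI[of _ "\<lambda>X. - a Y X"]) simp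
      qed
    qed (use cut_data_Q j topspace_M_prime in auto)
    then show "morphism ?X Q_variety (\<lambda>X. cut_data X j)" using j by (simp add: cut_data_def Q_variety_def)
  qed (simp add: cut_data_def)
qed

section \<open>The inverse map by gluing\<close>

definition trace_data :: "(nat \<Rightarrow> complex \<times> (complex^2) set) \<Rightarrow> nat \<Rightarrow> complex" where
  "trace_data x i = (if i = 1 then c 1 + 1 / c 1 else if i = k - 1 then c k + 1 / c k else fst (x (i - 2)))"

text \<open>
  The entry at \<open>k - 1\<close> only enters an auxiliary last frame; any vector with an invertible
  transition matrix would do.
\<close>

definition gluing_data :: "(nat \<Rightarrow> complex \<times> (complex^2) set) \<Rightarrow> nat \<Rightarrow> complex^2" where
  "gluing_data x i = (if i \<in> {2..k-2} then line_rep (snd (x (i - 2))) else vector [1, 0])"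

definition glue :: "(nat \<Rightarrow> complex \<times> (complex^2) set) \<Rightarrow> nat \<Rightarrow> complex^2^2" where
  "glue x = build (trace_data x) (gluing_data x)"

lemma data_Q:
  assumes "x \<in> PiE {..<k-3} (\<lambda>_. Q_points)" "i \<in> {2..k-2}" shows "x (i - 2) \<in> Q_points"
proof -
  have "i - 2 < k - 3" using assms(2) by auto
  then show ?thesis using assms(1) by auto
qed

lemma admissible_data:
  assumes x: "x \<in> PiE {..<k-3} (\<lambda>_. Q_points)"
  shows "admissible (trace_data x) (gluing_data x)"
  unfolding admissible_def
proof (intro conjI ballI)
  show "trace_data x 1 = c 1 + 1 / c 1" "trace_data x (k - 1) = c k + 1 / c k"
    using k by (auto simp: trace_data_def)
  fix i assume i: "i \<in> {2..k-1}"
  show "(gluing_data x i $ 1)\<^sup>2 + trace_data x i * gluing_data x i $ 1 * gluing_data x i $ 2 + (gluing_data x i $ 2)\<^sup>2 \<noteq> 0"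
  proof (cases "i = k - 1")
    case False
    then have "i \<in> {2..k-2}" using i by auto
    with Q_pointsD(5)[OF data_Q[OF x this]] False show ?thesis by (simp add: gluing_data_def trace_data_def)
  qed (use i in \<open>simp add: gluing_data_def\<close>)
qed

lemma stable_system_glue:
  assumes x: "x \<in> PiE {..<k-3} (\<lambda>_. Q_points)"
  shows "stable_system (glue x)"
  unfolding stable_system_def glue_def
proof (intro conjI ballI)
  note adm = admissible_data[OF x]
  show "build (trace_data x) (gluing_data x) \<in> Rep k c" by (rule build_in_Rep[OF adm])
  show "stable_pair (c i) (build (trace_data x) (gluing_data x) i)
      (cut_monodromy k (build (trace_data x) (gluing_data x)) i)" if "i \<in> {2..k-1}" for i
    by (rule build_stable[OF adm that])
  show "trace (cut_monodromy k (build (trace_data x) (gluing_data x)) i) \<noteq> 2"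
    "trace (cut_monodromy k (build (trace_data x) (gluing_data x)) i) \<noteq> -2" if i: "i \<in> {2..k-2}" for i
  proof -
    have "i \<in> {1..<k}" "i \<le> k" "i \<noteq> 1" "i \<noteq> k - 1" using i by auto
    then have "trace (cut_monodromy k (build (trace_data x) (gluing_data x)) i) = fst (x (i - 2))"
      by (simp add: cut_build[OF adm] trace_model_cut[OF adm]) (simp add: trace_data_def)
    then show "trace (cut_monodromy k (build (trace_data x) (gluing_data x)) i) \<noteq> 2"
      "trace (cut_monodromy k (build (trace_data x) (gluing_data x)) i) \<noteq> -2"
      using Q_pointsD(1,2)[OF data_Q[OF x i]] by simp_all
  qed
qed

lemma cut_data_glue:
  assumes x: "x \<in> PiE {..<k-3} (\<lambda>_. Q_points)"
  shows "cut_data (orbit k (glue x)) = x"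
proof
  fix j
  note adm = admissible_data[OF x]
  show "cut_data (orbit k (glue x)) j = x j"
  proof (cases "j < k - 3")
    case False
    then show ?thesis using x by (auto simp: cut_data_def PiE_iff extensional_def)
  next
    case True
    let ?i = "Suc (Suc j)"
    have i: "?i \<in> {2..k-2}" "?i \<le> k" "?i \<in> {1..<k}" "?i \<noteq> 1" "?i \<noteq> k - 1" using True by auto
    have R: "glue x \<in> Rep k c" using stable_system_glue[OF x] by (simp add: stable_system_def)
    obtain P where P: "det P \<noteq> 0" "orbit_rep (orbit k (glue x)) = conj_tuple k P (glue x)"
      using orbit_rep(3)[OF R] by blast
    have "trace (cut_monodromy k (conj_tuple k P (glue x)) ?i) = trace (cut_monodromy k (glue x) ?i)"
      using i by (simp add: cut_monodromy_conj_tuple P(1) trace_conjugate)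
    also have "\<dots> = fst (x j)"
      unfolding glue_def cut_build[OF adm i(2)] trace_model_cut[OF adm i(3)] using i by (simp add: trace_data_def)
    finally have t: "trace (cut_monodromy k (conj_tuple k P (glue x)) ?i) = fst (x j)" .
    have "cut_line (conj_tuple k P (glue x)) ?i = cut_line (glue x) ?i"
      unfolding cut_line_def using i
      by (simp add: cut_monodromy_conj_tuple P(1)) (simp add: conj_tuple_eq conjugate_gluing_line[OF P(1)])
    also have "\<dots> = snd (x j)"
    proof -
      \<comment> \<open>The gluing line is spanned by one vector, so it is determined by the nonzero
        vector that \<open>build\<close> placed in it.\<close>
      obtain w where w: "cut_line (glue x) ?i = proj_point w"
        using cut_line_stable_system(1,2)[OF stable_system_glue[OF x] i(1)] by blast
      have "gluing_data x ?i \<in> cut_line (glue x) ?i"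
        using build_gluing_line[OF adm i(1)] by (simp add: cut_line_def glue_def)
      moreover have v: "gluing_data x ?i = line_rep (snd (x j))" using i(1) by (simp add: gluing_data_def)
      moreover have Q: "x j \<in> Q_points" using data_Q[OF x i(1)] by simp
      ultimately obtain a where a: "line_rep (snd (x j)) = a *s w" unfolding w mem_proj_point by auto
      have "w \<noteq> 0" "a \<noteq> 0" using a Q_pointsD(3)[OF Q] by auto
      then have "proj_point w = proj_point (line_rep (snd (x j)))"
        using a Q_pointsD(3)[OF Q] proj_point_eq_iff by blast
      then show ?thesis using w Q_pointsD(4)[OF Q] by simp
    qed
    finally show ?thesis using True t by (simp add: cut_data_def P(2))
  qed
qed

lemma cut_data_PiE: "X \<in> M_prime k c \<Longrightarrow> cut_data X \<in> PiE {..<k-3} (\<lambda>_. Q_points)"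
  using cut_data_Q by (simp add: cut_data_def)

lemma glue_cut_data:
  assumes X: "X \<in> M_prime k c" shows "orbit k (glue (cut_data X)) = X"
proof -
  define A where "A = orbit_rep X"
  define x where "x = cut_data X"
  have A: "stable_system A" "orbit k A = X" "A \<in> Rep k c"
    using stable_system_orbit_rep[OF X] by (simp_all add: A_def stable_system_def)
  have x: "x \<in> PiE {..<k-3} (\<lambda>_. Q_points)" unfolding x_def by (rule cut_data_PiE[OF X])
  have x_eq: "x (i - 2) = (trace (cut_monodromy k A i), cut_line A i)" if "i \<in> {2..k-2}" for i
  proof -
    have "Suc (Suc (i - 2)) = i" "i - 2 < k - 3" using that by auto
    then show ?thesis by (simp add: x_def cut_data_def A_def)
  qed
  have "\<exists>P. det P \<noteq> 0 \<and> A = conj_tuple k P (build (trace_data x) (gluing_data x))"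
  proof (rule conjugate_to_build[OF A(3) admissible_data[OF x]])
    fix i assume i: "i \<in> {1..<k}"
    show "trace (cut_monodromy k A i) = trace_data x i"
    proof -
      consider "i = 1" | "i = k - 1" "i \<noteq> 1" | "i \<in> {2..k-2}" "i \<noteq> 1" "i \<noteq> k - 1"
      proof -
        have "i = 1 \<or> i = k - 1 \<or> i \<in> {2..k-2}" using i by auto
        then show thesis using that by blast
      qed
      then show ?thesis
      proof cases
        case 1
        have "A 1 ** cut_monodromy k A 1 = mat 1"
          using A(3) cut_monodromy_rec[of 0 k A] k by (simp add: Rep_iff)
        then have "matrix_inv (A 1) = cut_monodromy k A 1" by (rule matrix_inv_eqI)
        moreover have "1 \<in> {1..k}" using k by simp
        note A1 = Rep_entries[OF A(3) this]
        moreover have "trace (matrix_inv (A 1)) = trace (A 1)"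
          by (subst matrix_inv_entries) (simp_all only: A1(1) trace_2 mat22_nth, simp_all)
        ultimately show ?thesis using 1 by (simp add: trace_data_def)
      next
        case 2
        have "cut_monodromy k A (k - 1) = A k"
          using cut_monodromy_rec[of "k - 1" k A] k by (simp add: cut_monodromy_last)
        moreover have "k \<in> {1..k}" using k by simp
        ultimately show ?thesis using 2 Rep_entries(2)[OF A(3), of k] by (simp add: trace_data_def)
      next
        case 3
        then show ?thesis using x_eq[OF 3(1)] by (simp add: trace_data_def)
      qed
    qed
  next
    fix i assume "i \<in> {2..k-1}"
    then show "stable_pair (c i) (A i) (cut_monodromy k A i)" using A(1) unfolding stable_system_def by blast
  next
    fix i assume i: "i \<in> {2..k-2}"
    have v: "gluing_data x i = line_rep (snd (x (i - 2)))" using i by (simp add: gluing_data_def)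
    note Q = Q_pointsD(3,4)[OF data_Q[OF x i]]
    have "line_rep (snd (x (i - 2))) \<in> proj_point (line_rep (snd (x (i - 2))))"
      unfolding mem_proj_point by (rule exI[of _ 1]) simp
    then have "line_rep (snd (x (i - 2))) \<in> cut_line A i" unfolding Q(2) by (simp add: x_eq[OF i])
    then show "gluing_data x i \<noteq> 0 \<and> gluing_data x i \<in>
        gluing_line (c (i + 1)) (A (i + 1)) (c i) (A i) (cut_monodromy k A i)"
      using Q(1) by (simp add: v cut_line_def)
  qed
  then obtain P where "det P \<noteq> 0" "A = conj_tuple k P (glue x)" unfolding glue_def by blast
  then show ?thesis using orbit_conj_tuple A(2) unfolding x_def by metis
qed

end

section \<open>Regularity of the glued representation\<close>

lemma binary_form_coordinate: "binary_form 1 (\<lambda>v. v $ 1)" "binary_form 1 (\<lambda>v. v $ 2)"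
  unfolding binary_form_def
  by (rule exI[of _ "\<lambda>j. if j = 1 then 1 else 0"], simp)
    (rule exI[of _ "\<lambda>j. if j = 0 then 1 else 0"], simp)

definition (in function_sheaf) regular_matrix :: "'a set \<Rightarrow> ('a \<Rightarrow> complex^2^2) \<Rightarrow> bool" where
  "regular_matrix U M \<longleftrightarrow> (\<forall>r s. (\<lambda>x. M x $ r $ s) \<in> regular X U)"

lemma (in function_sheaf) regular_matrix_intros:
  assumes U: "openin (zariski X) U"
  shows "regular_matrix U (\<lambda>_. B)"
    and "regular_matrix U M \<Longrightarrow> regular_matrix U N \<Longrightarrow> regular_matrix U (\<lambda>x. M x ** N x)"
    and "f \<in> regular X U \<Longrightarrow> g \<in> regular X U \<Longrightarrow> h \<in> regular X U \<Longrightarrow> e \<in> regular X U \<Longrightarrow>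
      regular_matrix U (\<lambda>x. mat22 (f x) (g x) (h x) (e x))"
  using regular_const[OF U]
  by (simp_all add: regular_matrix_def forall_2 matrix2_mult_nth regular_add regular_mult)

text \<open>Cramer's rule holds only where the determinant is nonzero, that is, on \<open>U\<close>;
  \<open>regular_cong\<close> bridges the difference elsewhere.\<close>

lemma (in function_sheaf) regular_matrix_inv:
  assumes U: "openin (zariski X) U" and M: "regular_matrix U M" "\<And>x. x \<in> U \<Longrightarrow> det (M x) \<noteq> 0"
  shows "regular_matrix U (\<lambda>x. matrix_inv (M x))"
proof -
  have r: "(\<lambda>x. M x $ r $ s) \<in> regular X U" for r s using M(1) by (simp add: regular_matrix_def)
  have d: "(\<lambda>x. det (M x)) \<in> regular X U"
    unfolding det_2 by (intro regular_diff regular_mult U r)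
  have "regular_matrix U (\<lambda>x. mat22 (M x $ 2 $ 2 / det (M x)) (- M x $ 1 $ 2 / det (M x))
      (- M x $ 2 $ 1 / det (M x)) (M x $ 1 $ 1 / det (M x)))"
    by (intro regular_matrix_intros(3) regular_divide regular_uminus U r d M(2))
  then show ?thesis
    unfolding regular_matrix_def
  proof (intro allI)
    fix r s
    assume "\<forall>r s. (\<lambda>x. mat22 (M x $ 2 $ 2 / det (M x)) (- M x $ 1 $ 2 / det (M x))
      (- M x $ 2 $ 1 / det (M x)) (M x $ 1 $ 1 / det (M x)) $ r $ s) \<in> regular X U"
    then have "(\<lambda>x. mat22 (M x $ 2 $ 2 / det (M x)) (- M x $ 1 $ 2 / det (M x))
      (- M x $ 2 $ 1 / det (M x)) (M x $ 1 $ 1 / det (M x)) $ r $ s) \<in> regular X U" by blast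
    then show "(\<lambda>x. matrix_inv (M x) $ r $ s) \<in> regular X U"
      by (rule regular_cong[OF U]) (simp only: matrix_inv_entries[OF M(2)])
  qed
qed

context punctured_sphere
begin

text \<open>All ingredients are polynomial in the data except the matrix inverses, whose
  determinants admissibility keeps nonzero on \<open>U\<close>.\<close>

lemma regular_build:
  assumes "function_sheaf X" and U: "openin (zariski X) U"
    and t: "\<And>i. i \<in> {1..k-1} \<Longrightarrow> (\<lambda>x. t x i) \<in> regular X U"
    and v: "\<And>i s. i \<in> {2..k-1} \<Longrightarrow> (\<lambda>x. v x i $ s) \<in> regular X U"
    and adm: "\<And>x. x \<in> U \<Longrightarrow> admissible (t x) (v x)" and i: "i \<in> {1..k}"
  shows "function_sheaf.regular_matrix X U (\<lambda>x. build (t x) (v x) i)"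
proof -
  interpret function_sheaf X by fact
  note ring = regular_const[OF U] regular_add regular_mult regular_diff[OF U] regular_uminus[OF U]
  have frame: "regular_matrix U (\<lambda>x. frame (t x) (v x) m)" if "m \<le> k - 2" for m
    using that
  proof (induction m)
    case 0
    show ?case by (simp add: regular_matrix_intros(1)[OF U])
  next
    case (Suc m)
    have tm: "(\<lambda>x. t x (Suc m)) \<in> regular X U" "(\<lambda>x. t x (Suc (Suc m))) \<in> regular X U"
      using Suc.prems by (auto intro!: t)
    have vm: "(\<lambda>x. v x (Suc (Suc m)) $ s) \<in> regular X U" for s using Suc.prems k by (intro v) auto
    have cm: "(\<lambda>x. a / c (Suc (Suc m))) \<in> regular X U" for a by (rule regular_const[OF U])
    have tc: "(\<lambda>x. t x (Suc m) / c (Suc (Suc m))) \<in> regular X U"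
      using regular_mult[OF tm(1) cm[of 1]] by simp
    \<comment> \<open>\<open>p\<close> and \<open>q\<close> are the entries of the first column of
      the transition matrix: the coordinates of the next eigenvector.\<close>
    define p where "p x = v x (Suc (Suc m)) $ 1 + v x (Suc (Suc m)) $ 2 * (t x (Suc (Suc m)) - t x (Suc m) / c (Suc (Suc m)))" for x
    define q where "q x = v x (Suc (Suc m)) $ 2 * (1 / c (Suc (Suc m)))" for x
    have p: "p \<in> regular X U" and q: "q \<in> regular X U"
      unfolding p_def q_def by (intro ring tm vm cm tc)+
    have N: "regular_matrix U (\<lambda>x. normal_quot (c (Suc (Suc m))) (t x (Suc m)) (t x (Suc (Suc m))))"
      unfolding normal_quot_def by (intro regular_matrix_intros(3)[OF U] ring tm cm tc)
    define F where "F x = normal_quot (c (Suc (Suc m))) (t x (Suc m)) (t x (Suc (Suc m)))" for x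
    have F: "(\<lambda>x. F x $ r $ s) \<in> regular X U" for r s
      using N by (simp add: regular_matrix_def F_def)
    have "regular_matrix U (\<lambda>x. mat22 (p x) (F x $ 1 $ 1 * p x + F x $ 1 $ 2 * q x)
        (q x) (F x $ 2 $ 1 * p x + F x $ 2 $ 2 * q x))"
      by (intro regular_matrix_intros(3)[OF U] regular_add regular_mult p q F)
    moreover have "transition (c (Suc (Suc m))) (t x (Suc m)) (t x (Suc (Suc m))) (v x (Suc (Suc m))) =
      mat22 (p x) (F x $ 1 $ 1 * p x + F x $ 1 $ 2 * q x) (q x) (F x $ 2 $ 1 * p x + F x $ 2 $ 2 * q x)" for x
      by (simp add: transition_def Let_def p_def q_def F_def matrix2_eq_iff matrix2_vector_nth
          matrix2_mult_nth mat2_nth normal_quot_def)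
    ultimately have "regular_matrix U
        (\<lambda>x. transition (c (Suc (Suc m))) (t x (Suc m)) (t x (Suc (Suc m))) (v x (Suc (Suc m))))"
      by simp
    then show ?case using Suc by (simp add: regular_matrix_intros(2)[OF U])
  qed
  have model_cut: "regular_matrix U (\<lambda>x. model_cut (t x) (v x) j)" for j
  proof (cases "j \<in> {1..<k}")
    case False
    then have "model_cut (t x) (v x) j = mat 1" for x by (auto simp: model_cut_def)
    then show ?thesis by (simp add: regular_matrix_intros(1)[OF U])
  next
    case True
    then have le: "j - 1 \<le> k - 2" by auto
    have "(\<lambda>x. t x j) \<in> regular X U" using True by (intro t) auto
    then have "regular_matrix U (\<lambda>x. companion (t x j))"
      unfolding companion_def by (intro regular_matrix_intros(3)[OF U] ring)
    then have "regular_matrix U (\<lambda>x. frame (t x) (v x) (j - 1) ** companion (t x j) ** matrix_inv (frame (t x) (v x) (j - 1)))"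
      by (intro regular_matrix_intros(2)[OF U] regular_matrix_inv[OF U] frame le det_frame[OF adm])
    then show ?thesis using True by (simp add: model_cut_def conjugate_def)
  qed
  have "regular_matrix U (\<lambda>x. model_cut (t x) (v x) (i - 1) ** matrix_inv (model_cut (t x) (v x) i))"
    by (intro regular_matrix_intros(2)[OF U] regular_matrix_inv[OF U] model_cut) (simp add: det_model_cut[OF adm])
  then show ?thesis using i by (simp add: build_def)
qed

text \<open>\<open>glue\<close> uses \<open>line_rep\<close>, which is not regular. Dividing by a
  coordinate that does not vanish on the chart gives a regular vector, and by
  \<open>build_scale\<close> the tuple stays the same.\<close>

lemma glue_chart:
  assumes x0: "x0 \<in> PiE {..<k-3} (\<lambda>_. Q_points)"
  shows "\<exists>W B. openin (zariski (power_variety Q_variety (k - 3))) W \<and> x0 \<in> W \<and>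
    (\<forall>i\<in>{1..k}. function_sheaf.regular_matrix (power_variety Q_variety (k - 3)) W (\<lambda>x. B x i)) \<and>
    (\<forall>x\<in>W. glue x = B x)"
proof -
  let ?X = "power_variety Q_variety (k - 3)"
  interpret function_sheaf ?X by (rule function_sheaf_power) (rule regular_Q_restrict)
  \<comment> \<open>\<open>d j\<close> selects a coordinate that is nonzero on the j-th line of
    \<open>x0\<close>, hence on a neighbourhood of it.\<close>
  define d where "d j = (if line_rep (snd (x0 j)) $ 2 \<noteq> 0 then 2 else 1 :: 2)" for j
  define V where "V j = {proj_point v | v. v \<noteq> 0 \<and> v $ d j \<noteq> 0}" for j
  define U where "U j = Q_points \<inter> (UNIV \<times> V j)" for j
  define W where "W = PiE {..<k-3} U"
  define w :: "(nat \<Rightarrow> complex \<times> (complex^2) set) \<Rightarrow> nat \<Rightarrow> complex^2" where "w x i = (if i \<in> {2..k-2} then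
    (1 / line_rep (snd (x (i - 2))) $ d (i - 2)) *s line_rep (snd (x (i - 2))) else vector [1, 0])" for x i
  have form: "binary_form 1 (\<lambda>v. v $ s)" for s :: 2
    using binary_form_coordinate exhaust_2[of s] by auto
  have V: "openin (zariski projective_line) (V j)"
    "(\<lambda>l. line_rep l $ s / line_rep l $ d j) \<in> regular projective_line (V j)" for j s
    unfolding V_def by (rule projective_line_chart[OF form form])+
  have U: "openin (zariski Q_variety) (U j)" "fst \<in> regular Q_variety (U j)"
    "(\<lambda>z. line_rep (snd z) $ s / line_rep (snd z) $ d j) \<in> regular Q_variety (U j)" for j s
    unfolding U_def using Q_variety_cylinder[OF V(1)] V(2) by blast+
  have W: "openin (zariski ?X) W" unfolding W_def by (rule power_variety_cylinder(1)) (rule U)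
  have reg: "(\<lambda>x. f (x j)) \<in> regular ?X W" if "j < k - 3" "f \<in> regular Q_variety (U j)" for f j
    unfolding W_def by (rule power_variety_cylinder(2)[where Y = Q_variety and U = U, OF U(1) that])
  have WQ: "x \<in> PiE {..<k-3} (\<lambda>_. Q_points)" if "x \<in> W" for x
    using that unfolding W_def U_def by (auto simp: PiE_iff)
  have nz: "line_rep (snd (x j)) $ d j \<noteq> 0" if "x \<in> W" "j < k - 3" for x j
  proof -
    have "x j \<in> U j" using that unfolding W_def by (auto simp: PiE_iff)
    then have "snd (x j) \<in> V j" by (auto simp: U_def)
    then obtain v where v: "snd (x j) = proj_point v" "v \<noteq> 0" "v $ d j \<noteq> 0" unfolding V_def by auto
    obtain a where "a \<noteq> 0" "line_rep (snd (x j)) = a *s v" using line_rep_scale[OF v(2)] v(1) by metis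
    then show ?thesis using v(3) by simp
  qed
  have scale: "\<exists>s. s \<noteq> 0 \<and> w x i = s *s gluing_data x i" if "x \<in> W" for x i
  proof (cases "i \<in> {2..k-2}")
    case True
    then have "i - 2 < k - 3" by auto
    from nz[OF \<open>x \<in> W\<close> this] True show ?thesis
      by (intro exI[of _ "1 / line_rep (snd (x (i - 2))) $ d (i - 2)"]) (simp add: w_def gluing_data_def)
  next
    case False
    then have "w x i = 1 *s gluing_data x i" by (auto simp: w_def gluing_data_def)
    then show ?thesis by (intro exI[of _ 1]) simp
  qed
  have adm: "admissible (trace_data x) (w x)" if x: "x \<in> W" for x
  proof -
    have "(w x i $ 1)\<^sup>2 + trace_data x i * w x i $ 1 * w x i $ 2 + (w x i $ 2)\<^sup>2 \<noteq> 0" if i: "i \<in> {2..k-1}" for i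
    proof -
      obtain s where s: "s \<noteq> 0" "w x i = s *s gluing_data x i" using scale[OF x] by blast
      have "(w x i $ 1)\<^sup>2 + trace_data x i * w x i $ 1 * w x i $ 2 + (w x i $ 2)\<^sup>2 = s\<^sup>2 *
        ((gluing_data x i $ 1)\<^sup>2 + trace_data x i * gluing_data x i $ 1 * gluing_data x i $ 2 + (gluing_data x i $ 2)\<^sup>2)"
        by (simp add: s power2_eq_square algebra_simps)
      then show ?thesis using s(1) admissible_data[OF WQ[OF x]] i by (simp add: admissible_def)
    qed
    then show ?thesis using admissible_data[OF WQ[OF x]] by (simp add: admissible_def)
  qed
  have glue: "glue x = build (trace_data x) (w x)" if "x \<in> W" for x
    unfolding glue_def using build_scale[OF admissible_data[OF WQ[OF that]] scale[OF that]] by simp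
  have x0W: "x0 \<in> W"
    unfolding W_def
  proof (rule PiE_I)
    fix j assume "j \<in> {..<k-3}"
    then have Q: "x0 j \<in> Q_points" using x0 by auto
    have "line_rep (snd (x0 j)) $ d j \<noteq> 0"
      using Q_pointsD(3)[OF Q] by (auto simp: d_def vec2_eq_iff)
    then have "snd (x0 j) \<in> V j"
      unfolding V_def using Q_pointsD(3,4)[OF Q] by (auto intro!: exI[of _ "line_rep (snd (x0 j))"])
    then show "x0 j \<in> U j" using Q unfolding U_def by (cases "x0 j") simp
  qed (use x0 in auto)
  have "regular_matrix W (\<lambda>x. build (trace_data x) (w x) i)" if i: "i \<in> {1..k}" for i
  proof (rule regular_build[OF function_sheaf_axioms W _ _ adm i])
    show "(\<lambda>x. trace_data x i) \<in> regular ?X W" if "i \<in> {1..k-1}" for i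
    proof -
      consider "i = 1 \<or> i = k - 1" | "i \<noteq> 1" "i \<noteq> k - 1" by blast
      then show ?thesis
      proof cases
        case 1
        then have "(\<lambda>x. trace_data x i) = (\<lambda>_. if i = 1 then c 1 + 1 / c 1 else c k + 1 / c k)"
          by (auto simp: trace_data_def)
        then show ?thesis using regular_const[OF W] by simp
      next
        case 2
        then have "i - 2 < k - 3" using that by auto
        from reg[OF this U(2)] 2 show ?thesis by (simp add: trace_data_def)
      qed
    qed
    show "(\<lambda>x. w x i $ s) \<in> regular ?X W" if "i \<in> {2..k-1}" for i s
    proof (cases "i \<in> {2..k-2}")
      case True
      then have "i - 2 < k - 3" by auto
      from reg[OF this U(3)[of s]] True show ?thesis by (simp add: w_def)
    next
      case False
      then have "(\<lambda>x. w x i $ s) = (\<lambda>_. vector [1, 0] $ s)" by (auto simp: w_def)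
      then show ?thesis using regular_const[OF W] by simp
    qed
  qed
  then show ?thesis using W x0W glue
    by (intro exI[of _ W] exI[of _ "\<lambda>x. build (trace_data x) (w x)"]) simp
qed

text \<open>Near each point the orbit is represented by a tuple of regular matrices, and pulling
  back a coordinate function means substituting this tuple into a polynomial.\<close>

lemma morphism_glue:
  "morphism (power_variety Q_variety (k - 3)) (open_subvariety (character_variety k c) (M_prime k c))
     (\<lambda>x. orbit k (glue x))"
proof (rule morphism_into_open_subvariety[OF _ openin_M_prime])
  let ?X = "power_variety Q_variety (k - 3)"
  interpret function_sheaf ?X by (rule function_sheaf_power) (rule regular_Q_restrict)
  have top: "topspace (zariski ?X) = PiE {..<k-3} (\<lambda>_. Q_points)"
    by (simp add: topspace_power_variety topspace_Q_variety)
  show in_M: "orbit k (glue x) \<in> M_prime k c" if "x \<in> topspace (zariski ?X)" for x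
    using stable_system_glue that unfolding top M_prime_eq by blast
  show "morphism ?X (character_variety k c) (\<lambda>x. orbit k (glue x))"
    unfolding character_variety_eq
  proof (rule morphism_into_affine)
    fix F assume "F \<in> coordinate_ring"
    then obtain f where f: "f \<in> polynomial_functions k" "\<And>A. A \<in> Rep k c \<Longrightarrow> F (orbit k A) = f A"
      unfolding coordinate_ring_def invariant_functions_def by auto
    have T: "openin (zariski ?X) (topspace (zariski ?X))" by simp
    show "(\<lambda>x. F (orbit k (glue x))) \<in> regular ?X (topspace (zariski ?X))"
    proof (rule regular_local[OF T])
      fix x assume "x \<in> topspace (zariski ?X)"
      then have "x \<in> PiE {..<k-3} (\<lambda>_. Q_points)" unfolding top .
      from glue_chart[OF this] obtain W B where W: "openin (zariski ?X) W" "x \<in> W"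
        and B: "\<forall>i\<in>{1..k}. regular_matrix W (\<lambda>x. B x i)" "\<forall>x\<in>W. glue x = B x"
        by (elim exE conjE)
      have "(\<lambda>x. f (B x)) \<in> regular ?X W"
        by (rule regular_generated_algebra[OF W(1) _ f(1)[unfolded polynomial_functions_def]])
          (use B(1) in \<open>auto simp: regular_matrix_def\<close>)
      moreover have "F (orbit k (glue y)) = f (B y)" if "y \<in> topspace (zariski ?X) \<inter> W" for y
      proof -
        have "glue y \<in> Rep k c" using stable_system_glue that unfolding top stable_system_def by blast
        then show ?thesis using f(2) B(2) that by simp
      qed
      ultimately show "\<exists>V g. openin (zariski ?X) V \<and> x \<in> V \<and> g \<in> regular ?X V \<and>
          (\<forall>y\<in>topspace (zariski ?X) \<inter> V. F (orbit k (glue y)) = g y)"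
        using W by (intro exI[of _ W] exI[of _ "\<lambda>x. f (B x)"]) simp
    qed
  qed (use in_M M_prime_subset one_in_coordinate_ring in auto)
qed

end

theorem theorem10p6:
  fixes k :: nat and c :: "nat \<Rightarrow> complex"
  assumes "k \<ge> 3"
    and "\<And>i. i \<in> {1..k} \<Longrightarrow> c i \<noteq> 0 \<and> c i \<noteq> 1 \<and> c i \<noteq> -1"
    and "generic_eigenvalues k c"
  shows "openin (zariski (character_variety k c)) (M_prime k c) \<and>
         isomorphic_varieties
           (open_subvariety (character_variety k c) (M_prime k c))
           (power_variety Q_variety (k - 3))"
proof -
  interpret punctured_sphere k c using assms by unfold_locales
  show ?thesis
    unfolding isomorphic_varieties_def
    using openin_M_prime morphism_cut_data morphism_glue glue_cut_data cut_data_glue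
    by (intro conjI exI[of _ cut_data] exI[of _ "\<lambda>x. orbit k (glue x)"])
      (simp_all add: topspace_M_prime topspace_power_variety topspace_Q_variety)
qed

end
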